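(* Let $(Y(t))_{t\in\mathbb{R}^d}$ be a causal CARMA$(p,q)$ random field driven by a homogeneous Lévy basis $\Lambda$ with finite second moment and variance $\kappa_2$. Let $a_i(z)=\sum_{j=0}^p a_{i,j}z^{p-j}$ (with $a_{i,0}=1$), $i=1,\dots,d$, be the monic polynomials whose companion matrices are $A_1,\dots,A_d$. Then the spectral density $f$ of $Y$ has the representation $$f(\omega)=\frac{\kappa_2}{(2\pi)^d}\left|\frac{Q(\mathrm{i}\omega)}{P(\mathrm{i}\omega)}\right|^2,\quad\omega\in\mathbb{R}^d,$$ with polynomials $$P(z)=a_1(z_1)\cdots a_d(z_d),\qquad Q(z)=b^\top Q_1(z_1)\cdots Q_d(z_d)\,\mathbf e_p,$$ and matrix polynomials $Q_i(z)=a_i(z)(zI_p-A_i)^{-1}\in M_p(\mathbb{R}[z])$. For each $i=1,\dots,d$, the $(k,l)$-entry of $Q_i$ is given by $$Q_{i,k,l}(z)=\begin{cases} z^{p-1+k-l}+\sum_{j=1}^{p-l}a_{i,j}z^{p-1-j+k-l}, & k\le l,\\ -\sum_{j=p-l+1}^{p}a_{i,j}z^{p-1-j+k-l}, & k>l.\end{cases}$$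
   Context: Homogeneous Lévy basis: an infinitely divisible, independently scattered random measure $\Lambda$ on $\mathbb{R}^d$ with $\mathbb{E}[e^{\mathrm{i}u\Lambda(B)}]=\exp\{\mathrm{Leb}(B)(\mathrm{i}\beta u-\tfrac12\sigma^2u^2+\int_{\mathbb{R}}(e^{\mathrm{i}uz}-1-\mathrm{i}uz\mathbf 1_{\{|z|<1\}})\,\nu(dz))\}$ for bounded Borel sets $B$; its characteristic triplet is $(\beta,\sigma^2,\nu)$. It has finite second moment iff $\int z^2\nu(dz)<\infty$, and then its variance is $\kappa_2=\sigma^2+\int z^2\nu(dz)$. Stochastic integrals are in the sense of Rajput and Rosinski. Causal CARMA$(p,q)$ random field: let $0\le q<p$ be integers, $b=(b_0,\dots,b_{p-1})^\top\in\mathbb{R}^p$ with $b_q\ne0$ and $b_i=0$ for $i>q$, $\mathbf e_p=(0,\dots,0,1)^\top\in\mathbb{R}^p$, and for $i=1,\dots,d$ let $A_i\in\mathbb{R}^{p\times p}$ be the companion matrix (ones on the superdiagonal, last row $(-a_{i,p},\dots,-a_{i,1})$, other entries $0$) of a monic real polynomial $a_i(z)=z^p+a_{i,1}z^{p-1}+\dots+a_{i,p}$ all of whose roots have strictly negative real parts. With $\Lambda$ a homogeneous Lévy basis with $\int\log(|z|)^d\mathbf 1_{\{|z|>1\}}\nu(dz)<\infty$, $$Y(t)=\int_{-\infty}^{t_1}\cdots\int_{-\infty}^{t_d}b^\top e^{A_1(t_1-s_1)}\cdots e^{A_d(t_d-s_d)}\mathbf e_p\,\Lambda(ds),\quad t\in\mathbb{R}^d.$$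 The spectral density $f$ of $Y$ is the function with $\mathrm{Cov}[Y(t),Y(0)]=\int_{\mathbb{R}^d}e^{\mathrm{i}\omega\cdot t}f(\omega)\,d\omega$. $M_p(\mathbb{R}[z])$ is the space of $p\times p$ matrix polynomials, $I_p$ the identity matrix, and $\mathrm{i}$ the imaginary unit when it is not an index. *)

theory Defs
  imports
    "HOL-Probability.Probability"
    "HOL-Computational_Algebra.Polynomial_Factorial"
    "Jordan_Normal_Form.Char_Poly"
begin

text \<open>Points of \<open>\<real>\<^sup>d\<close> have type \<open>real^'d\<close>, with \<open>d = CARD('d)\<close>; the linear order on \<open>'d\<close> fixes the
  order of the factors in non-commuting matrix products over the coordinates. The \<open>p \<times> p\<close> matrices,
  where \<open>p\<close> is a number, are those of \<open>Jordan_Normal_Form\<close>, indexed from 0.\<close>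

no_notation vec_nth (infixl "$" 90)
hide_const (open) Finite_Cartesian_Product.mat Finite_Cartesian_Product.vec

section \<open>Homogeneous L\'evy bases\<close>

definition bounded_borel :: "'a::euclidean_space set set" where
  "bounded_borel = {B. B \<in> sets borel \<and> bounded B}"

definition levy_measure :: "real measure \<Rightarrow> bool" where
  "levy_measure \<nu> \<longleftrightarrow> sets \<nu> = sets borel \<and> emeasure \<nu> {0} = 0 \<and>
     (\<integral>\<^sup>+ z. ennreal (min 1 (z\<^sup>2)) \<partial>\<nu>) < \<infinity>"

definition levy_exponent :: "real \<Rightarrow> real \<Rightarrow> real measure \<Rightarrow> real \<Rightarrow> complex" where
  "levy_exponent \<beta> \<sigma> \<nu> u =
     \<i> * of_real (\<beta> * u) - of_real (\<sigma>\<^sup>2 * u\<^sup>2 / 2) +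
     (\<integral> z. (exp (\<i> * of_real (u * z)) - 1 - \<i> * of_real (u * z * indicator {z. \<bar>z\<bar> < 1} z)) \<partial>\<nu>)"

definition infinitely_divisible :: "real measure \<Rightarrow> bool" where
  "infinitely_divisible \<mu> \<longleftrightarrow>
     (\<forall>n>0. \<exists>\<mu>'. real_distribution \<mu>' \<and> (\<forall>u. char \<mu> u = char \<mu>' u ^ n))"

text \<open>The triplet is \<open>(\<beta>, \<sigma>\<^sup>2, \<nu>)\<close>; the values of \<open>\<Lambda>\<close> outside \<open>bounded_borel\<close> are irrelevant.\<close>

definition homogeneous_levy_basis ::
  "'w measure \<Rightarrow> ('a::euclidean_space set \<Rightarrow> 'w \<Rightarrow> real) \<Rightarrow> real \<Rightarrow> real \<Rightarrow> real measure \<Rightarrow> bool" where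
  "homogeneous_levy_basis M \<Lambda> \<beta> \<sigma> \<nu> \<longleftrightarrow>
     levy_measure \<nu> \<and>
     (\<forall>B \<in> bounded_borel. \<Lambda> B \<in> borel_measurable M \<and>
        infinitely_divisible (distr M borel (\<Lambda> B)) \<and>
        (\<forall>u. char (distr M borel (\<Lambda> B)) u
             = exp (of_real (measure lborel B) * levy_exponent \<beta> \<sigma> \<nu> u))) \<and>
     (\<forall>B :: nat \<Rightarrow> 'a set. range B \<subseteq> bounded_borel \<longrightarrow> disjoint_family B \<longrightarrow>
        prob_space.indep_vars M (\<lambda>_. borel) (\<lambda>n. \<Lambda> (B n)) UNIV \<and>
        ((\<Union>n. B n) \<in> bounded_borel \<longrightarrow>
           (AE \<omega> in M. (\<lambda>n. \<Lambda> (B n) \<omega>) sums \<Lambda> (\<Union>n. B n) \<omega>)))"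

definition levy_finite_second_moment :: "real measure \<Rightarrow> bool" where
  "levy_finite_second_moment \<nu> \<longleftrightarrow> (\<integral>\<^sup>+ z. ennreal (z\<^sup>2) \<partial>\<nu>) < \<infinity>"

definition levy_variance :: "real \<Rightarrow> real measure \<Rightarrow> real" where
  "levy_variance \<sigma> \<nu> = \<sigma>\<^sup>2 + (\<integral> z. z\<^sup>2 \<partial>\<nu>)"

section \<open>Stochastic integrals in the sense of Rajput and Rosinski\<close>

definition levy_simple :: "('a::euclidean_space \<Rightarrow> real) \<Rightarrow> bool" where
  "levy_simple g \<longleftrightarrow> g \<in> borel_measurable borel \<and> finite (range g) \<and> bounded {s. g s \<noteq> 0}"

definition levy_simple_integral ::
  "('a::euclidean_space set \<Rightarrow> 'w \<Rightarrow> real) \<Rightarrow> ('a \<Rightarrow> real) \<Rightarrow> 'a set \<Rightarrow> 'w \<Rightarrow> real" where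
  "levy_simple_integral \<Lambda> g A \<omega> = (\<Sum>y \<in> range g - {0}. y * \<Lambda> (A \<inter> g -` {y}) \<omega>)"

definition converges_in_probability ::
  "'w measure \<Rightarrow> (nat \<Rightarrow> 'w \<Rightarrow> real) \<Rightarrow> ('w \<Rightarrow> real) \<Rightarrow> bool" where
  "converges_in_probability M X Z \<longleftrightarrow>
     Z \<in> borel_measurable M \<and>
     (\<forall>\<epsilon>>0. (\<lambda>n. measure M {\<omega> \<in> space M. \<bar>X n \<omega> - Z \<omega>\<bar> > \<epsilon>}) \<longlonglongrightarrow> 0)"

text \<open>\<open>X\<close> is a version of \<open>\<integral> f d\<Lambda>\<close>. The control measure of a homogeneous L\'evy basis is a constant
  multiple of Lebesgue measure, hence the \<open>lborel\<close>-a.e. convergence.\<close>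

definition has_levy_integral ::
  "'w measure \<Rightarrow> ('a::euclidean_space set \<Rightarrow> 'w \<Rightarrow> real) \<Rightarrow> ('a \<Rightarrow> real) \<Rightarrow> ('w \<Rightarrow> real) \<Rightarrow> bool" where
  "has_levy_integral M \<Lambda> f X \<longleftrightarrow>
     f \<in> borel_measurable borel \<and>
     (\<exists>g :: nat \<Rightarrow> 'a \<Rightarrow> real.
        (\<forall>n. levy_simple (g n)) \<and>
        (AE s in lborel. (\<lambda>n. g n s) \<longlonglongrightarrow> f s) \<and>
        (\<forall>A \<in> sets borel. \<exists>Z.
           converges_in_probability M (\<lambda>n. levy_simple_integral \<Lambda> (g n) A) Z) \<and>
        converges_in_probability M (\<lambda>n. levy_simple_integral \<Lambda> (g n) UNIV) X)"

section \<open>Causal CARMA random fields\<close>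

definition mat_exp :: "real mat \<Rightarrow> real mat" where
  "mat_exp A = Matrix.mat (dim_row A) (dim_row A)
     (\<lambda>(k, l). \<Sum>n. ((A ^\<^sub>m n) $$ (k, l)) / fact n)"

definition companion :: "real poly \<Rightarrow> real mat" where
  "companion a = (let p = degree a in Matrix.mat p p
     (\<lambda>(k, l). if k = p - 1 then - coeff a l else if l = k + 1 then 1 else 0))"

definition coord_mat_prod :: "nat \<Rightarrow> ('d::{finite,linorder} \<Rightarrow> 'a::semiring_1 mat) \<Rightarrow> 'a mat" where
  "coord_mat_prod p N = foldr (\<lambda>i R. N i * R) (sorted_list_of_set UNIV) (1\<^sub>m p)"

definition carma_kernel ::
  "nat \<Rightarrow> real Matrix.vec \<Rightarrow> ('d::{finite,linorder} \<Rightarrow> real poly) \<Rightarrow> real^'d::{finite,linorder} \<Rightarrow> real" where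
  "carma_kernel p b a r = scalar_prod b
     (coord_mat_prod p (\<lambda>i. mat_exp (vec_nth r i \<cdot>\<^sub>m companion (a i))) *\<^sub>v unit_vec p (p - 1))"

definition carma_parameters ::
  "nat \<Rightarrow> nat \<Rightarrow> real Matrix.vec \<Rightarrow> ('d \<Rightarrow> real poly) \<Rightarrow> bool" where
  "carma_parameters p q b a \<longleftrightarrow>
     q < p \<and> b \<in> carrier_vec p \<and> vec_index b q \<noteq> 0 \<and> (\<forall>i<p. i > q \<longrightarrow> vec_index b i = 0) \<and>
     (\<forall>i. degree (a i) = p \<and> lead_coeff (a i) = 1 \<and>
        (\<forall>z::complex. poly (map_poly of_real (a i)) z = 0 \<longrightarrow> Re z < 0))"

definition causal_carma_field ::
  "'w measure \<Rightarrow> ((real^'d::{finite,linorder}) set \<Rightarrow> 'w \<Rightarrow> real) \<Rightarrow> real \<Rightarrow> real \<Rightarrow> real measure \<Rightarrow>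
   nat \<Rightarrow> nat \<Rightarrow> real Matrix.vec \<Rightarrow> ('d \<Rightarrow> real poly) \<Rightarrow> (real^'d::{finite,linorder} \<Rightarrow> 'w \<Rightarrow> real) \<Rightarrow> bool" where
  "causal_carma_field M \<Lambda> \<beta> \<sigma> \<nu> p q b a Y \<longleftrightarrow>
     homogeneous_levy_basis M \<Lambda> \<beta> \<sigma> \<nu> \<and>
     (\<integral>\<^sup>+ z. ennreal (ln \<bar>z\<bar> ^ CARD('d) * indicator {z. \<bar>z\<bar> > 1} z) \<partial>\<nu>) < \<infinity> \<and>
     carma_parameters p q b a \<and>
     (\<forall>t. has_levy_integral M \<Lambda>
        (\<lambda>s. if \<forall>i. vec_nth s i \<le> vec_nth t i then carma_kernel p b a (t - s) else 0) (Y t))"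

section \<open>Spectral density\<close>

definition covariance :: "'w measure \<Rightarrow> ('w \<Rightarrow> real) \<Rightarrow> ('w \<Rightarrow> real) \<Rightarrow> real" where
  "covariance M X Z =
     (\<integral> \<omega>. (X \<omega> - integral\<^sup>L M X) * (Z \<omega> - integral\<^sup>L M Z) \<partial>M)"

text \<open>Square integrability of \<open>Y\<close> and integrability of \<open>f\<close> are required explicitly, since the Bochner
  integral of a non-integrable function is 0.\<close>

definition is_spectral_density ::
  "'w measure \<Rightarrow> ('a::euclidean_space \<Rightarrow> 'w \<Rightarrow> real) \<Rightarrow> ('a \<Rightarrow> real) \<Rightarrow> bool" where
  "is_spectral_density M Y f \<longleftrightarrow>
     (\<forall>t. Y t \<in> borel_measurable M \<and> integrable M (\<lambda>\<omega>. (Y t \<omega>)\<^sup>2)) \<and>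
     integrable lborel f \<and>
     (\<forall>t. complex_of_real (covariance M (Y t) (Y 0)) =
          (\<integral> w. exp (\<i> * of_real (inner w t)) * of_real (f w) \<partial>lborel))"

definition imag_vec :: "real^'d \<Rightarrow> complex^'d" where
  "imag_vec w = (\<chi> i. \<i> * of_real (vec_nth w i))"

text \<open>\<open>Q = a(z) (z I - A)\<^sup>-\<^sup>1\<close> for the companion matrix \<open>A\<close> of \<open>a\<close>: the inverse is taken over the field
  of rational functions, and the product is required to have polynomial entries.\<close>

definition is_scaled_resolvent :: "real poly \<Rightarrow> real poly mat \<Rightarrow> bool" where
  "is_scaled_resolvent a Q \<longleftrightarrow>
     (let p = degree a; zI_A = map_mat to_fract (char_poly_matrix (companion a)) in
      Q \<in> carrier_mat p p \<and>
      (\<exists>R \<in> carrier_mat p p. inverts_mat zI_A R \<and> inverts_mat R zI_A \<and>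
         map_mat to_fract Q = to_fract a \<cdot>\<^sub>m R))"

definition carma_P :: "('d::finite \<Rightarrow> real poly) \<Rightarrow> complex^'d \<Rightarrow> complex" where
  "carma_P a z = (\<Prod>i\<in>UNIV. poly (map_poly of_real (a i)) (vec_nth z i))"

definition carma_Q ::
  "nat \<Rightarrow> real Matrix.vec \<Rightarrow> ('d::{finite,linorder} \<Rightarrow> real poly mat) \<Rightarrow> complex^'d::{finite,linorder} \<Rightarrow> complex" where
  "carma_Q p b Qs z = scalar_prod (map_vec of_real b)
     (coord_mat_prod p (\<lambda>i. map_mat (\<lambda>r. poly (map_poly of_real r) (vec_nth z i)) (Qs i))
        *\<^sub>v unit_vec p (p - 1))"

text \<open>\<open>acoeff a j\<close> is \<open>a\<^sub>j\<close> in \<open>a(z) = \<Sum>j=0..p. a\<^sub>j z\<^sup>p\<^sup>-\<^sup>j\<close>.\<close>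

definition acoeff :: "real poly \<Rightarrow> nat \<Rightarrow> real" where
  "acoeff a j = coeff a (degree a - j)"

end

theory Submission
  imports Defs
begin

text \<open>If simple functions \<open>g\<^sub>n\<close> approximate \<open>f\<close>, then \<open>\<bar>E exp (iu \<integral>\<^sub>A g\<^sub>n d\<Lambda>)\<bar> = exp (- \<integral>\<^sub>A \<psi>(u g\<^sub>n(s)) ds)\<close>, where
  \<open>- \<psi>\<close> is the real part of the L\'evy exponent. These numbers converge for every Borel set \<open>A\<close>, so a
  Vitali--Hahn--Saks argument yields \<open>\<bar>E exp (iu \<integral> f d\<Lambda>)\<bar> = exp (- \<integral> \<psi>(u f(s)) ds)\<close>. Since
  \<open>\<psi>(u) / u\<^sup>2 \<longrightarrow> \<kappa>\<^sub>2 / 2\<close> as \<open>u \<longrightarrow> 0\<close>, symmetrization gives \<open>Var (\<integral> f d\<Lambda>) = \<kappa>\<^sub>2 \<integral> f\<^sup>2\<close>, and polarization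
  gives the covariances; neither the drift nor the \<open>L\<^sup>2\<close> theory of the integral is needed.

  The kernel is a finite sum of products of functions of one coordinate, namely of entries of the
  matrices \<open>exp (x A\<^sub>i)\<close>. These decay exponentially, and their Fourier transforms are the entries of
  \<open>(i\<omega> - A\<^sub>i)\<^sup>-\<^sup>1 = Q\<^sub>i(i\<omega>) / a\<^sub>i(i\<omega>)\<close>. Hence the covariance function is the Fourier transform of the claimed
  density by Parseval's identity in one dimension.\<close>

section \<open>Setwise convergence of integrals\<close>

text \<open>The definition of the integral provides a.e. convergence of the approximations
  \<open>g n\<close> and convergence in probability of their integrals, but no dominating function.
  Fatou alone would leave an inequality, because mass of \<open>levy_psi (u * g n s)\<close> might
  concentrate or escape to infinity; convergence over every Borel set excludes both. Moduli suffice
  because a variance does not see the phase.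

  On the Fourier side the obstacle is the jump of the causal entries at 0: their transforms decay in
  general only like 1/|w|, so inversion cannot be applied to the kernel itself. It is applied to
  correlations of two entries, which are continuous and whose transforms are products of two
  transforms, hence of order 1/w^2.

  The companion matrices need not commute, so the kernel is not a single product over the
  coordinates. Its expansion into entries is chosen once for arbitrary matrices, so that the same
  coefficients describe the kernel and Q.\<close>

lemma (in sigma_finite_measure) integral_tendsto_0_if_setwise_convergent:
  fixes k :: "nat \<Rightarrow> 'a \<Rightarrow> real"
  assumes int: "\<And>n. integrable M (k n)" and nn: "\<And>n x. 0 \<le> k n x"
    and lim: "AE x in M. (\<lambda>n. k n x) \<longlonglongrightarrow> 0"
    and conv: "\<And>A. A \<in> sets M \<Longrightarrow> convergent (\<lambda>n. exp (- (\<integral>x. indicator A x * k n x \<partial>M)))"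
  shows "(\<lambda>n. \<integral>x. k n x \<partial>M) \<longlonglongrightarrow> 0"
proof (rule ccontr)
  \<comment> \<open>Gliding hump: otherwise there are disjoint sets \<open>B j\<close> such that \<open>k (n j)\<close> has almost all its mass on \<open>B j\<close>,
    and its integrals over the union of the \<open>B (2 * i)\<close> oscillate.\<close>
  assume "\<not> ?thesis"
  moreover have int0: "0 \<le> (\<integral>x. k n x \<partial>M)" for n
    using nn by simp
  ultimately obtain \<epsilon> where \<epsilon>: "0 < \<epsilon>" and eps: "\<And>N. \<exists>n\<ge>N. \<epsilon> \<le> (\<integral>x. k n x \<partial>M)"
    unfolding lim_sequentially by (auto simp: dist_real_def not_less)
  \<comment> \<open>A positive integrable weight plays the part of a tolerance: on a space of
    infinite measure a constant would not be integrable, whereas \<open>w\<close> makes dominated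
    convergence available on each \<open>G N\<close>.\<close>
  obtain w :: "'a \<Rightarrow> real" where w[measurable]: "w \<in> borel_measurable M"
    and w0: "\<And>x. w x > 0" and wi: "integrable M w"
    by (rule obtain_positive_integrable_function) (rule that; assumption)
  have [measurable]: "k n \<in> borel_measurable M" for n
    using int by simp
  define G where "G N = {x\<in>space M. \<forall>n\<ge>N. k n x \<le> w x}" for N :: nat
  have G[measurable]: "G N \<in> sets M" for N
    unfolding G_def by measurable
  have Gmono: "G m \<subseteq> G n" if "m \<le> n" for m n
    using that unfolding G_def by auto
  have Gin: "AE x in M. \<forall>\<^sub>F N in sequentially. x \<in> G N"
    using lim AE_space
  proof eventually_elim
    case (elim x)
    have "\<forall>\<^sub>F n in sequentially. k n x < w x"
      using elim(1) w0[of x] by (rule order_tendstoD)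
    then obtain N where "\<And>n. n \<ge> N \<Longrightarrow> k n x < w x"
      by (auto simp: eventually_sequentially)
    then have "x \<in> G n" if "n \<ge> N" for n
      using that elim unfolding G_def by (auto intro: less_imp_le)
    then show ?case
      by (auto simp: eventually_sequentially)
  qed
  define I where "I A n = (\<integral>x. indicator A x * k n x \<partial>M)" for A n
  have iA: "integrable M (\<lambda>x. indicator A x * k n x)" if "A \<in> sets M" for A n
    using integrable_mult_indicator[OF that int[of n]] by simp
  have limG: "(\<lambda>n. I (G N) n) \<longlonglongrightarrow> 0" for N
  proof (rule LIMSEQ_offset[of _ N])
    have "(\<lambda>n. I (G N) (n + N)) \<longlonglongrightarrow> (\<integral>x. 0 \<partial>M)"
      unfolding I_def
    proof (rule integral_dominated_convergence[where w=w])
      show "AE x in M. (\<lambda>n. indicator (G N) x * k (n + N) x) \<longlonglongrightarrow> 0"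
        using lim by eventually_elim (auto intro!: tendsto_mult_right_zero LIMSEQ_ignore_initial_segment)
      show "AE x in M. norm (indicator (G N) x * k (n + N) x) \<le> w x" for n
        using w0 nn by (auto simp: G_def indicator_def intro: less_imp_le)
    qed (use wi in auto)
    then show "(\<lambda>n. I (G N) (n + N)) \<longlonglongrightarrow> 0" by simp
  qed
  have limC: "(\<lambda>N. I (space M - G N) n) \<longlonglongrightarrow> 0" for n
  proof -
    have "(\<lambda>N. I (space M - G N) n) \<longlonglongrightarrow> (\<integral>x. 0 \<partial>M)"
      unfolding I_def
    proof (rule integral_dominated_convergence[where w="k n"])
      show "AE x in M. (\<lambda>N. indicator (space M - G N) x * k n x) \<longlonglongrightarrow> 0"
        using Gin
      proof eventually_elim
        case (elim x)
        then have "\<forall>\<^sub>F N in sequentially. indicator (space M - G N) x * k n x = 0"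
          by eventually_elim (auto simp: indicator_def)
        then show ?case by (rule tendsto_eventually)
      qed
    qed (use nn int in \<open>auto simp: indicator_def\<close>)
    then show ?thesis by simp
  qed
  have Imono: "I A n \<le> I B n" if "A \<in> sets M" "B \<in> sets M" "A \<subseteq> B" for A B n
    unfolding I_def using that nn
    by (intro integral_mono iA) (auto simp: indicator_def)
  have Isub: "I A n \<le> I B n + I C n" if "A \<in> sets M" "B \<in> sets M" "C \<in> sets M" "A \<subseteq> B \<union> C" for A B C n
  proof -
    have "I A n \<le> (\<integral>x. indicator B x * k n x + indicator C x * k n x \<partial>M)"
      unfolding I_def using that nn
      by (intro integral_mono iA Bochner_Integration.integrable_add) (auto simp: indicator_def)
    also have "\<dots> = I B n + I C n"
      unfolding I_def using that by (intro Bochner_Integration.integral_add iA)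
    finally show ?thesis .
  qed
  \<comment> \<open>A pair holds an index n of \<open>k\<close> and an index N of \<open>G\<close>.
    The mass on \<open>G N\<close> and the mass outside the next \<open>G\<close> are at most
    \<epsilon>/8 each, so 3\<epsilon>/4 remains on the ring between them; for odd indices the same
    two bounds leave at most \<epsilon>/4 for all the other rings.\<close>
  define P where "P j x \<longleftrightarrow> j \<le> fst x \<and> \<epsilon> \<le> I (space M) (fst x) \<and> I (G (snd x)) (fst x) \<le> \<epsilon>/8"
    for j and x :: "nat \<times> nat"
  define R where "R x y \<longleftrightarrow> fst x < fst y \<and> snd x \<le> snd y \<and> I (space M - G (snd y)) (fst x) \<le> \<epsilon>/8"
    for x y :: "nat \<times> nat"
  have eps': "\<exists>n\<ge>N. \<epsilon> \<le> I (space M) n" for N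
  proof -
    have "I (space M) n = (\<integral>x. k n x \<partial>M)" for n
      unfolding I_def by (intro Bochner_Integration.integral_cong) auto
    then show ?thesis using eps by simp
  qed
  have ex: "\<exists>n. n \<ge> j \<and> P j (n, N)" for j N
  proof -
    have "\<forall>\<^sub>F n in sequentially. I (G N) n < \<epsilon>/8"
      using limG[of N] \<epsilon> by (intro order_tendstoD(2)[where a="\<epsilon>/8"]) auto
    then obtain n0 where "\<And>n. n \<ge> n0 \<Longrightarrow> I (G N) n < \<epsilon>/8"
      by (auto simp: eventually_sequentially)
    moreover obtain n where "n \<ge> max j n0" "\<epsilon> \<le> I (space M) n"
      using eps' by blast
    ultimately show ?thesis
      unfolding P_def by (intro exI[of _ n]) (auto intro: less_imp_le)
  qed
  have "\<exists>f. \<forall>n. P n (f n) \<and> R (f n) (f (Suc n))"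
  proof (rule dependent_nat_choice)
    show "\<exists>x. P 0 x" using ex by blast
    fix x :: "nat \<times> nat" and j
    obtain n N where x: "x = (n, N)" by (cases x)
    have "\<forall>\<^sub>F N' in sequentially. I (space M - G N') n < \<epsilon>/8"
      using limC[of n] \<epsilon> by (intro order_tendstoD(2)[where a="\<epsilon>/8"]) auto
    then have "\<forall>\<^sub>F N' in sequentially. N' \<ge> N \<and> I (space M - G N') n < \<epsilon>/8"
      by (intro eventually_conj eventually_ge_at_top)
    then obtain N' where N': "N' \<ge> N" "I (space M - G N') n < \<epsilon>/8"
      by (auto simp: eventually_sequentially)
    obtain n' where "n' \<ge> max (Suc j) (Suc n)" "P (max (Suc j) (Suc n)) (n', N')"
      using ex by blast
    with N' show "\<exists>y. P (Suc j) y \<and> R x y"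
      unfolding P_def R_def x by (intro exI[of _ "(n', N')"]) auto
  qed
  then obtain f where f: "\<And>j. P j (f j)" "\<And>j. R (f j) (f (Suc j))" by blast
  define n where "n j = fst (f j)" for j
  define N where "N j = snd (f j)" for j
  have n_mono: "strict_mono n"
    unfolding strict_mono_Suc_iff using f(2) by (auto simp: R_def n_def)
  have "incseq N"
    unfolding incseq_Suc_iff using f(2) by (auto simp: R_def N_def)
  then have GN: "G (N i) \<subseteq> G (N j)" if "i \<le> j" for i j
    using that by (auto dest: incseqD intro!: Gmono)
  have n1: "\<epsilon> \<le> I (space M) (n j)" "I (G (N j)) (n j) \<le> \<epsilon>/8"
    "I (space M - G (N (Suc j))) (n j) \<le> \<epsilon>/8" for j
    using f(1)[of j] f(2)[of j] by (auto simp: P_def R_def n_def N_def)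
  define B where "B j = G (N (Suc j)) - G (N j)" for j
  define A where "A = (\<Union>j. B (2 * j))"
  have B[measurable]: "B j \<in> sets M" for j unfolding B_def by measurable
  have A[measurable]: "A \<in> sets M" unfolding A_def by measurable
  have "B i \<inter> B j = {}" if "i < j" for i j
    using GN[of "Suc i" j] that by (auto simp: B_def)
  then have Bdisj: "B i \<inter> B j = {}" if "i \<noteq> j" for i j
    using that by (cases "i < j") (auto simp: not_less_iff_gr_or_eq)
  have Gsp: "G j \<subseteq> space M" for j by (auto simp: G_def)
  have even: "I A (n (2 * j)) \<ge> 3 * \<epsilon> / 4" for j
  proof -
    have "I (space M) (n (2*j)) \<le> I (B (2 * j)) (n (2*j)) + I (space M - B (2*j)) (n (2*j))"
      by (rule Isub) auto
    moreover have "I (space M - B (2*j)) (n (2*j)) \<le> I (G (N (2*j))) (n (2*j)) + I (space M - G (N (Suc (2*j)))) (n (2*j))"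
      by (rule Isub) (auto simp: B_def)
    moreover have "I (B (2 * j)) (n (2*j)) \<le> I A (n (2*j))"
      by (rule Imono) (auto simp: A_def)
    ultimately show ?thesis using n1[of "2*j"] by simp
  qed
  have odd: "I A (n (2 * j + 1)) \<le> \<epsilon> / 4" for j
  proof -
    have "B (2 * i) \<inter> B (2 * j + 1) = {}" for i
      by (rule Bdisj) presburger
    then have "A \<inter> B (2 * j + 1) = {}" unfolding A_def by blast
    moreover have "A \<subseteq> space M" using Gsp by (auto simp: A_def B_def)
    ultimately have "I A (n (2 * j + 1)) \<le> I (G (N (2*j+1))) (n (2*j+1)) + I (space M - G (N (Suc (2*j+1)))) (n (2*j+1))"
      by (intro Isub) (auto simp: B_def)
    then show ?thesis using n1[of "2*j+1"] by simp
  qed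
  obtain l where l: "(\<lambda>i. exp (- I A i)) \<longlonglongrightarrow> l"
    using conv[OF A] unfolding I_def convergent_def by blast
  have "strict_mono (\<lambda>j. n (2 * j))" "strict_mono (\<lambda>j. n (2 * j + 1))"
    using n_mono by (auto simp: strict_mono_def)
  from this[THEN LIMSEQ_subseq_LIMSEQ[OF l]]
  have "(\<lambda>j. exp (- I A (n (2*j)))) \<longlonglongrightarrow> l" "(\<lambda>j. exp (- I A (n (2*j+1)))) \<longlonglongrightarrow> l"
    by (simp_all add: o_def)
  note even_odd = this
  have "l \<le> exp (- (3 * \<epsilon> / 4))"
    by (rule LIMSEQ_le_const2[OF even_odd(1)]) (use even in auto)
  moreover have "exp (- (\<epsilon> / 4)) \<le> l"
    by (rule LIMSEQ_le_const[OF even_odd(2)]) (use odd in auto)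
  ultimately have "exp (- (\<epsilon> / 4)) \<le> exp (- (3 * \<epsilon> / 4))"
    by (rule order_trans[rotated])
  then show False using \<epsilon> by simp
qed

text \<open>A Vitali--Hahn--Saks theorem; the exponential allows setwise limits that are infinite.\<close>

lemma (in sigma_finite_measure) integral_tendsto_if_setwise_convergent:
  fixes k :: "nat \<Rightarrow> 'a \<Rightarrow> real"
  assumes int: "\<And>n. integrable M (k n)" and nn: "\<And>n x. 0 \<le> k n x"
    and int': "integrable M l" and nn': "\<And>x. 0 \<le> l x"
    and lim: "AE x in M. (\<lambda>n. k n x) \<longlonglongrightarrow> l x"
    and conv: "\<And>A. A \<in> sets M \<Longrightarrow> convergent (\<lambda>n. exp (- (\<integral>x. indicator A x * k n x \<partial>M)))"
  shows "(\<lambda>n. \<integral>x. k n x \<partial>M) \<longlonglongrightarrow> (\<integral>x. l x \<partial>M)"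
proof -
  have [measurable]: "k n \<in> borel_measurable M" "l \<in> borel_measurable M" for n
    using int int' by auto
  \<comment> \<open>The negative part \<open>s\<close> of k - l is dominated by l, so dominated
    convergence disposes of it. The positive part satisfies r = k + s - l; it tends to 0 pointwise
    and inherits the convergence of the exponentials, so the preceding lemma applies to it.\<close>
  define r where "r n x = max 0 (k n x - l x)" for n x
  define s where "s n x = max 0 (l x - k n x)" for n x
  have k: "k n x = r n x - s n x + l x" for n x by (auto simp: r_def s_def)
  have ir: "integrable M (r n)" and isn: "integrable M (s n)" for n
    unfolding r_def s_def using int int' by auto
  have limr: "AE x in M. (\<lambda>n. r n x) \<longlonglongrightarrow> 0"
    using lim
  proof eventually_elim
    case (elim x)
    then have "(\<lambda>n. max 0 (k n x - l x)) \<longlonglongrightarrow> max 0 (l x - l x)" by (intro tendsto_intros)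
    then show ?case by (simp add: r_def)
  qed
  have lims: "AE x in M. (\<lambda>n. s n x) \<longlonglongrightarrow> 0"
    using lim
  proof eventually_elim
    case (elim x)
    then have "(\<lambda>n. max 0 (l x - k n x)) \<longlonglongrightarrow> max 0 (l x - l x)" by (intro tendsto_intros)
    then show ?case by (simp add: s_def)
  qed
  have limS: "(\<lambda>n. \<integral>x. indicator A x * s n x \<partial>M) \<longlonglongrightarrow> 0" if A[measurable]: "A \<in> sets M" for A
  proof -
    have "(\<lambda>n. \<integral>x. indicator A x * s n x \<partial>M) \<longlonglongrightarrow> (\<integral>x. 0 \<partial>M)"
    proof (rule integral_dominated_convergence[where w=l])
      show "AE x in M. (\<lambda>n. indicator A x * s n x) \<longlonglongrightarrow> 0"
        using lims by eventually_elim (auto intro!: tendsto_mult_right_zero)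
      show "AE x in M. norm (indicator A x * s n x) \<le> l x" for n
        using nn[of n] nn' by (auto simp: s_def indicator_def)
    qed (use int' in \<open>auto simp: s_def\<close>)
    then show ?thesis by simp
  qed
  have "(\<lambda>n. \<integral>x. r n x \<partial>M) \<longlonglongrightarrow> 0"
  proof (rule integral_tendsto_0_if_setwise_convergent[OF ir _ limr])
    show "0 \<le> r n x" for n x by (simp add: r_def)
    fix A assume A[measurable]: "A \<in> sets M"
    have "exp (- (\<integral>x. indicator A x * r n x \<partial>M)) =
        exp (- (\<integral>x. indicator A x * k n x \<partial>M)) *
        (exp (- (\<integral>x. indicator A x * s n x \<partial>M)) * exp (\<integral>x. indicator A x * l x \<partial>M))" for n
    proof -
      have "(\<integral>x. indicator A x * r n x \<partial>M) =
          (\<integral>x. indicator A x * k n x + indicator A x * s n x - indicator A x * l x \<partial>M)"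
        by (intro Bochner_Integration.integral_cong) (auto simp: k algebra_simps)
      also have "\<dots> = (\<integral>x. indicator A x * k n x \<partial>M) + (\<integral>x. indicator A x * s n x \<partial>M) - (\<integral>x. indicator A x * l x \<partial>M)"
        using integrable_mult_indicator[OF A int[of n]] integrable_mult_indicator[OF A isn[of n]]
          integrable_mult_indicator[OF A int']
        by simp
      finally show ?thesis by (simp add: exp_add[symmetric])
    qed
    moreover have "convergent (\<lambda>n. exp (- (\<integral>x. indicator A x * k n x \<partial>M)) *
        (exp (- (\<integral>x. indicator A x * s n x \<partial>M)) * exp (\<integral>x. indicator A x * l x \<partial>M)))"
      using conv[OF A] limS[OF A]
      by (intro convergent_mult convergent_const) (auto intro!: convergentI[OF tendsto_exp] tendsto_minus)
    ultimately show "convergent (\<lambda>n. exp (- (\<integral>x. indicator A x * r n x \<partial>M)))" by simp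
  qed
  moreover have "(\<lambda>n. \<integral>x. s n x \<partial>M) \<longlonglongrightarrow> 0"
  proof -
    have "(\<integral>x. indicator (space M) x * s n x \<partial>M) = (\<integral>x. s n x \<partial>M)" for n
      by (intro Bochner_Integration.integral_cong) auto
    then show ?thesis using limS[of "space M"] by simp
  qed
  ultimately have "(\<lambda>n. (\<integral>x. r n x \<partial>M) - (\<integral>x. s n x \<partial>M) + (\<integral>x. l x \<partial>M)) \<longlonglongrightarrow> 0 - 0 + (\<integral>x. l x \<partial>M)"
    by (intro tendsto_intros)
  then show ?thesis using ir isn int' by (simp add: k)
qed

section \<open>Variance from the characteristic function\<close>

text \<open>Off the event that \<open>X n\<close> and \<open>Z\<close> differ by more than e, the
  two exponentials differ by at most |u| e; on it they differ by at most 2, and its probability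
  tends to 0.\<close>

lemma (in prob_space) char_tendsto_if_converges_in_probability:
  assumes X: "\<And>n. X n \<in> borel_measurable M" and conv: "converges_in_probability M X Z"
  shows "(\<lambda>n. char (distr M borel (X n)) u) \<longlonglongrightarrow> char (distr M borel Z) u"
proof -
  have [measurable]: "Z \<in> borel_measurable M" "\<And>n. X n \<in> borel_measurable M"
    using X conv by (auto simp: converges_in_probability_def)
  have char: "char (distr M borel V) u = (\<integral>x. iexp (u * V x) \<partial>M)" if "V \<in> borel_measurable M" for V
    using that by (simp add: char_def integral_distr)
  have bound: "cmod (char (distr M borel (X n)) u - char (distr M borel Z) u)
      \<le> \<bar>u\<bar> * e + 2 * prob {x \<in> space M. \<bar>X n x - Z x\<bar> > e}" if "e > 0" for e n
  proof -
    let ?S = "{x \<in> space M. \<bar>X n x - Z x\<bar> > e}"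
    have le: "cmod (iexp (u * X n x) - iexp (u * Z x)) \<le> \<bar>u\<bar> * e + 2 * indicator ?S x" if "x \<in> space M" for x
    proof (cases "x \<in> ?S")
      case True
      have "cmod (iexp (u * X n x) - iexp (u * Z x)) \<le> cmod (iexp (u * X n x)) + cmod (iexp (u * Z x))"
        by (rule norm_triangle_ineq4)
      with True \<open>e > 0\<close> show ?thesis by (simp add: add_increasing)
    next
      case False
      have "iexp (u * X n x) - iexp (u * Z x) = iexp (u * Z x) * (iexp (u * (X n x - Z x)) - 1)"
        by (simp add: algebra_simps flip: exp_add)
      then have "cmod (iexp (u * X n x) - iexp (u * Z x)) = cmod (iexp (u * (X n x - Z x)) - 1)"
        by (simp add: norm_mult)
      also have "\<dots> \<le> \<bar>u * (X n x - Z x)\<bar>"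
        using iexp_approx1[of "u * (X n x - Z x)" 0] by simp
      also have "\<dots> \<le> \<bar>u\<bar> * e"
        using False that unfolding abs_mult by (intro mult_left_mono) auto
      finally show ?thesis using False by simp
    qed
    have int: "integrable M (\<lambda>x. iexp (u * V x))" if "V \<in> borel_measurable M" for V
      using that by (intro integrable_const_bound[where B=1]) auto
    have "cmod (char (distr M borel (X n)) u - char (distr M borel Z) u)
        = cmod (\<integral>x. iexp (u * X n x) - iexp (u * Z x) \<partial>M)"
      using int by (simp add: char)
    also have "\<dots> \<le> (\<integral>x. cmod (iexp (u * X n x) - iexp (u * Z x)) \<partial>M)"
      by (rule integral_norm_bound)
    also have "\<dots> \<le> (\<integral>x. \<bar>u\<bar> * e + 2 * indicator ?S x \<partial>M)"
      using int by (intro integral_mono le integrable_norm Bochner_Integration.integrable_diff)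
        (auto intro!: integrable_real_indicator simp: emeasure_eq_measure)
    also have "\<dots> = \<bar>u\<bar> * e + 2 * prob ?S"
      by (simp add: prob_space emeasure_eq_measure)
    finally show ?thesis .
  qed
  show ?thesis
  proof (rule LIMSEQ_I)
    fix r :: real assume "r > 0"
    \<comment> \<open>This makes |u| e smaller than r/2; the exceptional event will have probability
      below r/8 and thus contribute less than r/4.\<close>
    define e where "e = r / (2 * (\<bar>u\<bar> + 1))"
    have e: "e > 0" "\<bar>u\<bar> * e < r / 2 + r / 4" using \<open>r > 0\<close> by (auto simp: e_def field_simps add_pos_nonneg add_nonneg_pos)
    have "(\<lambda>n. prob {x \<in> space M. \<bar>X n x - Z x\<bar> > e}) \<longlonglongrightarrow> 0"
      using conv e by (auto simp: converges_in_probability_def)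
    then have "\<forall>\<^sub>F n in sequentially. prob {x \<in> space M. \<bar>X n x - Z x\<bar> > e} < r / 8"
      using \<open>r > 0\<close> by (intro order_tendstoD(2)[where a="r/8"]) auto
    then have "\<forall>\<^sub>F n in sequentially. cmod (char (distr M borel (X n)) u - char (distr M borel Z) u) < r"
    proof eventually_elim
      case (elim n)
      then show ?case using bound[OF e(1), of n] e(2) by linarith
    qed
    then show "\<exists>no. \<forall>n\<ge>no. cmod (char (distr M borel (X n)) u - char (distr M borel Z) u) < r"
      by (simp add: eventually_sequentially)
  qed
qed

lemma one_minus_cos_le: "1 - cos x \<le> x\<^sup>2 / 2" for x :: real
proof -
  have "1 - cos x = 2 * (sin (x/2))\<^sup>2"
    using cos_double_sin[of "x/2"] by simp
  also have "\<dots> \<le> 2 * (x/2)\<^sup>2"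
    using abs_sin_x_le_abs_x[of "x/2"] by (intro mult_left_mono abs_le_square_iff[THEN iffD1]) auto
  finally show ?thesis by (simp add: power2_eq_square)
qed

lemma one_minus_cos_over_square_tendsto: "((\<lambda>x::real. (1 - cos x) / x\<^sup>2) \<longlongrightarrow> 1/2) (at 0)"
proof -
  have "filterlim (\<lambda>x::real. x / 2) (at 0) (at 0)"
    by (auto simp: filterlim_at eventually_at_filter intro!: tendsto_eq_intros)
  from filterlim_compose[OF sinc_at_0 this]
  have "((\<lambda>x::real. (1/2) * (sin (x/2) / (x/2))\<^sup>2) \<longlongrightarrow> (1/2) * 1\<^sup>2) (at 0)"
    by (intro tendsto_intros)
  moreover have "(1 - cos x) / x\<^sup>2 = (1/2) * (sin (x/2) / (x/2))\<^sup>2" for x :: real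
    using cos_double_sin[of "x/2"] by (simp add: power_divide)
  ultimately show ?thesis by (simp only: power_one mult_1_right)
qed

text \<open>The difference of two independent copies of \<open>X\<close> has characteristic function \<open>exp (- 2 * \<psi> u)\<close>.\<close>

lemma (in prob_space) second_moment_of_char:
  fixes c :: real and \<psi> :: "real \<Rightarrow> real"
  assumes X[measurable]: "X \<in> borel_measurable M"
    and char: "\<And>u. cmod (char (distr M borel X) u) = exp (- \<psi> u)"
    and lim: "((\<lambda>u. \<psi> u / u\<^sup>2) \<longlongrightarrow> c) (at 0)"
  shows "integrable M (\<lambda>x. (X x)\<^sup>2)" "variance X = 2 * c"
proof -
  define \<mu> where "\<mu> = distr M borel X"
  interpret \<mu>: real_distribution \<mu>
    unfolding \<mu>_def by simp
  interpret P: pair_prob_space \<mu> \<mu> ..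
  let ?P = "\<mu> \<Otimes>\<^sub>M \<mu>"
  have int[simp]: "integrable ?P (\<lambda>z. cos (u * (fst z - snd z)))" for u
    by (intro P.P.integrable_const_bound[where B=1]) auto
  have cos: "(\<integral>z. cos (u * (fst z - snd z)) \<partial>?P) = (exp (- \<psi> u))\<^sup>2" for u
  proof -
    have i1: "integrable ?P (\<lambda>z. iexp (u * (fst z - snd z)))"
      by (intro P.P.integrable_const_bound[where B=1]) auto
    have "(\<integral>z. iexp (u * (fst z - snd z)) \<partial>?P) = (\<integral>x. \<integral>y. iexp (u * x) * cnj (iexp (u * y)) \<partial>\<mu> \<partial>\<mu>)"
      using P.integral_fst'[OF i1, symmetric]
      by (simp add: exp_cnj exp_add[symmetric] algebra_simps)
    also have "\<dots> = char \<mu> u * cnj (char \<mu> u)"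
      using \<mu>.integrable_iexp[of "\<lambda>x. u * x"]
      by (simp add: char_def)
    also have "\<dots> = complex_of_real ((exp (- \<psi> u))\<^sup>2)"
      using char[of u] by (simp add: complex_norm_square[symmetric] \<mu>_def)
    finally have *: "(\<integral>z. iexp (u * (fst z - snd z)) \<partial>?P) = complex_of_real ((exp (- \<psi> u))\<^sup>2)" .
    have "(\<integral>z. cos (u * (fst z - snd z)) \<partial>?P) = (\<integral>z. Re (iexp (u * (fst z - snd z))) \<partial>?P)"
      by (simp add: Re_exp)
    also have "\<dots> = Re (\<integral>z. iexp (u * (fst z - snd z)) \<partial>?P)"
      by (rule integral_Re[OF i1])
    finally show ?thesis using * by simp
  qed
  define u where "u n = inverse (real (Suc n))" for n
  have u0: "u n \<noteq> 0" for n by (simp add: u_def)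
  have ulim: "filterlim u (at 0) sequentially"
    unfolding filterlim_at using u0 LIMSEQ_inverse_real_of_nat by (auto simp: u_def[abs_def])
  \<comment> \<open>Bounded, hence integrable before any moment of \<open>X\<close> is known, and
    with integrals determined by \<psi>. These quotients tend to the squared difference of the two
    copies and stay below it.\<close>
  define F where "F n z = 2 * (1 - cos (u n * (fst z - snd z))) / (u n)\<^sup>2" for n and z :: "real \<times> real"
  have F_lim: "(\<lambda>n. F n z) \<longlonglongrightarrow> (fst z - snd z)\<^sup>2" for z
  proof (cases "fst z = snd z")
    case False
    have "filterlim (\<lambda>n. u n * (fst z - snd z)) (at 0) sequentially"
      using ulim False u0 unfolding filterlim_at
      by (auto intro!: tendsto_eq_intros)
    from filterlim_compose[OF one_minus_cos_over_square_tendsto this]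
    have "(\<lambda>n. 2 * (fst z - snd z)\<^sup>2 * ((1 - cos (u n * (fst z - snd z))) / (u n * (fst z - snd z))\<^sup>2))
      \<longlonglongrightarrow> 2 * (fst z - snd z)\<^sup>2 * (1/2)"
      by (rule tendsto_mult_left)
    moreover have "F n z = 2 * (fst z - snd z)\<^sup>2 * ((1 - cos (u n * (fst z - snd z))) / (u n * (fst z - snd z))\<^sup>2)" for n
      using False by (simp add: F_def power_mult_distrib)
    ultimately show ?thesis by simp
  qed (simp add: F_def)
  have F_nn: "0 \<le> F n z" for n z by (simp add: F_def)
  have F_le: "F n z \<le> (fst z - snd z)\<^sup>2" for n z
    using one_minus_cos_le[of "u n * (fst z - snd z)"] u0[of n]
    by (simp add: F_def divide_le_eq power_mult_distrib mult.commute)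
  have F_int: "integrable ?P (F n)" for n unfolding F_def by simp
  have F_int_eq: "(\<integral>z. F n z \<partial>?P) = 2 * (1 - exp (- (2 * \<psi> (u n)))) / (u n)\<^sup>2" for n
    unfolding F_def using cos[of "u n"] P.P.prob_space
    by (simp add: power2_eq_square flip: exp_add)
  have psi_lim: "(\<lambda>n. \<psi> (u n) / (u n)\<^sup>2) \<longlonglongrightarrow> c"
    by (rule filterlim_compose[OF lim ulim])
  have F_int_lim: "(\<lambda>n. \<integral>z. F n z \<partial>?P) \<longlonglongrightarrow> 4 * c"
  proof -
    have "(\<lambda>n. 2 * \<psi> (u n)) \<longlonglongrightarrow> 0"
    proof -
      have "(\<lambda>n. 2 * (\<psi> (u n) / (u n)\<^sup>2) * (u n)\<^sup>2) \<longlonglongrightarrow> 2 * c * 0\<^sup>2"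
        using ulim by (intro tendsto_intros psi_lim) (auto simp: filterlim_at)
      then show ?thesis using u0 by simp
    qed
    \<comment> \<open>\<open>\<psi> (u n)\<close> may be 0, for instance when \<open>X\<close> is
      constant, so the quotient is extended by its limit 1.\<close>
    define g where "g x = (if x = 0 then 1 else (1 - exp (- x)) / x)" for x :: real
    have "((\<lambda>x::real. (1 - exp (- x)) / x) \<longlongrightarrow> 1) (at 0)"
    proof -
      have "((\<lambda>x::real. 1 - exp (- x)) has_real_derivative 1) (at 0)"
        by (auto intro!: derivative_eq_intros)
      then show ?thesis by (simp add: has_field_derivative_iff)
    qed
    then have "isCont g 0"
      unfolding isCont_def by (rule Lim_transform_eventually[THEN tendsto_eq_rhs]) (auto simp: g_def eventually_at_filter)
    from isCont_tendsto_compose[OF this \<open>(\<lambda>n. 2 * \<psi> (u n)) \<longlonglongrightarrow> 0\<close>]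
    have "(\<lambda>n. 4 * (\<psi> (u n) / (u n)\<^sup>2) * g (2 * \<psi> (u n))) \<longlonglongrightarrow> 4 * c * 1"
      by (intro tendsto_intros psi_lim) (simp add: g_def)
    moreover have "(\<integral>z. F n z \<partial>?P) = 4 * (\<psi> (u n) / (u n)\<^sup>2) * g (2 * \<psi> (u n))" for n
      unfolding F_int_eq g_def by simp
    ultimately show ?thesis by simp
  qed
  \<comment> \<open>Fatou comes first: the squared difference can dominate the \<open>F n\<close> in
    \<open>D_eq\<close> only once it is known to be integrable.\<close>
  have D_int: "integrable ?P (\<lambda>z. (fst z - snd z)\<^sup>2)"
  proof (rule integrableI_bounded)
    have "(\<integral>\<^sup>+z. ennreal (norm ((fst z - snd z)\<^sup>2)) \<partial>?P) = (\<integral>\<^sup>+z. liminf (\<lambda>n. ennreal (F n z)) \<partial>?P)"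
      by (intro nn_integral_cong)
        (auto intro!: lim_imp_Liminf[symmetric] tendsto_ennrealI F_lim)
    also have "\<dots> \<le> liminf (\<lambda>n. \<integral>\<^sup>+z. ennreal (F n z) \<partial>?P)"
      by (rule nn_integral_liminf) (simp add: F_def)
    also have "\<dots> = liminf (\<lambda>n. ennreal (\<integral>z. F n z \<partial>?P))"
      using F_int F_nn by (simp add: nn_integral_eq_integral)
    also have "\<dots> = ennreal (4 * c)"
      by (intro lim_imp_Liminf tendsto_ennrealI F_int_lim) simp
    finally show "(\<integral>\<^sup>+z. ennreal (norm ((fst z - snd z)\<^sup>2)) \<partial>?P) < \<infinity>"
      by (auto simp: le_less_trans)
  qed auto
  have D_eq: "(\<integral>z. (fst z - snd z)\<^sup>2 \<partial>?P) = 4 * c"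
  proof (rule LIMSEQ_unique[OF _ F_int_lim])
    show "(\<lambda>n. \<integral>z. F n z \<partial>?P) \<longlonglongrightarrow> (\<integral>z. (fst z - snd z)\<^sup>2 \<partial>?P)"
    proof (rule integral_dominated_convergence[where w="\<lambda>z. (fst z - snd z)\<^sup>2"])
      show "AE z in ?P. norm (F n z) \<le> (fst z - snd z)\<^sup>2" for n
        using F_nn F_le by auto
    qed (use F_lim D_int F_int in auto)
  qed
  \<comment> \<open>Freezing the first copy at one suitable x is enough, since y^2 \<le> 2 (x - y)^2
    + 2 x^2.\<close>
  have "AE x in \<mu>. integrable \<mu> (\<lambda>y. (x - y)\<^sup>2)"
    using P.AE_integrable_fst'[OF D_int] by simp
  then have "\<exists>x. integrable \<mu> (\<lambda>y. (x - y)\<^sup>2)"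
    using \<mu>.AE_E_prob \<mu>.ae_filter_bot eventually_happens by blast
  then obtain x where x: "integrable \<mu> (\<lambda>y. (x - y)\<^sup>2)" by blast
  have sq: "integrable \<mu> (\<lambda>y. y\<^sup>2)"
  proof (rule Bochner_Integration.integrable_bound)
    show "integrable \<mu> (\<lambda>y. 2 * (x - y)\<^sup>2 + 2 * x\<^sup>2)" using x by simp
    have "y\<^sup>2 \<le> 2 * (x - y)\<^sup>2 + 2 * x\<^sup>2" for y
      using zero_le_power2[of "y - 2 * x"] by (simp add: power2_eq_square algebra_simps)
    then show "AE y in \<mu>. norm (y\<^sup>2) \<le> norm (2 * (x - y)\<^sup>2 + 2 * x\<^sup>2)" by simp
  qed simp
  then show sqX: "integrable M (\<lambda>x. (X x)\<^sup>2)"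
    by (simp add: \<mu>_def integrable_distr_eq)
  have i1: "integrable \<mu> (\<lambda>y. y)"
    using \<mu>.square_integrable_imp_integrable[OF _ sq] by simp
  have "4 * c = (\<integral>x. \<integral>y. (x - y)\<^sup>2 \<partial>\<mu> \<partial>\<mu>)"
    using P.integral_fst'[OF D_int] D_eq by simp
  also have "\<dots> = (\<integral>x. x\<^sup>2 - 2 * x * (\<integral>y. y \<partial>\<mu>) + (\<integral>y. y\<^sup>2 \<partial>\<mu>) \<partial>\<mu>)"
  proof (rule Bochner_Integration.integral_cong[OF refl])
    fix x :: real
    have "(\<integral>y. (x - y)\<^sup>2 \<partial>\<mu>) = (\<integral>y. x\<^sup>2 - 2 * x * y + y\<^sup>2 \<partial>\<mu>)"
      by (simp add: power2_diff algebra_simps)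
    also have "\<dots> = x\<^sup>2 - 2 * x * (\<integral>y. y \<partial>\<mu>) + (\<integral>y. y\<^sup>2 \<partial>\<mu>)"
      using i1 sq \<mu>.prob_space by simp
    finally show "(\<integral>y. (x - y)\<^sup>2 \<partial>\<mu>) = x\<^sup>2 - 2 * x * (\<integral>y. y \<partial>\<mu>) + (\<integral>y. y\<^sup>2 \<partial>\<mu>)" .
  qed
  also have "\<dots> = 2 * ((\<integral>y. y\<^sup>2 \<partial>\<mu>) - (\<integral>y. y \<partial>\<mu>)\<^sup>2)"
    using i1 sq \<mu>.prob_space by (simp add: power2_eq_square)
  finally have "2 * c = (\<integral>y. y\<^sup>2 \<partial>\<mu>) - (\<integral>y. y \<partial>\<mu>)\<^sup>2" by simp
  also have "\<dots> = variance X"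
    using square_integrable_imp_integrable[OF X sqX] sqX
    by (subst variance_eq) (auto simp: \<mu>_def integral_distr)
  finally show "variance X = 2 * c" by simp
qed

section \<open>Integrals with respect to a L\'evy basis\<close>

locale levy_basis = prob_space M
  for M :: "'w measure" +
  fixes \<Lambda> :: "'a::euclidean_space set \<Rightarrow> 'w \<Rightarrow> real" and \<beta> \<sigma> :: real and \<nu> :: "real measure"
  assumes basis: "homogeneous_levy_basis M \<Lambda> \<beta> \<sigma> \<nu>"
begin

lemma measurable_basis [measurable]: "B \<in> bounded_borel \<Longrightarrow> \<Lambda> B \<in> borel_measurable M"
  using basis by (auto simp: homogeneous_levy_basis_def)

lemma char_basis: "B \<in> bounded_borel \<Longrightarrow>
    char (distr M borel (\<Lambda> B)) u = exp (of_real (measure lborel B) * levy_exponent \<beta> \<sigma> \<nu> u)"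
  using basis by (auto simp: homogeneous_levy_basis_def)

lemma indep_basis:
  fixes B :: "nat \<Rightarrow> 'a set"
  assumes "range B \<subseteq> bounded_borel" "disjoint_family B"
  shows "indep_vars (\<lambda>_. borel) (\<lambda>n. \<Lambda> (B n)) UNIV"
  using assms basis by (auto simp: homogeneous_levy_basis_def)

lemma sums_basis:
  fixes B :: "nat \<Rightarrow> 'a set"
  assumes "range B \<subseteq> bounded_borel" "disjoint_family B" "(\<Union>n. B n) \<in> bounded_borel"
  shows "AE \<omega> in M. (\<lambda>n. \<Lambda> (B n) \<omega>) sums \<Lambda> (\<Union>n. B n) \<omega>"
  using assms basis by (auto simp: homogeneous_levy_basis_def)

text \<open>Countable additivity for the sequence of empty sets gives a convergent series with
  constant terms, and such terms must be 0.\<close>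

lemma basis_empty: "AE \<omega> in M. \<Lambda> {} \<omega> = 0"
proof -
  have "AE \<omega> in M. (\<lambda>n::nat. \<Lambda> {} \<omega>) sums \<Lambda> {} \<omega>"
    using sums_basis[of "\<lambda>_. {}"] by (simp add: bounded_borel_def disjoint_family_on_def)
  then show ?thesis
  proof eventually_elim
    case (elim \<omega>)
    then have "(\<lambda>n::nat. \<Lambda> {} \<omega>) \<longlonglongrightarrow> 0"
      using summable_LIMSEQ_zero sums_summable by blast
    then show ?case by (simp add: LIMSEQ_const_iff)
  qed
qed

lemma bounded_borel_finite_UN:
  assumes "finite I" "\<And>i. i \<in> I \<Longrightarrow> B i \<in> bounded_borel"
  shows "(\<Union>i\<in>I. B i) \<in> bounded_borel"
  using assms by (auto simp: bounded_borel_def intro!: sets.finite_UN)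

text \<open>The axioms of a basis speak of sequences. Padding by empty sets turns a finite family
  into one with the same union, and the additional values vanish almost surely by
  \<open>basis_empty\<close>.\<close>

lemma enumerate_family:
  fixes B :: "'i \<Rightarrow> 'a set"
  assumes I: "finite I" and B: "\<And>i. i \<in> I \<Longrightarrow> B i \<in> bounded_borel" and disj: "disjoint_family_on B I"
  obtains f and B' :: "nat \<Rightarrow> 'a set" where "bij_betw f {..<card I} I" "range B' \<subseteq> bounded_borel"
    "disjoint_family B'" "\<And>k. k < card I \<Longrightarrow> B' k = B (f k)" "\<And>k. k \<ge> card I \<Longrightarrow> B' k = {}"
proof -
  obtain f where f: "bij_betw f {..<card I} I"
    using ex_bij_betw_nat_finite[OF I] by (auto simp: atLeast0LessThan)
  define B' where "B' k = (if k < card I then B (f k) else {})" for k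
  have "disjoint_family B'"
    unfolding disjoint_family_on_def
  proof (intro ballI impI)
    fix m n :: nat assume "m \<noteq> n"
    show "B' m \<inter> B' n = {}"
    proof (cases "m < card I \<and> n < card I")
      case True
      then have "f m \<in> I" "f n \<in> I" "f m \<noteq> f n"
        using f \<open>m \<noteq> n\<close> by (auto simp: bij_betw_def inj_on_def)
      then show ?thesis using disj True by (auto simp: B'_def disjoint_family_on_def)
    qed (auto simp: B'_def)
  qed
  moreover have "range B' \<subseteq> bounded_borel"
    using B f by (auto simp: B'_def bij_betw_def) (auto simp: bounded_borel_def)
  ultimately show ?thesis
    using f by (intro that[of f B']) (auto simp: B'_def)
qed

lemma basis_finite_additive:
  assumes I: "finite I" and B: "\<And>i. i \<in> I \<Longrightarrow> B i \<in> bounded_borel" and disj: "disjoint_family_on B I"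
  shows "AE \<omega> in M. \<Lambda> (\<Union>i\<in>I. B i) \<omega> = (\<Sum>i\<in>I. \<Lambda> (B i) \<omega>)"
proof -
  obtain f B' where f: "bij_betw f {..<card I} I" and B': "range B' \<subseteq> bounded_borel" "disjoint_family B'"
    "\<And>k. k < card I \<Longrightarrow> B' k = B (f k)" "\<And>k. k \<ge> card I \<Longrightarrow> B' k = {}"
    using enumerate_family[OF assms] by blast
  have Un: "(\<Union>n. B' n) = (\<Union>i\<in>I. B i)"
  proof -
    have "(\<Union>n. B' n) = (\<Union>n\<in>{..<card I}. B' n)"
      using B'(4) by (force simp: not_less[symmetric])
    also have "\<dots> = (\<Union>n\<in>{..<card I}. B (f n))"
      using B'(3) by auto
    also have "\<dots> = (\<Union>i\<in>I. B i)"
      using bij_betw_imp_surj_on[OF f] by (metis image_image)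
    finally show ?thesis .
  qed
  have "AE \<omega> in M. (\<lambda>n. \<Lambda> (B' n) \<omega>) sums \<Lambda> (\<Union>n. B' n) \<omega>"
    using B' Un bounded_borel_finite_UN[OF I B] by (intro sums_basis) auto
  with basis_empty show ?thesis
  proof eventually_elim
    case (elim \<omega>)
    have "(\<lambda>n. \<Lambda> (B' n) \<omega>) sums (\<Sum>n<card I. \<Lambda> (B' n) \<omega>)"
      by (rule sums_finite) (auto simp: B'(4) elim not_less)
    moreover have "(\<Sum>n<card I. \<Lambda> (B' n) \<omega>) = (\<Sum>n<card I. \<Lambda> (B (f n)) \<omega>)"
      using B'(3) by simp
    moreover have "\<dots> = (\<Sum>i\<in>I. \<Lambda> (B i) \<omega>)"
      by (rule sum.reindex_bij_betw[OF f])
    ultimately have "(\<lambda>n. \<Lambda> (B' n) \<omega>) sums (\<Sum>i\<in>I. \<Lambda> (B i) \<omega>)" by simp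
    with elim(2) show ?case unfolding Un by (rule sums_unique2)
  qed
qed

lemma char_basis_sum:
  assumes I: "finite I" and B: "\<And>i. i \<in> I \<Longrightarrow> B i \<in> bounded_borel" and disj: "disjoint_family_on B I"
  shows "char (distr M borel (\<lambda>\<omega>. \<Sum>i\<in>I. y i * \<Lambda> (B i) \<omega>)) u =
    (\<Prod>i\<in>I. exp (of_real (measure lborel (B i)) * levy_exponent \<beta> \<sigma> \<nu> (u * y i)))"
proof -
  obtain f B' where f: "bij_betw f {..<card I} I" and B': "range B' \<subseteq> bounded_borel" "disjoint_family B'"
    "\<And>k. k < card I \<Longrightarrow> B' k = B (f k)" "\<And>k. k \<ge> card I \<Longrightarrow> B' k = {}"
    using enumerate_family[OF assms] by blast
  have "indep_vars (\<lambda>_. borel) (\<lambda>n. \<Lambda> (B' n)) {..<card I}"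
    using indep_vars_subset[OF indep_basis[OF B'(1,2)]] by simp
  then have ind: "indep_vars (\<lambda>_. borel) (\<lambda>n \<omega>. y (f n) * \<Lambda> (B' n) \<omega>) {..<card I}"
    by (rule indep_vars_compose2[where Y="\<lambda>n x. y (f n) * x"]) simp
  have scale: "char (distr M borel (\<lambda>\<omega>. c * \<Lambda> C \<omega>)) u = char (distr M borel (\<Lambda> C)) (u * c)"
    if "C \<in> bounded_borel" for c C
    using measurable_basis[OF that] by (simp add: char_def integral_distr mult.assoc)
  have "(\<lambda>\<omega>. \<Sum>i\<in>I. y i * \<Lambda> (B i) \<omega>) = (\<lambda>\<omega>. \<Sum>n<card I. y (f n) * \<Lambda> (B' n) \<omega>)"
  proof
    fix \<omega>
    have "(\<Sum>n<card I. y (f n) * \<Lambda> (B' n) \<omega>) = (\<Sum>n<card I. y (f n) * \<Lambda> (B (f n)) \<omega>)"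
      by (rule sum.cong) (simp_all add: B'(3))
    also have "\<dots> = (\<Sum>i\<in>I. y i * \<Lambda> (B i) \<omega>)"
      by (rule sum.reindex_bij_betw[OF f])
    finally show "(\<Sum>i\<in>I. y i * \<Lambda> (B i) \<omega>) = (\<Sum>n<card I. y (f n) * \<Lambda> (B' n) \<omega>)" by (rule sym)
  qed
  then have "char (distr M borel (\<lambda>\<omega>. \<Sum>i\<in>I. y i * \<Lambda> (B i) \<omega>)) u =
      (\<Prod>n<card I. char (distr M borel (\<lambda>\<omega>. y (f n) * \<Lambda> (B' n) \<omega>)) u)"
    using char_distr_sum[OF ind] by simp
  also have "\<dots> = (\<Prod>n<card I. exp (of_real (measure lborel (B (f n))) * levy_exponent \<beta> \<sigma> \<nu> (u * y (f n))))"
  proof (rule prod.cong[OF refl])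
    fix n assume "n \<in> {..<card I}"
    then have "B (f n) \<in> bounded_borel" "B' n = B (f n)"
      using B B'(3) bij_betw_apply[OF f] by auto
    then show "char (distr M borel (\<lambda>\<omega>. y (f n) * \<Lambda> (B' n) \<omega>)) u =
        exp (of_real (measure lborel (B (f n))) * levy_exponent \<beta> \<sigma> \<nu> (u * y (f n)))"
      by (simp add: scale char_basis)
  qed
  also have "\<dots> = (\<Prod>i\<in>I. exp (of_real (measure lborel (B i)) * levy_exponent \<beta> \<sigma> \<nu> (u * y i)))"
    by (rule prod.reindex_bij_betw[OF f])
  finally show ?thesis .
qed

definition levy_psi :: "real \<Rightarrow> real" where
  "levy_psi u = - Re (levy_exponent \<beta> \<sigma> \<nu> u)"

text \<open>The unit cube has Lebesgue measure 1, so \<psi> is the negative logarithm of the modulus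
  of a characteristic function. Its nonnegativity and continuity thus follow from general facts
  about characteristic functions.\<close>

lemma unit_box_char:
  "cmod (char (distr M borel (\<Lambda> (cbox 0 One))) u) = exp (- levy_psi u)"
proof -
  have B: "cbox 0 One \<in> (bounded_borel :: 'a set set)" by (simp add: bounded_borel_def)
  have "measure lborel (cbox 0 One :: 'a set) = 1" by (simp add: content_unit)
  then show ?thesis unfolding char_basis[OF B] by (simp add: levy_psi_def)
qed

lemma distr_unit_box: "real_distribution (distr M borel (\<Lambda> (cbox 0 One)))"
proof -
  have "cbox 0 One \<in> (bounded_borel :: 'a set set)" by (simp add: bounded_borel_def)
  then show ?thesis by simp
qed

lemma levy_psi_nonneg: "0 \<le> levy_psi u"
  using real_distribution.cmod_char_le_1[OF distr_unit_box, of u] by (simp add: unit_box_char)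

lemma isCont_levy_psi: "isCont levy_psi u"
proof -
  have "levy_psi = (\<lambda>u. - ln (cmod (char (distr M borel (\<Lambda> (cbox 0 One))) u)))"
    by (simp add: unit_box_char)
  moreover have "isCont \<dots> u"
    using real_distribution.isCont_char[OF distr_unit_box, of u]
    by (intro continuous_intros) (auto simp: unit_box_char)
  ultimately show ?thesis by simp
qed

lemma levy_psi_measurable [measurable]: "levy_psi \<in> borel_measurable borel"
  by (intro borel_measurable_continuous_onI continuous_at_imp_continuous_on ballI isCont_levy_psi)

lemma levy_psi_0 [simp]: "levy_psi 0 = 0"
  by (simp add: levy_psi_def levy_exponent_def)

lemma levy_simple_pieces:
  assumes "levy_simple g" "A \<in> sets borel"
  shows "finite (range g - {0})" "y \<in> range g - {0} \<Longrightarrow> A \<inter> g -` {y} \<in> bounded_borel"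
    "disjoint_family_on (\<lambda>y. A \<inter> g -` {y}) (range g - {0})"
proof -
  have [measurable]: "g \<in> borel_measurable borel" "A \<in> sets borel"
    using assms by (auto simp: levy_simple_def)
  have "A \<inter> g -` {y} \<in> sets borel"
    using measurable_sets[of g borel borel "{y}"] by simp
  moreover have "A \<inter> g -` {y} \<subseteq> {s. g s \<noteq> 0}" if "y \<noteq> 0"
    using that by auto
  ultimately show "y \<in> range g - {0} \<Longrightarrow> A \<inter> g -` {y} \<in> bounded_borel"
    using assms by (auto simp: levy_simple_def bounded_borel_def intro: bounded_subset)
qed (use assms in \<open>auto simp: levy_simple_def disjoint_family_on_def\<close>)

lemma levy_simple_integral_measurable [measurable]:
  assumes "levy_simple g" "A \<in> sets borel"
  shows "levy_simple_integral \<Lambda> g A \<in> borel_measurable M"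
  using levy_simple_pieces[OF assms] unfolding levy_simple_integral_def by measurable

lemma levy_simple_psi:
  assumes g: "levy_simple g" and A: "A \<in> sets borel"
  shows "integrable lborel (\<lambda>s. indicator A s * levy_psi (u * g s))"
    "cmod (char (distr M borel (levy_simple_integral \<Lambda> g A)) u) =
       exp (- (\<integral>s. indicator A s * levy_psi (u * g s) \<partial>lborel))"
proof -
  note pieces = levy_simple_pieces[OF g A]
  \<comment> \<open>The value 0 may be left out because \<open>levy_psi 0 = 0\<close>. Its level set
    has infinite measure, while all the others are bounded.\<close>
  have eq: "indicator A s * levy_psi (u * g s) =
      (\<Sum>y\<in>range g - {0}. levy_psi (u * y) * indicator (A \<inter> g -` {y}) s)" for s
  proof (cases "g s = 0")
    case False
    then have "(\<Sum>y\<in>range g - {0}. levy_psi (u * y) * indicator (A \<inter> g -` {y}) s) =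
        (\<Sum>y\<in>{g s}. levy_psi (u * y) * indicator (A \<inter> g -` {y}) s)"
      by (intro sum.mono_neutral_right pieces) (auto simp: indicator_def)
    then show ?thesis by (simp add: indicator_def)
  qed (auto intro!: sum.neutral simp: indicator_def)
  have int: "integrable lborel (\<lambda>s. levy_psi (u * y) * indicator (A \<inter> g -` {y}) s :: real)"
    if "y \<in> range g - {0}" for y
    using pieces(2)[OF that] emeasure_bounded_finite[of "A \<inter> g -` {y}"]
    by (intro integrable_mult_right integrable_real_indicator) (auto simp: bounded_borel_def)
  show "integrable lborel (\<lambda>s. indicator A s * levy_psi (u * g s))"
    unfolding eq by (intro Bochner_Integration.integrable_sum int)
  have "(\<integral>s. indicator A s * levy_psi (u * g s) \<partial>lborel) =
      (\<Sum>y\<in>range g - {0}. levy_psi (u * y) * measure lborel (A \<inter> g -` {y}))"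
    unfolding eq using int by (subst Bochner_Integration.integral_sum) auto
  moreover have "cmod (char (distr M borel (levy_simple_integral \<Lambda> g A)) u) =
      exp (\<Sum>y\<in>range g - {0}. - levy_psi (u * y) * measure lborel (A \<inter> g -` {y}))"
  proof -
    have "cmod (char (distr M borel (levy_simple_integral \<Lambda> g A)) u) =
        (\<Prod>y\<in>range g - {0}. cmod (exp (of_real (measure lborel (A \<inter> g -` {y})) * levy_exponent \<beta> \<sigma> \<nu> (u * y))))"
      unfolding levy_simple_integral_def[abs_def]
      using char_basis_sum[OF pieces, where y="\<lambda>y. y"] by (simp only: prod_norm)
    also have "\<dots> = (\<Prod>y\<in>range g - {0}. exp (- levy_psi (u * y) * measure lborel (A \<inter> g -` {y})))"
      by (intro prod.cong refl) (simp add: levy_psi_def mult.commute)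
    finally show ?thesis by (simp only: exp_sum[OF pieces(1)])
  qed
  ultimately show "cmod (char (distr M borel (levy_simple_integral \<Lambda> g A)) u) =
       exp (- (\<integral>s. indicator A s * levy_psi (u * g s) \<partial>lborel))"
    by (simp add: sum_negf)
qed

end

locale square_integrable_levy_basis = levy_basis +
  assumes second_moment: "levy_finite_second_moment \<nu>"
begin

lemma sets_nu [measurable_cong, simp]: "sets \<nu> = sets borel"
  using basis by (auto simp: homogeneous_levy_basis_def levy_measure_def)

lemma integrable_nu_square [simp]: "integrable \<nu> (\<lambda>z. z\<^sup>2)"
  using second_moment by (intro integrableI_bounded) (auto simp: levy_finite_second_moment_def)

abbreviation "kappa2 \<equiv> levy_variance \<sigma> \<nu>"

lemma integrable_nu_cos: "integrable \<nu> (\<lambda>z. 1 - cos (u * z))"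
proof (rule Bochner_Integration.integrable_bound)
  show "integrable \<nu> (\<lambda>z. u\<^sup>2 / 2 * z\<^sup>2)" by simp
  show "AE z in \<nu>. norm (1 - cos (u * z)) \<le> norm (u\<^sup>2 / 2 * z\<^sup>2)"
    using one_minus_cos_le[of "u * _"] by (auto simp: power_mult_distrib)
qed simp

text \<open>The compensator is purely imaginary and leaves the real part. To take the real part
  inside, the whole integrand must be integrable: for |z| < 1 by Taylor's bound of order 2, for |z|
  \<ge> 1 by 2 \<le> 2 z^2.\<close>

lemma levy_psi_eq: "levy_psi u = \<sigma>\<^sup>2 * u\<^sup>2 / 2 + (\<integral>z. 1 - cos (u * z) \<partial>\<nu>)"
proof -
  let ?f = "\<lambda>z. exp (\<i> * of_real (u * z)) - 1 - \<i> * of_real (u * z * indicator {z. \<bar>z\<bar> < 1} z)"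
  have int: "integrable \<nu> ?f"
  proof (rule Bochner_Integration.integrable_bound)
    show "integrable \<nu> (\<lambda>z. (u\<^sup>2 / 2 + 2) * z\<^sup>2)" by simp
    show "AE z in \<nu>. norm (?f z) \<le> norm ((u\<^sup>2 / 2 + 2) * z\<^sup>2)"
    proof (rule AE_I2)
      fix z :: real
      show "norm (?f z) \<le> norm ((u\<^sup>2 / 2 + 2) * z\<^sup>2)"
      proof (cases "\<bar>z\<bar> < 1")
        case True
        then have "norm (?f z) \<le> \<bar>u * z\<bar> ^ 2 / 2"
          using iexp_approx1[of "u * z" 1] by (simp add: numeral_2_eq_2 algebra_simps)
        also have "\<dots> \<le> (u\<^sup>2 / 2 + 2) * z\<^sup>2"
          by (simp add: power_mult_distrib algebra_simps)
        finally show ?thesis by simp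
      next
        case False
        have "norm (?f z) \<le> norm (exp (\<i> * of_real (u * z))) + norm (1::complex)"
          using False norm_triangle_ineq4[of "exp (\<i> * of_real (u * z))" 1] by simp
        also have "\<dots> = 2" by simp
        also have "2 \<le> 2 * z\<^sup>2"
          using False abs_le_square_iff[of 1 z] by simp
        also have "\<dots> \<le> (u\<^sup>2 / 2 + 2) * z\<^sup>2" by (simp add: algebra_simps)
        finally show ?thesis by simp
      qed
    qed
  qed simp
  have "Re (integral\<^sup>L \<nu> ?f) = (\<integral>z. Re (?f z) \<partial>\<nu>)"
    using integral_Re[OF int] by simp
  also have "\<dots> = - (\<integral>z. 1 - cos (u * z) \<partial>\<nu>)"
    by (simp add: Re_exp flip: Bochner_Integration.integral_minus)
  finally show ?thesis by (simp add: levy_psi_def levy_exponent_def)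
qed

lemma kappa2_nonneg: "0 \<le> kappa2"
  by (simp add: levy_variance_def)

lemma levy_psi_le: "levy_psi u \<le> kappa2 * u\<^sup>2 / 2"
proof -
  have "(\<integral>z. 1 - cos (u * z) \<partial>\<nu>) \<le> (\<integral>z. u\<^sup>2 / 2 * z\<^sup>2 \<partial>\<nu>)"
    using one_minus_cos_le[of "u * _"]
    by (intro integral_mono integrable_nu_cos) (auto simp: power_mult_distrib)
  then show ?thesis by (simp add: levy_psi_eq levy_variance_def algebra_simps)
qed

text \<open>The bound 1 - cos x \<le> x^2/2 makes z^2/2 a dominating function uniformly in u,
  integrable by the second moment of \<nu>; the Gaussian part contributes exactly
  \<sigma>^2/2.\<close>

lemma levy_psi_over_square_tendsto: "((\<lambda>u. levy_psi u / u\<^sup>2) \<longlongrightarrow> kappa2 / 2) (at 0)"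
  unfolding tendsto_at_iff_sequentially o_def
proof (intro allI impI)
  fix u :: "nat \<Rightarrow> real" assume u: "\<forall>i. u i \<in> UNIV - {0}" and lim: "u \<longlonglongrightarrow> 0"
  have u0: "u n \<noteq> 0" for n using u by auto
  have "(\<lambda>n. \<integral>z. (1 - cos (u n * z)) / (u n)\<^sup>2 \<partial>\<nu>) \<longlonglongrightarrow> (\<integral>z. z\<^sup>2 / 2 \<partial>\<nu>)"
  proof (rule integral_dominated_convergence[where w="\<lambda>z. z\<^sup>2 / 2"])
    show "AE z in \<nu>. norm ((1 - cos (u n * z)) / (u n)\<^sup>2) \<le> z\<^sup>2 / 2" for n
      using one_minus_cos_le[of "u n * _"] u0[of n]
      by (auto simp: power_mult_distrib divide_le_eq mult.commute)
    show "AE z in \<nu>. (\<lambda>n. (1 - cos (u n * z)) / (u n)\<^sup>2) \<longlonglongrightarrow> z\<^sup>2 / 2"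
    proof (rule AE_I2)
      fix z :: real
      show "(\<lambda>n. (1 - cos (u n * z)) / (u n)\<^sup>2) \<longlonglongrightarrow> z\<^sup>2 / 2"
      proof (cases "z = 0")
        case False
        have "filterlim (\<lambda>n. u n * z) (at 0) sequentially"
          using lim False u0 unfolding filterlim_at by (auto intro!: tendsto_eq_intros)
        from filterlim_compose[OF one_minus_cos_over_square_tendsto this]
        have "(\<lambda>n. z\<^sup>2 * ((1 - cos (u n * z)) / (u n * z)\<^sup>2)) \<longlonglongrightarrow> z\<^sup>2 * (1/2)"
          by (rule tendsto_mult_left)
        then show ?thesis using False by (simp add: power_mult_distrib)
      qed simp
    qed
  qed auto
  then have "(\<lambda>n. \<sigma>\<^sup>2 / 2 + (\<integral>z. (1 - cos (u n * z)) / (u n)\<^sup>2 \<partial>\<nu>)) \<longlonglongrightarrow> \<sigma>\<^sup>2 / 2 + (\<integral>z. z\<^sup>2 / 2 \<partial>\<nu>)"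
    by (rule tendsto_add_const_iff[THEN iffD2])
  moreover have "levy_psi (u n) / (u n)\<^sup>2 = \<sigma>\<^sup>2 / 2 + (\<integral>z. (1 - cos (u n * z)) / (u n)\<^sup>2 \<partial>\<nu>)" for n
    using u0[of n] by (simp add: levy_psi_eq add_divide_distrib)
  ultimately show "(\<lambda>n. levy_psi (u n) / (u n)\<^sup>2) \<longlonglongrightarrow> kappa2 / 2"
    by (simp add: levy_variance_def add_divide_distrib)
qed

lemma integrable_levy_psi:
  fixes f :: "'b \<Rightarrow> real"
  assumes f[measurable]: "f \<in> borel_measurable borel" "integrable lborel (\<lambda>s. (f s)\<^sup>2)"
  shows "integrable lborel (\<lambda>s. levy_psi (u * f s))"
proof (rule Bochner_Integration.integrable_bound)
  show "integrable lborel (\<lambda>s. kappa2 * u\<^sup>2 / 2 * (f s)\<^sup>2)" using f by simp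
  show "AE s in lborel. norm (levy_psi (u * f s)) \<le> norm (kappa2 * u\<^sup>2 / 2 * (f s)\<^sup>2)"
    using levy_psi_le[of "u * f _"] levy_psi_nonneg kappa2_nonneg
    by (auto simp: power_mult_distrib mult.assoc)
qed measurable

lemma cmod_char_levy_integral:
  assumes X: "has_levy_integral M \<Lambda> f X" and f2: "integrable lborel (\<lambda>s. (f s)\<^sup>2)"
  shows "cmod (char (distr M borel X) u) = exp (- (\<integral>s. levy_psi (u * f s) \<partial>lborel))"
proof -
  obtain g where f[measurable]: "f \<in> borel_measurable borel"
    and g: "\<And>n. levy_simple (g n)" and lim: "AE s in lborel. (\<lambda>n. g n s) \<longlonglongrightarrow> f s"
    and conv: "\<And>A. A \<in> sets borel \<Longrightarrow> \<exists>Z. converges_in_probability M (\<lambda>n. levy_simple_integral \<Lambda> (g n) A) Z"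
    and convX: "converges_in_probability M (\<lambda>n. levy_simple_integral \<Lambda> (g n) UNIV) X"
    using X unfolding has_levy_integral_def by blast
  note psi = levy_simple_psi[OF g]
  have "(\<lambda>n. \<integral>s. levy_psi (u * g n s) \<partial>lborel) \<longlonglongrightarrow> (\<integral>s. levy_psi (u * f s) \<partial>lborel)"
  proof (rule lborel.integral_tendsto_if_setwise_convergent)
    show "integrable lborel (\<lambda>s. levy_psi (u * g n s))" for n
      using psi(1)[of UNIV u n] by simp
    show "AE s in lborel. (\<lambda>n. levy_psi (u * g n s)) \<longlonglongrightarrow> levy_psi (u * f s)"
      using lim
      by eventually_elim (intro isCont_tendsto_compose[OF isCont_levy_psi] tendsto_intros)
    fix A :: "'b set" assume "A \<in> sets lborel"
    then have A: "A \<in> sets borel" by simp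
    then obtain Z where "converges_in_probability M (\<lambda>n. levy_simple_integral \<Lambda> (g n) A) Z"
      using conv by blast
    \<comment> \<open>The limit over A is known only to exist, and this is enough: the moduli of the
      characteristic functions converge, and they are the required exponentials.\<close>
    from tendsto_norm[OF char_tendsto_if_converges_in_probability[OF levy_simple_integral_measurable[OF g A] this]]
    show "convergent (\<lambda>n. exp (- (\<integral>s. indicator A s * levy_psi (u * g n s) \<partial>lborel)))"
      unfolding psi(2)[OF A, symmetric] convergent_def by blast
  qed (use levy_psi_nonneg integrable_levy_psi[OF f f2] in auto)
  then have "(\<lambda>n. exp (- (\<integral>s. levy_psi (u * g n s) \<partial>lborel))) \<longlonglongrightarrow> exp (- (\<integral>s. levy_psi (u * f s) \<partial>lborel))"
    by (intro tendsto_intros)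
  moreover have "(\<lambda>n. cmod (char (distr M borel (levy_simple_integral \<Lambda> (g n) UNIV)) u))
      \<longlonglongrightarrow> cmod (char (distr M borel X) u)"
    by (intro tendsto_norm char_tendsto_if_converges_in_probability[OF levy_simple_integral_measurable[OF g] convX]) simp
  then have "(\<lambda>n. exp (- (\<integral>s. levy_psi (u * g n s) \<partial>lborel))) \<longlonglongrightarrow> cmod (char (distr M borel X) u)"
    using psi(2)[of UNIV] by simp
  ultimately show ?thesis using LIMSEQ_unique by blast
qed

lemma variance_levy_integral:
  assumes X: "has_levy_integral M \<Lambda> f X" and f2: "integrable lborel (\<lambda>s. (f s)\<^sup>2)"
  shows "X \<in> borel_measurable M" "integrable M (\<lambda>\<omega>. (X \<omega>)\<^sup>2)"
    "variance X = kappa2 * (\<integral>s. (f s)\<^sup>2 \<partial>lborel)"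
proof -
  have f[measurable]: "f \<in> borel_measurable borel"
    using X by (auto simp: has_levy_integral_def)
  show Xm: "X \<in> borel_measurable M"
    using X by (auto simp: has_levy_integral_def converges_in_probability_def)
  have "((\<lambda>u. (\<integral>s. levy_psi (u * f s) \<partial>lborel) / u\<^sup>2) \<longlongrightarrow> kappa2 / 2 * (\<integral>s. (f s)\<^sup>2 \<partial>lborel)) (at 0)"
    unfolding tendsto_at_iff_sequentially o_def
  proof (intro allI impI)
    fix u :: "nat \<Rightarrow> real" assume u: "\<forall>i. u i \<in> UNIV - {0}" and lim: "u \<longlonglongrightarrow> 0"
    have u0: "u n \<noteq> 0" for n using u by auto
    have "(\<lambda>n. \<integral>s. levy_psi (u n * f s) / (u n)\<^sup>2 \<partial>lborel) \<longlonglongrightarrow> (\<integral>s. kappa2 / 2 * (f s)\<^sup>2 \<partial>lborel)"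
    proof (rule integral_dominated_convergence[where w="\<lambda>s. kappa2 / 2 * (f s)\<^sup>2"])
      show "AE s in lborel. norm (levy_psi (u n * f s) / (u n)\<^sup>2) \<le> kappa2 / 2 * (f s)\<^sup>2" for n
        using levy_psi_le[of "u n * f _"] u0[of n] levy_psi_nonneg
        by (auto simp: power_mult_distrib divide_le_eq algebra_simps)
      show "AE s in lborel. (\<lambda>n. levy_psi (u n * f s) / (u n)\<^sup>2) \<longlonglongrightarrow> kappa2 / 2 * (f s)\<^sup>2"
      proof (rule AE_I2)
        fix s
        show "(\<lambda>n. levy_psi (u n * f s) / (u n)\<^sup>2) \<longlonglongrightarrow> kappa2 / 2 * (f s)\<^sup>2"
        \<comment> \<open>The limit of \<psi>(x)/x^2 concerns x \<noteq> 0 only, so zeros of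
          \<open>f\<close> are treated apart.\<close>
        proof (cases "f s = 0")
          case False
          have "filterlim (\<lambda>n. u n * f s) (at 0) sequentially"
            using lim False u0 unfolding filterlim_at by (auto intro!: tendsto_eq_intros)
          from filterlim_compose[OF levy_psi_over_square_tendsto this]
          have "(\<lambda>n. (f s)\<^sup>2 * (levy_psi (u n * f s) / (u n * f s)\<^sup>2)) \<longlonglongrightarrow> (f s)\<^sup>2 * (kappa2 / 2)"
            by (rule tendsto_mult_left)
          then show ?thesis using False by (simp add: power_mult_distrib mult.commute)
        qed simp
      qed
    qed (use f2 in auto)
    then show "(\<lambda>n. (\<integral>s. levy_psi (u n * f s) \<partial>lborel) / (u n)\<^sup>2) \<longlonglongrightarrow> kappa2 / 2 * (\<integral>s. (f s)\<^sup>2 \<partial>lborel)"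
      by simp
  qed
  from second_moment_of_char[OF Xm cmod_char_levy_integral[OF X f2] this]
  show "integrable M (\<lambda>\<omega>. (X \<omega>)\<^sup>2)" "variance X = kappa2 * (\<integral>s. (f s)\<^sup>2 \<partial>lborel)"
    by auto
qed

end

section \<open>Additivity of the integral and covariances\<close>

text \<open>\<open>W n\<close> is a sum only almost everywhere because \<Lambda> is additive only up
  to null sets, and so are its simple integrals.\<close>

lemma (in prob_space) converges_in_probability_add:
  assumes X: "converges_in_probability M X X'" and Z: "converges_in_probability M Z Z'"
    and [measurable]: "\<And>n. X n \<in> borel_measurable M" "\<And>n. Z n \<in> borel_measurable M" "\<And>n. W n \<in> borel_measurable M"
    and W: "\<And>n. AE \<omega> in M. W n \<omega> = X n \<omega> + Z n \<omega>"
  shows "converges_in_probability M W (\<lambda>\<omega>. X' \<omega> + Z' \<omega>)"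
proof -
  have [measurable]: "X' \<in> borel_measurable M" "Z' \<in> borel_measurable M"
    using X Z by (auto simp: converges_in_probability_def)
  have "(\<lambda>n. prob {\<omega> \<in> space M. \<bar>W n \<omega> - (X' \<omega> + Z' \<omega>)\<bar> > \<epsilon>}) \<longlonglongrightarrow> 0" if "\<epsilon> > 0" for \<epsilon>
  proof (rule tendsto_sandwich[OF _ _ tendsto_const])
    let ?p = "\<lambda>n. prob {\<omega> \<in> space M. \<bar>X n \<omega> - X' \<omega>\<bar> > \<epsilon> / 2} + prob {\<omega> \<in> space M. \<bar>Z n \<omega> - Z' \<omega>\<bar> > \<epsilon> / 2}"
    show "\<forall>\<^sub>F n in sequentially. prob {\<omega> \<in> space M. \<bar>W n \<omega> - (X' \<omega> + Z' \<omega>)\<bar> > \<epsilon>} \<le> ?p n"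
    proof (rule always_eventually, rule allI)
      fix n
      have "prob {\<omega> \<in> space M. \<bar>W n \<omega> - (X' \<omega> + Z' \<omega>)\<bar> > \<epsilon>} \<le>
          prob ({\<omega> \<in> space M. \<bar>X n \<omega> - X' \<omega>\<bar> > \<epsilon> / 2} \<union> {\<omega> \<in> space M. \<bar>Z n \<omega> - Z' \<omega>\<bar> > \<epsilon> / 2})"
      proof (rule finite_measure_mono_AE)
        have le: "\<bar>a - a'\<bar> > \<epsilon> / 2 \<or> \<bar>b - b'\<bar> > \<epsilon> / 2" if "\<bar>a + b - (a' + b')\<bar> > \<epsilon>" for a b a' b' :: real
          using that by linarith
        show "AE \<omega> in M. \<omega> \<in> {\<omega> \<in> space M. \<bar>W n \<omega> - (X' \<omega> + Z' \<omega>)\<bar> > \<epsilon>} \<longrightarrow>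
            \<omega> \<in> {\<omega> \<in> space M. \<bar>X n \<omega> - X' \<omega>\<bar> > \<epsilon> / 2} \<union> {\<omega> \<in> space M. \<bar>Z n \<omega> - Z' \<omega>\<bar> > \<epsilon> / 2}"
          using W[of n]
        proof eventually_elim
          case (elim \<omega>)
          with le[of "X n \<omega>" "Z n \<omega>" "X' \<omega>" "Z' \<omega>"] show ?case by auto
        qed
      qed simp
      also have "\<dots> \<le> ?p n" by (rule measure_Un_le) auto
      finally show "prob {\<omega> \<in> space M. \<bar>W n \<omega> - (X' \<omega> + Z' \<omega>)\<bar> > \<epsilon>} \<le> ?p n" .
    qed
    have "(\<lambda>n. prob {\<omega> \<in> space M. \<bar>X n \<omega> - X' \<omega>\<bar> > \<epsilon> / 2}) \<longlonglongrightarrow> 0"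
      "(\<lambda>n. prob {\<omega> \<in> space M. \<bar>Z n \<omega> - Z' \<omega>\<bar> > \<epsilon> / 2}) \<longlonglongrightarrow> 0"
      using X Z half_gt_zero[OF \<open>\<epsilon> > 0\<close>] unfolding converges_in_probability_def by blast+
    from tendsto_add[OF this] show "?p \<longlonglongrightarrow> 0" by simp
  qed auto
  then show ?thesis by (simp add: converges_in_probability_def)
qed

lemma levy_simple_add:
  assumes "levy_simple g" "levy_simple h"
  shows "levy_simple (\<lambda>s. g s + h s)"
proof -
  have "range (\<lambda>s. g s + h s) \<subseteq> (\<lambda>(x, y). x + y) ` (range g \<times> range h)" by auto
  then have "finite (range (\<lambda>s. g s + h s))"
    by (rule finite_subset) (use assms in \<open>auto simp: levy_simple_def\<close>)
  moreover have "bounded {s. g s + h s \<noteq> 0}"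
    by (rule bounded_subset[of "{s. g s \<noteq> 0} \<union> {s. h s \<noteq> 0}"])
      (use assms in \<open>auto simp: levy_simple_def\<close>)
  ultimately show ?thesis using assms by (auto simp: levy_simple_def)
qed

context levy_basis
begin

text \<open>Common refinement: with \<phi> equal to \<open>fst\<close>, \<open>snd\<close> or their
  sum, the integrals of g, h and g + h become sums over the same cells, the level sets of the pair
  (g, h), where additivity is termwise. Since \<phi> maps (0, 0) to 0, the unbounded cell g = h = 0
  meets no level set for a nonzero value.\<close>

lemma levy_simple_integral_refine:
  assumes g: "levy_simple g" and h: "levy_simple h" and A: "A \<in> sets borel"
    and k: "levy_simple (\<lambda>s. \<phi> (g s, h s))" and \<phi>: "\<phi> (0, 0) = 0"
  shows "AE \<omega> in M. levy_simple_integral \<Lambda> (\<lambda>s. \<phi> (g s, h s)) A \<omega> =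
    (\<Sum>v\<in>range (\<lambda>s. (g s, h s)) - {(0, 0)}. \<phi> v * \<Lambda> (A \<inter> (\<lambda>s. (g s, h s)) -` {v}) \<omega>)"
proof -
  define T where "T s = (g s, h s)" for s
  define V where "V = range T - {(0, 0)}"
  let ?k = "\<lambda>s. \<phi> (T s)"
  have [measurable]: "g \<in> borel_measurable borel" "h \<in> borel_measurable borel" "A \<in> sets borel"
    using g h A by (auto simp: levy_simple_def)
  have finT: "finite (range T)"
    by (rule finite_subset[of _ "range g \<times> range h"]) (use g h in \<open>auto simp: levy_simple_def T_def\<close>)
  then have finV: "finite V" by (simp add: V_def)
  have TV: "A \<inter> T -` {v} \<in> bounded_borel" if "v \<in> V" for v
  proof -
    have "A \<inter> T -` {v} = A \<inter> (g -` {fst v} \<inter> h -` {snd v})"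
      by (auto simp: T_def)
    moreover have "g -` {fst v} \<in> sets borel" "h -` {snd v} \<in> sets borel"
      using measurable_sets[of g borel borel "{fst v}"] measurable_sets[of h borel borel "{snd v}"] by simp_all
    ultimately have "A \<inter> T -` {v} \<in> sets borel" by simp
    moreover have "A \<inter> T -` {v} \<subseteq> {s. g s \<noteq> 0} \<union> {s. h s \<noteq> 0}"
      using that by (auto simp: V_def T_def)
    then have "bounded (A \<inter> T -` {v})"
      by (rule bounded_subset[rotated]) (use g h in \<open>auto simp: levy_simple_def\<close>)
    ultimately show ?thesis by (simp add: bounded_borel_def)
  qed
  have Un: "A \<inter> ?k -` {y} = (\<Union>v\<in>{v\<in>V. \<phi> v = y}. A \<inter> T -` {v})" if "y \<noteq> 0" for y
    using that \<phi> by (auto simp: V_def)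
  have "AE \<omega> in M. \<forall>y\<in>range ?k - {0}. \<Lambda> (A \<inter> ?k -` {y}) \<omega> = (\<Sum>v\<in>{v\<in>V. \<phi> v = y}. \<Lambda> (A \<inter> T -` {v}) \<omega>)"
  proof (rule AE_finite_allI)
    show "finite (range ?k - {0})" using k by (simp add: levy_simple_def T_def)
    fix y assume "y \<in> range ?k - {0}"
    then have "y \<noteq> 0" by simp
    show "AE \<omega> in M. \<Lambda> (A \<inter> ?k -` {y}) \<omega> = (\<Sum>v\<in>{v\<in>V. \<phi> v = y}. \<Lambda> (A \<inter> T -` {v}) \<omega>)"
      unfolding Un[OF \<open>y \<noteq> 0\<close>]
      by (rule basis_finite_additive) (use finV TV in \<open>auto simp: disjoint_family_on_def\<close>)
  qed
  then have "AE \<omega> in M. levy_simple_integral \<Lambda> ?k A \<omega> = (\<Sum>v\<in>V. \<phi> v * \<Lambda> (A \<inter> T -` {v}) \<omega>)"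
  proof eventually_elim
    case (elim \<omega>)
    have "levy_simple_integral \<Lambda> ?k A \<omega> =
        (\<Sum>y\<in>range ?k - {0}. \<Sum>v\<in>{v\<in>V. \<phi> v = y}. \<phi> v * \<Lambda> (A \<inter> T -` {v}) \<omega>)"
      unfolding levy_simple_integral_def using elim
      by (intro sum.cong refl) (simp add: sum_distrib_left)
    \<comment> \<open>The value y = 0 is put back, where \<phi> v = 0 kills every term, so that the
      inner sums run over all fibres of \<phi> on V.\<close>
    also have "\<dots> = (\<Sum>y\<in>range ?k. \<Sum>v\<in>{v\<in>V. \<phi> v = y}. \<phi> v * \<Lambda> (A \<inter> T -` {v}) \<omega>)"
      using k by (intro sum.mono_neutral_left) (auto simp: levy_simple_def T_def)
    also have "\<dots> = (\<Sum>v\<in>V. \<phi> v * \<Lambda> (A \<inter> T -` {v}) \<omega>)"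
      using k finV by (intro sum.group) (auto simp: levy_simple_def T_def V_def)
    finally show ?case .
  qed
  then show ?thesis by (simp add: V_def T_def[abs_def])
qed

lemma levy_simple_integral_add:
  assumes g: "levy_simple g" and h: "levy_simple h" and A: "A \<in> sets borel"
  shows "AE \<omega> in M. levy_simple_integral \<Lambda> (\<lambda>s. g s + h s) A \<omega> =
    levy_simple_integral \<Lambda> g A \<omega> + levy_simple_integral \<Lambda> h A \<omega>"
proof -
  note r = levy_simple_integral_refine[OF g h A]
  from r[of fst] r[of snd] r[of "\<lambda>v. fst v + snd v"] g h levy_simple_add[OF g h]
  have "AE \<omega> in M. levy_simple_integral \<Lambda> g A \<omega> =
    (\<Sum>v\<in>range (\<lambda>s. (g s, h s)) - {(0, 0)}. fst v * \<Lambda> (A \<inter> (\<lambda>s. (g s, h s)) -` {v}) \<omega>)"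
   "AE \<omega> in M. levy_simple_integral \<Lambda> h A \<omega> =
    (\<Sum>v\<in>range (\<lambda>s. (g s, h s)) - {(0, 0)}. snd v * \<Lambda> (A \<inter> (\<lambda>s. (g s, h s)) -` {v}) \<omega>)"
   "AE \<omega> in M. levy_simple_integral \<Lambda> (\<lambda>s. g s + h s) A \<omega> =
    (\<Sum>v\<in>range (\<lambda>s. (g s, h s)) - {(0, 0)}. (fst v + snd v) * \<Lambda> (A \<inter> (\<lambda>s. (g s, h s)) -` {v}) \<omega>)"
    by simp_all
  then show ?thesis
    by eventually_elim (simp add: sum.distrib distrib_right)
qed

lemma has_levy_integral_add:
  assumes X: "has_levy_integral M \<Lambda> f X" and Z: "has_levy_integral M \<Lambda> g Z"
  shows "has_levy_integral M \<Lambda> (\<lambda>s. f s + g s) (\<lambda>\<omega>. X \<omega> + Z \<omega>)"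
proof -
  obtain F where f: "f \<in> borel_measurable borel"
    and F: "\<And>n. levy_simple (F n)" and limF: "AE s in lborel. (\<lambda>n. F n s) \<longlonglongrightarrow> f s"
    and convF: "\<And>A. A \<in> sets borel \<Longrightarrow> \<exists>Z. converges_in_probability M (\<lambda>n. levy_simple_integral \<Lambda> (F n) A) Z"
    and convX: "converges_in_probability M (\<lambda>n. levy_simple_integral \<Lambda> (F n) UNIV) X"
    using X unfolding has_levy_integral_def by blast
  obtain G where g: "g \<in> borel_measurable borel"
    and G: "\<And>n. levy_simple (G n)" and limG: "AE s in lborel. (\<lambda>n. G n s) \<longlonglongrightarrow> g s"
    and convG: "\<And>A. A \<in> sets borel \<Longrightarrow> \<exists>Z. converges_in_probability M (\<lambda>n. levy_simple_integral \<Lambda> (G n) A) Z"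
    and convZ: "converges_in_probability M (\<lambda>n. levy_simple_integral \<Lambda> (G n) UNIV) Z"
    using Z unfolding has_levy_integral_def by blast
  have FG: "levy_simple (\<lambda>s. F n s + G n s)" for n by (rule levy_simple_add[OF F G])
  have add: "converges_in_probability M (\<lambda>n. levy_simple_integral \<Lambda> (\<lambda>s. F n s + G n s) A) (\<lambda>\<omega>. U \<omega> + V \<omega>)"
    if A: "A \<in> sets borel" and "converges_in_probability M (\<lambda>n. levy_simple_integral \<Lambda> (F n) A) U"
      "converges_in_probability M (\<lambda>n. levy_simple_integral \<Lambda> (G n) A) V" for A U V
    using that by (intro converges_in_probability_add[OF that(2,3)] levy_simple_integral_add F G FG
      levy_simple_integral_measurable)
  show ?thesis
    unfolding has_levy_integral_def
  proof (intro conjI exI[of _ "\<lambda>n s. F n s + G n s"] allI ballI)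
    show "AE s in lborel. (\<lambda>n. F n s + G n s) \<longlonglongrightarrow> f s + g s"
      using limF limG by eventually_elim (rule tendsto_add)
    show "levy_simple (\<lambda>s. F n s + G n s)" for n by (rule FG)
    show "converges_in_probability M (\<lambda>n. levy_simple_integral \<Lambda> (\<lambda>s. F n s + G n s) UNIV) (\<lambda>\<omega>. X \<omega> + Z \<omega>)"
      by (rule add[OF _ convX convZ]) simp
    fix A :: "'a set" assume A: "A \<in> sets borel"
    obtain U V where "converges_in_probability M (\<lambda>n. levy_simple_integral \<Lambda> (F n) A) U"
      "converges_in_probability M (\<lambda>n. levy_simple_integral \<Lambda> (G n) A) V"
      using convF[OF A] convG[OF A] by blast
    from add[OF A this]
    show "\<exists>Z. converges_in_probability M (\<lambda>n. levy_simple_integral \<Lambda> (\<lambda>s. F n s + G n s) A) Z" by blast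
  qed (use f g in simp)
qed

end

lemma (in square_integrable_levy_basis) covariance_levy_integral:
  assumes X: "has_levy_integral M \<Lambda> f X" and f: "integrable lborel (\<lambda>s. (f s)\<^sup>2)"
    and Z: "has_levy_integral M \<Lambda> g Z" and g: "integrable lborel (\<lambda>s. (g s)\<^sup>2)"
  shows "covariance M X Z = kappa2 * (\<integral>s. f s * g s \<partial>lborel)"
proof -
  have [measurable]: "f \<in> borel_measurable borel" "g \<in> borel_measurable borel"
    using X Z by (auto simp: has_levy_integral_def)
  have le: "\<bar>x * y\<bar> \<le> x\<^sup>2 + y\<^sup>2" for x y :: real
  proof -
    have "2 * \<bar>x\<bar> * \<bar>y\<bar> \<le> x\<^sup>2 + y\<^sup>2" using sum_squares_bound[of "\<bar>x\<bar>" "\<bar>y\<bar>"] by simp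
    moreover have "0 \<le> \<bar>x\<bar> * \<bar>y\<bar>" by simp
    ultimately show ?thesis unfolding abs_mult by linarith
  qed
  have fg: "integrable lborel (\<lambda>s. f s * g s)"
    by (rule Bochner_Integration.integrable_bound[OF Bochner_Integration.integrable_add[OF f g]]) (auto intro!: order_trans[OF le])
  then have fg2: "integrable lborel (\<lambda>s. (f s + g s)\<^sup>2)"
    using f g by (simp add: power2_sum mult.assoc)
  note vX = variance_levy_integral[OF X f] and vZ = variance_levy_integral[OF Z g]
  note vS = variance_levy_integral[OF has_levy_integral_add[OF X Z] fg2]
  have [measurable]: "X \<in> borel_measurable M" "Z \<in> borel_measurable M" using vX vZ by auto
  have i1[simp]: "integrable M X" "integrable M Z"
    using square_integrable_imp_integrable[OF vX(1,2)] square_integrable_imp_integrable[OF vZ(1,2)] by auto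
  have XZ: "integrable M (\<lambda>\<omega>. X \<omega> * Z \<omega>)"
    by (rule Bochner_Integration.integrable_bound[OF Bochner_Integration.integrable_add[OF vX(2) vZ(2)]]) (auto intro!: order_trans[OF le])
  have i2: "integrable M (\<lambda>\<omega>. (X \<omega> - expectation X)\<^sup>2)" "integrable M (\<lambda>\<omega>. (Z \<omega> - expectation Z)\<^sup>2)"
    using vX vZ by (simp_all add: power2_diff)
  have i3: "integrable M (\<lambda>\<omega>. (X \<omega> - expectation X) * (Z \<omega> - expectation Z))"
    using XZ by (simp add: algebra_simps)
  have "variance (\<lambda>\<omega>. X \<omega> + Z \<omega>) =
      (\<integral>\<omega>. (X \<omega> - expectation X)\<^sup>2 + (Z \<omega> - expectation Z)\<^sup>2 + 2 * ((X \<omega> - expectation X) * (Z \<omega> - expectation Z)) \<partial>M)"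
    unfolding Bochner_Integration.integral_add[OF i1]
    by (intro Bochner_Integration.integral_cong refl) (simp only: power2_eq_square algebra_simps)
  also have "\<dots> = variance X + variance Z + 2 * covariance M X Z"
    using i2 i3 by (simp add: covariance_def)
  finally have "2 * covariance M X Z = variance (\<lambda>\<omega>. X \<omega> + Z \<omega>) - variance X - variance Z" by simp
  also have "\<dots> = kappa2 * ((\<integral>s. (f s + g s)\<^sup>2 \<partial>lborel) - (\<integral>s. (f s)\<^sup>2 \<partial>lborel) - (\<integral>s. (g s)\<^sup>2 \<partial>lborel))"
    unfolding vX(3) vZ(3) vS(3) by (simp only: right_diff_distrib)
  also have "(\<integral>s. (f s + g s)\<^sup>2 \<partial>lborel) = (\<integral>s. (f s)\<^sup>2 + (g s)\<^sup>2 + 2 * (f s * g s) \<partial>lborel)"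
    by (simp add: power2_sum mult.assoc)
  also have "\<dots> = (\<integral>s. (f s)\<^sup>2 \<partial>lborel) + (\<integral>s. (g s)\<^sup>2 \<partial>lborel) + 2 * (\<integral>s. f s * g s \<partial>lborel)"
    using f g fg by simp
  finally have cov: "2 * covariance M X Z = kappa2 * ((\<integral>s. (f s)\<^sup>2 \<partial>lborel) + (\<integral>s. (g s)\<^sup>2 \<partial>lborel)
      + 2 * (\<integral>s. f s * g s \<partial>lborel) - (\<integral>s. (f s)\<^sup>2 \<partial>lborel) - (\<integral>s. (g s)\<^sup>2 \<partial>lborel))" .
  have arith: "z = k * c" if "2 * z = k * (a + b + 2 * c - a - b)" for z k a b c :: real
    using that by simp
  show ?thesis by (rule arith[OF cov])
qed

section \<open>Stable linear recurrences\<close>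

definition exp_decay :: "(real \<Rightarrow> 'a::real_normed_vector) \<Rightarrow> bool" where
  "exp_decay f \<longleftrightarrow> (\<exists>C \<delta>. \<delta> > 0 \<and> (\<forall>x\<ge>0. norm (f x) \<le> C * exp (- (\<delta> * x))))"

lemma exp_decay_bounds:
  assumes "exp_decay f"
  obtains C \<delta> where "\<delta> > 0" "C \<ge> 0" "\<And>x. x \<ge> 0 \<Longrightarrow> norm (f x) \<le> C * exp (- (\<delta> * x))"
proof -
  obtain C \<delta> where *: "\<delta> > 0" "\<And>x. x \<ge> 0 \<Longrightarrow> norm (f x) \<le> C * exp (- (\<delta> * x))"
    using assms by (auto simp: exp_decay_def)
  have "0 \<le> C" using order_trans[OF norm_ge_zero *(2)[of 0]] by simp
  with * that show ?thesis by blast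
qed

text \<open>Variation of constants: exp(-r x) u(x) has derivative exp(-r x) w(x), whose bound is
  integrated explicitly.\<close>

lemma exp_decay_if_ode:
  fixes u w :: "real \<Rightarrow> complex"
  assumes u: "\<And>x. (u has_vector_derivative (r * u x + w x)) (at x)" and w: "exp_decay w" and r: "Re r < 0"
  shows "exp_decay u"
proof -
  obtain C \<delta> where \<delta>: "\<delta> > 0" and C: "C \<ge> 0" and wb: "\<And>x. x \<ge> 0 \<Longrightarrow> norm (w x) \<le> C * exp (- (\<delta> * x))"
    by (rule exp_decay_bounds[OF w]) (rule that; assumption)
  define \<rho> where "\<rho> = - Re r"
  \<comment> \<open>Strictly below \<rho>, so that \<rho> - \<delta>' is positive and may be divided
    by; this also covers the resonant case \<delta> = \<rho>, where the exact integral is not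
    exponential.\<close>
  define \<delta>' where "\<delta>' = min \<delta> \<rho> / 2"
  have \<delta>': "0 < \<delta>'" "\<delta>' \<le> \<delta>" "\<delta>' < \<rho>" using \<delta> r by (auto simp: \<delta>'_def \<rho>_def)
  define v where "v x = exp (- (r * of_real x)) * u x" for x :: real
  have v': "(v has_vector_derivative exp (- (r * of_real x)) * w x) (at x)" for x
  proof -
    have "((\<lambda>x. exp (- (r * of_real x))) has_vector_derivative (- r * exp (- (r * of_real x)))) (at x)"
      by (rule has_vector_derivative_real_field) (auto intro!: derivative_eq_intros)
    from has_vector_derivative_mult[OF this u[of x]] show ?thesis
      unfolding v_def by (simp add: algebra_simps)
  qed
  \<comment> \<open>An antiderivative of the bound on the norm of the derivative of v, for the mean
    value inequality.\<close>
  define \<phi> where "\<phi> x = C / (\<rho> - \<delta>') * exp ((\<rho> - \<delta>') * x)" for x :: real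
  have \<phi>': "(\<phi> has_vector_derivative C * exp ((\<rho> - \<delta>') * x)) (at x)" for x
    unfolding \<phi>_def has_real_derivative_iff_has_vector_derivative[symmetric]
    using \<delta>' by (auto intro!: derivative_eq_intros)
  have v_bound: "norm (v x - v 0) \<le> \<phi> x - \<phi> 0" if "x > 0" for x
  proof (rule differentiable_bound_general[OF that])
    show "continuous_on {0..x} v" "continuous_on {0..x} \<phi>"
      using v' \<phi>' by (auto intro!: continuous_at_imp_continuous_on has_vector_derivative_continuous)
    fix y assume y: "0 < y" "y < x"
    show "(v has_vector_derivative exp (- (r * of_real y)) * w y) (at y)"
      "(\<phi> has_vector_derivative C * exp ((\<rho> - \<delta>') * y)) (at y)" using v' \<phi>' by auto
    have "norm (exp (- (r * of_real y)) * w y) = exp (\<rho> * y) * norm (w y)"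
      by (simp add: norm_mult \<rho>_def)
    also have "\<dots> \<le> exp (\<rho> * y) * (C * exp (- (\<delta> * y)))"
      using wb[of y] y by (intro mult_left_mono) auto
    also have "\<dots> = C * exp ((\<rho> - \<delta>) * y)"
      by (simp add: left_diff_distrib exp_diff exp_minus field_simps)
    also have "\<dots> \<le> C * exp ((\<rho> - \<delta>') * y)"
      using C \<delta>' y by (intro mult_left_mono) auto
    finally show "norm (exp (- (r * of_real y)) * w y) \<le> C * exp ((\<rho> - \<delta>') * y)" .
  qed
  have "norm (u x) \<le> (norm (u 0) + C / (\<rho> - \<delta>')) * exp (- (\<delta>' * x))" if "x \<ge> 0" for x
  proof (cases "x = 0")
    case True
    then show ?thesis using C \<delta>' by simp
  next
    case False
    with that have x: "x > 0" by simp
    have "norm (v x) \<le> norm (v 0) + \<phi> x"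
    proof -
      have "norm (v x) \<le> norm (v 0) + norm (v x - v 0)" by (rule norm_triangle_sub)
      moreover have "0 \<le> \<phi> 0" using C \<delta>' by (simp add: \<phi>_def)
      ultimately show ?thesis using v_bound[OF x] by linarith
    qed
    then have "exp (\<rho> * x) * norm (u x) \<le> norm (u 0) + \<phi> x"
      by (simp add: v_def norm_mult \<rho>_def)
    also have "\<dots> \<le> (norm (u 0) + C / (\<rho> - \<delta>')) * exp ((\<rho> - \<delta>') * x)"
    proof -
      have "1 \<le> exp ((\<rho> - \<delta>') * x)" using \<delta>' x by simp
      then have "norm (u 0) * 1 \<le> norm (u 0) * exp ((\<rho> - \<delta>') * x)" by (intro mult_left_mono) auto
      then show ?thesis by (simp add: \<phi>_def distrib_right)
    qed
    also have "\<dots> = exp (\<rho> * x) * ((norm (u 0) + C / (\<rho> - \<delta>')) * exp (- (\<delta>' * x)))"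
      by (simp add: left_diff_distrib exp_diff exp_minus divide_simps)
    finally show ?thesis by (simp only: mult_le_cancel_left_pos[OF exp_gt_zero])
  qed
  then show ?thesis using \<delta>'(1) by (auto simp: exp_decay_def)
qed

text \<open>The scalar setting to which each column of the exponential of a companion matrix
  reduces: \<open>a\<close> is the characteristic polynomial of the recurrence for
  \<open>s\<close>.\<close>

locale linear_recurrence =
  fixes a :: "real poly" and s :: "nat \<Rightarrow> real"
  assumes monic: "lead_coeff a = 1"
    and recurrence: "\<And>n. (\<Sum>k\<le>degree a. coeff a k * s (n + k)) = 0"
    and stable: "\<And>z::complex. poly (map_poly of_real a) z = 0 \<Longrightarrow> Re z < 0"
begin

lemma recurrence': "s (n + degree a) = - (\<Sum>k<degree a. coeff a k * s (n + k))"
proof -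
  have "{..degree a} = insert (degree a) {..<degree a}" by auto
  then show ?thesis using recurrence[of n] monic by simp
qed

lemma geometric_bound: "\<exists>C R. R > 0 \<and> (\<forall>n. \<bar>s n\<bar> \<le> C * R ^ n)"
proof -
  define p where "p = degree a"
  \<comment> \<open>R \<ge> 1 lets C R^(n-1) bound all p preceding values at once, and the sum of
    the absolute coefficients, being at most R, supplies the last factor. The case p = 0 is separate
    because n may then be 0.\<close>
  define R where "R = 1 + (\<Sum>k<p. \<bar>coeff a k\<bar>)"
  define C where "C = (\<Sum>k<p. \<bar>s k\<bar>)"
  have R: "R \<ge> 1" and C: "C \<ge> 0" by (auto simp: R_def C_def sum_nonneg)
  have "\<bar>s n\<bar> \<le> C * R ^ n" for n
  proof (induction n rule: less_induct)
    case (less n)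
    show ?case
    proof (cases "n < p")
      case True
      then have "\<bar>s n\<bar> \<le> C" unfolding C_def by (intro member_le_sum) auto
      also have "\<dots> \<le> C * R ^ n" using C R by (simp add: mult_le_cancel_left1)
      finally show ?thesis .
    next
      case False
      then obtain m where n: "n = m + p" by (metis add.commute le_Suc_ex not_less)
      show ?thesis
      proof (cases "p = 0")
        case True
        then have "s n = 0" using recurrence'[of n] by (simp add: p_def)
        then show ?thesis using C R by simp
      next
        case False
        have "\<bar>s n\<bar> = \<bar>\<Sum>k<p. coeff a k * s (m + k)\<bar>"
          using recurrence'[of m] by (simp add: n p_def)
        also have "\<dots> \<le> (\<Sum>k<p. \<bar>coeff a k\<bar> * \<bar>s (m + k)\<bar>)"
          using sum_abs[of "\<lambda>k. coeff a k * s (m + k)" "{..<p}"] by (simp add: abs_mult)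
        also have "\<dots> \<le> (\<Sum>k<p. \<bar>coeff a k\<bar> * (C * R ^ (n - 1)))"
        proof (intro sum_mono mult_left_mono)
          fix k assume k: "k \<in> {..<p}"
          then have "\<bar>s (m + k)\<bar> \<le> C * R ^ (m + k)" by (intro less.IH) (simp add: n)
          also have "\<dots> \<le> C * R ^ (n - 1)"
            using k C R n by (intro mult_left_mono power_increasing) auto
          finally show "\<bar>s (m + k)\<bar> \<le> C * R ^ (n - 1)" .
        qed simp
        also have "\<dots> \<le> R * (C * R ^ (n - 1))"
          unfolding sum_distrib_right[symmetric] using C R by (intro mult_right_mono) (auto simp: R_def)
        also have "\<dots> = C * R ^ n" using False n by (simp flip: power_Suc)
        finally show ?thesis .
      qed
    qed
  qed
  then show ?thesis using R by (intro exI[of _ C] exI[of _ R]) auto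
qed

text \<open>The exponential generating function of the sequence shifted by k. Shifting is
  differentiation, so this is the k-th derivative of \<open>W 0\<close>.\<close>

definition W :: "nat \<Rightarrow> real \<Rightarrow> real" where
  "W k x = (\<Sum>n. s (n + k) / fact n * x ^ n)"

lemma summable_W: "summable (\<lambda>n. s (n + k) / fact n * x ^ n)"
proof -
  obtain C R where R: "R > 0" and b: "\<And>n. \<bar>s n\<bar> \<le> C * R ^ n" using geometric_bound by blast
  show ?thesis
  proof (rule summable_comparison_test')
    show "summable (\<lambda>n. (C * R ^ k) * (inverse (fact n) * (R * \<bar>x\<bar>) ^ n))"
      by (intro summable_mult summable_exp)
    fix n :: nat
    have "norm (s (n + k) / fact n * x ^ n) = \<bar>s (n + k)\<bar> * (\<bar>x\<bar> ^ n / fact n)"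
      by (simp add: abs_mult power_abs)
    also have "\<dots> \<le> (C * R ^ (n + k)) * (\<bar>x\<bar> ^ n / fact n)"
      by (intro mult_right_mono b) auto
    also have "\<dots> = (C * R ^ k) * (inverse (fact n) * (R * \<bar>x\<bar>) ^ n)"
      by (simp add: power_add power_mult_distrib divide_inverse)
    finally show "norm (s (n + k) / fact n * x ^ n) \<le> (C * R ^ k) * (inverse (fact n) * (R * \<bar>x\<bar>) ^ n)" .
  qed
qed

lemma W_deriv: "(W k has_real_derivative W (Suc k) x) (at x)"
proof -
  have "diffs (\<lambda>n. s (n + k) / fact n) = (\<lambda>n. s (n + Suc k) / fact n)"
    by (auto simp: diffs_def fun_eq_iff divide_simps)
  then show ?thesis
    using termdiffs_strong_converges_everywhere[OF summable_W, of k x] by (simp add: W_def[abs_def])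
qed

lemma W_0: "W k 0 = s k"
  unfolding W_def powser_zero by simp

lemma W_cont: "continuous_on S (W k)"
  by (intro continuous_at_imp_continuous_on ballI DERIV_isCont[OF W_deriv])

lemma W_measurable [measurable]: "W k \<in> borel_measurable borel"
  by (intro borel_measurable_continuous_onI W_cont)

lemma W_recurrence: "(\<Sum>k\<le>degree a. coeff a k * W (m + k) x) = 0"
proof -
  have "(\<Sum>k\<le>degree a. coeff a k * W (m + k) x) =
      (\<Sum>k\<le>degree a. \<Sum>n. coeff a k * (s (n + (m + k)) / fact n * x ^ n))"
    unfolding W_def by (intro sum.cong refl suminf_mult[symmetric] summable_W)
  also have "\<dots> = (\<Sum>n. \<Sum>k\<le>degree a. coeff a k * (s (n + (m + k)) / fact n * x ^ n))"
    by (intro suminf_sum[symmetric] summable_mult summable_W)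
  also have "\<dots> = (\<Sum>n. (\<Sum>k\<le>degree a. coeff a k * s ((n + m) + k)) * (x ^ n / fact n))"
    unfolding sum_distrib_right by (intro suminf_cong sum.cong refl) (simp add: add.assoc)
  also have "\<dots> = 0" unfolding recurrence by simp
  finally show ?thesis .
qed

text \<open>\<open>apply_poly q\<close> is the differential operator \<open>q(D)\<close> applied to \<open>W 0\<close>.\<close>

definition apply_poly :: "complex poly \<Rightarrow> real \<Rightarrow> complex" where
  "apply_poly q x = (\<Sum>k\<le>degree q. coeff q k * of_real (W k x))"

lemma apply_poly_eq: "degree q \<le> n \<Longrightarrow> apply_poly q x = (\<Sum>k\<le>n. coeff q k * of_real (W k x))"
  unfolding apply_poly_def by (rule sum.mono_neutral_left) (auto simp: coeff_eq_0)

lemma apply_poly_add: "apply_poly (q + r) x = apply_poly q x + apply_poly r x"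
  by (simp add: apply_poly_eq[of _ "max (degree q) (degree r)"] degree_add_le sum.distrib distrib_right)

lemma apply_poly_smult: "apply_poly (Polynomial.smult c q) x = c * apply_poly q x"
  by (simp add: apply_poly_eq[of _ "degree q"] degree_smult_le sum_distrib_left mult.assoc)

lemma apply_poly_sum: "apply_poly (sum f S) x = (\<Sum>i\<in>S. apply_poly (f i) x)"
proof (induction S rule: infinite_finite_induct)
  case (insert i S)
  then show ?case by (simp add: apply_poly_add)
qed (simp_all add: apply_poly_def)

lemma apply_poly_monom: "apply_poly (monom 1 k) x = of_real (W k x)"
  by (simp add: apply_poly_def degree_monom_eq if_distrib[of "\<lambda>c. c * _"] cong: if_cong)

lemma apply_poly_deriv: "(apply_poly q has_vector_derivative apply_poly (pCons 0 q) x) (at x)"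
proof -
  have "apply_poly (pCons 0 q) x = (\<Sum>k\<le>Suc (degree q). coeff (pCons 0 q) k * of_real (W k x))"
    by (rule apply_poly_eq) (simp add: degree_pCons_le)
  also have "\<dots> = (\<Sum>k\<le>degree q. coeff q k * of_real (W (Suc k) x))"
    by (subst sum.atMost_Suc_shift) simp
  finally have eq: "apply_poly (pCons 0 q) x = (\<Sum>k\<le>degree q. coeff q k * of_real (W (Suc k) x))" .
  have "((\<lambda>x. complex_of_real (W k x)) has_vector_derivative of_real (W (Suc k) x)) (at x)" for k
    using has_vector_derivative_of_real[OF W_deriv] .
  then have "((\<lambda>x. \<Sum>k\<le>degree q. coeff q k * of_real (W k x)) has_vector_derivative apply_poly (pCons 0 q) x) (at x)"
    unfolding eq by (intro has_vector_derivative_sum has_vector_derivative_mult_right)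
  then show ?thesis by (simp only: apply_poly_def[abs_def])
qed

text \<open>By linearity \<open>q\<close> may be a monomial, and then the claim is
  \<open>W_recurrence\<close>: a(D) annihilates each derivative of \<open>W 0\<close>.\<close>

lemma apply_poly_multiple: "apply_poly (map_poly of_real a * q) x = 0"
proof -
  define ac where "ac = map_poly complex_of_real a"
  have deg: "degree ac = degree a" by (simp add: ac_def)
  have shift: "apply_poly (ac * monom 1 m) x = 0" for m
  proof -
    have "ac * monom 1 m = (\<Sum>k\<le>degree a. Polynomial.smult (coeff ac k) (monom 1 (m + k)))"
      by (subst poly_as_sum_of_monoms[of ac, symmetric], subst deg)
        (simp add: sum_distrib_right mult_monom smult_monom add.commute)
    then have "apply_poly (ac * monom 1 m) x = (\<Sum>k\<le>degree a. coeff ac k * of_real (W (m + k) x))"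
      by (simp add: apply_poly_sum apply_poly_smult apply_poly_monom)
    also have "\<dots> = of_real (\<Sum>k\<le>degree a. coeff a k * W (m + k) x)"
      by (simp add: ac_def coeff_map_poly)
    finally show ?thesis by (simp add: W_recurrence)
  qed
  have "ac * q = (\<Sum>k\<le>degree q. Polynomial.smult (coeff q k) (ac * monom 1 k))"
    by (subst poly_as_sum_of_monoms[of q, symmetric])
      (simp add: sum_distrib_left smult_monom flip: mult_smult_right)
  then show ?thesis
    unfolding ac_def[symmetric] by (simp add: apply_poly_sum apply_poly_smult shift)
qed

text \<open>Linear factors are peeled off one at a time. If g = (X - r) h, then u = (h q)(D)
  \<open>W 0\<close> solves u' = r u + (g q)(D) \<open>W 0\<close>, and
  \<open>exp_decay_if_ode\<close> passes decay from the inhomogeneity to u. A multiple root merely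
  repeats the step. The starting point is g = a, whose multiples act as 0.\<close>

lemma apply_poly_exp_decay_factor:
  assumes "\<And>z. poly g z = 0 \<Longrightarrow> Re z < 0" "g \<noteq> 0" "\<And>q. exp_decay (apply_poly (g * q))"
  shows "exp_decay (apply_poly q)"
  using assms
proof (induction "degree g" arbitrary: g q)
  case 0
  then obtain c where g: "g = [:c:]" "c \<noteq> 0" by (metis degree_eq_zeroE pCons_0_0)
  then have "g * Polynomial.smult (inverse c) q = q" by simp
  then show ?case using 0(4)[of "Polynomial.smult (inverse c) q"] by simp
next
  case (Suc n)
  then obtain r where r: "poly g r = 0"
    using fundamental_theorem_of_algebra[of g] by (metis constant_degree nat.distinct(1))
  then obtain h where h: "g = [:- r, 1:] * h" by (auto simp: poly_eq_0_iff_dvd elim: dvdE)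
  have "h \<noteq> 0" using h Suc.prems(2) by auto
  have "degree g = Suc (degree h)" using \<open>h \<noteq> 0\<close> unfolding h by (subst degree_mult_eq) auto
  then have deg: "n = degree h" using Suc.hyps(2) by simp
  show ?case
  proof (rule Suc.hyps(1)[OF deg])
    show "Re z < 0" if "poly h z = 0" for z using that Suc.prems(1)[of z] by (simp add: h)
    show "h \<noteq> 0" by fact
    fix q
    show "exp_decay (apply_poly (h * q))"
    proof (rule exp_decay_if_ode)
      show "exp_decay (apply_poly (g * q))" by (rule Suc.prems(3))
      show "Re r < 0" using Suc.prems(1)[OF r] .
      fix x
      have "g * q = pCons 0 (h * q) + Polynomial.smult (- r) (h * q)" by (simp add: h algebra_simps)
      then have "r * apply_poly (h * q) x + apply_poly (g * q) x = apply_poly (pCons 0 (h * q)) x"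
        by (simp only: apply_poly_add apply_poly_smult) simp
      then show "(apply_poly (h * q) has_vector_derivative r * apply_poly (h * q) x + apply_poly (g * q) x) (at x)"
        using apply_poly_deriv[of "h * q" x] by simp
    qed
  qed
qed

lemma W_exp_decay: "exp_decay (W k)"
proof -
  have "exp_decay (apply_poly (map_poly of_real a * q))" for q
    unfolding exp_decay_def apply_poly_multiple by (intro exI[of _ 0] exI[of _ 1]) simp
  then have "exp_decay (apply_poly (monom 1 k))"
    by (rule apply_poly_exp_decay_factor[OF stable, rotated 2]) (use monic in auto)
  then show ?thesis by (simp add: exp_decay_def apply_poly_monom)
qed

end

section \<open>Fourier transforms\<close>

text \<open>Unnormalised; inversion then carries the factor 2 pi that becomes (2 pi)^d in the
  density.\<close>

definition fourier :: "(real \<Rightarrow> complex) \<Rightarrow> real \<Rightarrow> complex" where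
  "fourier f \<omega> = (\<integral>x. f x * iexp (- (\<omega> * x)) \<partial>lborel)"

text \<open>The characteristic function of the standard normal law at r/\<epsilon>, after the
  substitution x = \<epsilon> \<omega> in its defining integral.\<close>

lemma gaussian_fourier:
  fixes \<epsilon> r :: real
  assumes "\<epsilon> > 0"
  shows "(\<integral>\<omega>. exp (- (\<epsilon> * \<omega>)\<^sup>2 / 2) *\<^sub>R iexp (\<omega> * r) \<partial>lborel) = of_real (2 * pi / \<epsilon> * std_normal_density (r / \<epsilon>))"
proof -
  have "complex_of_real (exp (- ((r / \<epsilon>)\<^sup>2) / 2)) = char std_normal_distribution (r / \<epsilon>)"
    by (simp add: char_std_normal_distribution)
  also have "\<dots> = (\<integral>x. std_normal_density x *\<^sub>R iexp (r / \<epsilon> * x) \<partial>lborel)"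
    unfolding char_def by (subst integral_density) auto
  also have "\<dots> = \<bar>\<epsilon>\<bar> *\<^sub>R (\<integral>\<omega>. std_normal_density (0 + \<epsilon> * \<omega>) *\<^sub>R iexp (r / \<epsilon> * (0 + \<epsilon> * \<omega>)) \<partial>lborel)"
    using assms by (intro lborel_integral_real_affine) simp
  also have "\<dots> = \<epsilon> *\<^sub>R (\<integral>\<omega>. (1 / sqrt (2 * pi)) *\<^sub>R (exp (- (\<epsilon> * \<omega>)\<^sup>2 / 2) *\<^sub>R iexp (\<omega> * r)) \<partial>lborel)"
    using assms by (simp add: std_normal_density_def mult.commute)
  also have "\<dots> = (\<epsilon> / sqrt (2 * pi)) *\<^sub>R (\<integral>\<omega>. exp (- (\<epsilon> * \<omega>)\<^sup>2 / 2) *\<^sub>R iexp (\<omega> * r) \<partial>lborel)"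
    unfolding integral_scaleR_right by simp
  finally have "(\<integral>\<omega>. exp (- (\<epsilon> * \<omega>)\<^sup>2 / 2) *\<^sub>R iexp (\<omega> * r) \<partial>lborel)
      = (sqrt (2 * pi) / \<epsilon>) *\<^sub>R complex_of_real (exp (- ((r / \<epsilon>)\<^sup>2) / 2))"
    using assms by simp
  also have "\<dots> = of_real (2 * pi / \<epsilon> * std_normal_density (r / \<epsilon>))"
  proof -
    have "sqrt (2 * pi) = 2 * pi * (1 / sqrt (2 * pi))"
      by (simp add: real_div_sqrt)
    then have "sqrt (2 * pi) / \<epsilon> * exp (- ((r / \<epsilon>)\<^sup>2) / 2) = 2 * pi / \<epsilon> * std_normal_density (r / \<epsilon>)"
      unfolding std_normal_density_def by (metis (no_types) mult.assoc times_divide_eq_left)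
    then show ?thesis by (metis of_real_mult scaleR_conv_of_real)
  qed
  finally show ?thesis .
qed

lemma integrable_gaussian:
  fixes \<epsilon> :: real
  assumes "\<epsilon> > 0"
  shows "integrable lborel (\<lambda>\<omega>. exp (- (\<epsilon> * \<omega>)\<^sup>2 / 2))"
proof -
  have "integrable lborel (\<lambda>\<omega>. sqrt (2 * pi) * std_normal_density (0 + \<epsilon> * \<omega>))"
    using assms by (intro integrable_mult_right lborel_integrable_real_affine) auto
  then show ?thesis by (simp add: std_normal_density_def)
qed

lemma integrable_times_iexp:
  fixes f :: "real \<Rightarrow> complex"
  assumes f: "integrable lborel f" and [measurable]: "h \<in> borel_measurable borel"
  shows "integrable lborel (\<lambda>x. f x * iexp (h x))"
proof (rule Bochner_Integration.integrable_bound[OF f])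
  show "(\<lambda>x. f x * iexp (h x)) \<in> borel_measurable lborel"
    using borel_measurable_integrable[OF f] by simp
qed (simp add: norm_mult)

lemma cnj_borel_measurable [measurable]: "cnj \<in> borel_measurable borel"
  by (intro borel_measurable_continuous_onI continuous_intros)

lemma fourier_measurable [measurable]:
  assumes [measurable]: "f \<in> borel_measurable borel"
  shows "fourier f \<in> borel_measurable borel"
  unfolding fourier_def[abs_def] by (rule lborel.borel_measurable_lebesgue_integral) measurable

text \<open>The Gaussian weight makes the double integral absolutely convergent even where the
  transform of \<open>f\<close> is not integrable. After Fubini, the transform of the weight is a
  normal density of scale \<epsilon> centred at t, that is, an approximate identity.\<close>

lemma fourier_gaussian_mean:
  fixes f :: "real \<Rightarrow> complex"
  assumes f: "integrable lborel f" and \<epsilon>: "\<epsilon> > 0"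
  shows "(\<integral>\<omega>. exp (- (\<epsilon> * \<omega>)\<^sup>2 / 2) *\<^sub>R (fourier f \<omega> * iexp (\<omega> * t)) \<partial>lborel)
    = 2 * pi * (\<integral>x. std_normal_density x *\<^sub>R f (t + \<epsilon> * x) \<partial>lborel)"
proof -
  have [measurable]: "f \<in> borel_measurable borel" using f by auto
  define h where "h \<omega> s = (exp (- (\<epsilon> * \<omega>)\<^sup>2 / 2) *\<^sub>R iexp (\<omega> * (t - s))) * f s" for \<omega> s
  have h: "integrable (lborel \<Otimes>\<^sub>M lborel) (\<lambda>(\<omega>, s). h \<omega> s)"
  proof (rule lborel_pair.Fubini_integrable)
    show "(\<lambda>(\<omega>, s). h \<omega> s) \<in> borel_measurable (lborel \<Otimes>\<^sub>M lborel)"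
      unfolding h_def by measurable
    have "integrable lborel (\<lambda>\<omega>. exp (- (\<epsilon> * \<omega>)\<^sup>2 / 2) * (\<integral>s. norm (f s) \<partial>lborel))"
      using integrable_gaussian[OF \<epsilon>] by (rule integrable_mult_left)
    then show "integrable lborel (\<lambda>x. \<integral>y. norm (case (x, y) of (\<omega>, s) \<Rightarrow> h \<omega> s) \<partial>lborel)"
      by (simp add: h_def norm_mult)
    show "AE x in lborel. integrable lborel (\<lambda>y. case (x, y) of (\<omega>, s) \<Rightarrow> h \<omega> s)"
      unfolding h_def by (auto intro!: AE_I2 Bochner_Integration.integrable_bound[OF f] simp: norm_mult mult_left_le_one_le)
  qed
  have "(\<integral>\<omega>. exp (- (\<epsilon> * \<omega>)\<^sup>2 / 2) *\<^sub>R (fourier f \<omega> * iexp (\<omega> * t)) \<partial>lborel) = (\<integral>\<omega>. \<integral>s. h \<omega> s \<partial>lborel \<partial>lborel)"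
  proof (rule Bochner_Integration.integral_cong[OF refl])
    fix \<omega>
    have "h \<omega> s = (exp (- (\<epsilon> * \<omega>)\<^sup>2 / 2) *\<^sub>R iexp (\<omega> * t)) * (f s * iexp (- (\<omega> * s)))" for s
    proof -
      have "iexp (\<omega> * (t - s)) = iexp (\<omega> * t) * iexp (- (\<omega> * s))"
        by (simp add: algebra_simps flip: exp_add)
      then show ?thesis unfolding h_def by simp
    qed
    then have "(\<integral>s. h \<omega> s \<partial>lborel) = (exp (- (\<epsilon> * \<omega>)\<^sup>2 / 2) *\<^sub>R iexp (\<omega> * t)) * fourier f \<omega>"
      unfolding fourier_def by simp
    then show "exp (- (\<epsilon> * \<omega>)\<^sup>2 / 2) *\<^sub>R (fourier f \<omega> * iexp (\<omega> * t)) = (\<integral>s. h \<omega> s \<partial>lborel)"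
      by (simp add: mult.commute)
  qed
  also have "\<dots> = (\<integral>s. \<integral>\<omega>. h \<omega> s \<partial>lborel \<partial>lborel)"
    by (rule lborel_pair.Fubini_integral[OF h, symmetric])
  also have "\<dots> = (\<integral>s. of_real (2 * pi / \<epsilon> * std_normal_density ((t - s) / \<epsilon>)) * f s \<partial>lborel)"
    unfolding h_def integral_mult_left_zero gaussian_fourier[OF \<epsilon>] ..
  also have "\<dots> = \<bar>\<epsilon>\<bar> *\<^sub>R (\<integral>x. of_real (2 * pi / \<epsilon> * std_normal_density ((t - (t + \<epsilon> * x)) / \<epsilon>)) * f (t + \<epsilon> * x) \<partial>lborel)"
    using \<epsilon> by (intro lborel_integral_real_affine) simp
  also have "\<dots> = \<epsilon> *\<^sub>R (\<integral>x. (2 * pi / \<epsilon>) *\<^sub>R (std_normal_density x *\<^sub>R f (t + \<epsilon> * x)) \<partial>lborel)"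
  proof -
    have "complex_of_real (2 * pi / \<epsilon> * std_normal_density ((t - (t + \<epsilon> * x)) / \<epsilon>)) * f (t + \<epsilon> * x) =
        (2 * pi / \<epsilon>) *\<^sub>R (std_normal_density x *\<^sub>R f (t + \<epsilon> * x))" for x
    proof -
      have "std_normal_density ((t - (t + \<epsilon> * x)) / \<epsilon>) = std_normal_density x"
        using \<epsilon> by (simp add: std_normal_density_def)
      then show ?thesis by (simp only: scaleR_conv_of_real of_real_mult mult.assoc)
    qed
    then show ?thesis using \<epsilon> by (simp only: abs_of_pos)
  qed
  also have "\<dots> = 2 * pi * (\<integral>x. std_normal_density x *\<^sub>R f (t + \<epsilon> * x) \<partial>lborel)"
    using \<epsilon> unfolding integral_scaleR_right by (simp add: scaleR_conv_of_real)
  finally show ?thesis .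
qed

text \<open>Let \<epsilon> tend to 0 in \<open>fourier_gaussian_mean\<close>: the left side is
  dominated by the integrable transform, the right side by the bound on \<open>f\<close>, and
  continuity matters only at t.\<close>

lemma fourier_inversion:
  fixes f :: "real \<Rightarrow> complex"
  assumes f: "integrable lborel f" and bounded: "\<And>x. norm (f x) \<le> B" and cont: "isCont f t"
    and F: "integrable lborel (fourier f)"
  shows "(\<integral>\<omega>. fourier f \<omega> * iexp (\<omega> * t) \<partial>lborel) = 2 * pi * f t"
proof -
  define \<epsilon> where "\<epsilon> n = inverse (real (Suc n))" for n
  have \<epsilon>: "\<epsilon> n > 0" for n by (simp add: \<epsilon>_def)
  have \<epsilon>0: "\<epsilon> \<longlonglongrightarrow> 0" unfolding \<epsilon>_def[abs_def] by (rule LIMSEQ_inverse_real_of_nat)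
  have [measurable]: "f \<in> borel_measurable borel" using f by auto
  have Ft: "integrable lborel (\<lambda>\<omega>. fourier f \<omega> * iexp (\<omega> * t))"
    by (rule integrable_times_iexp[OF F]) simp
  have "(\<lambda>n. \<integral>\<omega>. exp (- (\<epsilon> n * \<omega>)\<^sup>2 / 2) *\<^sub>R (fourier f \<omega> * iexp (\<omega> * t)) \<partial>lborel)
      \<longlonglongrightarrow> (\<integral>\<omega>. fourier f \<omega> * iexp (\<omega> * t) \<partial>lborel)"
  proof (rule integral_dominated_convergence[where w="\<lambda>\<omega>. norm (fourier f \<omega> * iexp (\<omega> * t))"])
    show "AE \<omega> in lborel. (\<lambda>n. exp (- (\<epsilon> n * \<omega>)\<^sup>2 / 2) *\<^sub>R (fourier f \<omega> * iexp (\<omega> * t))) \<longlonglongrightarrow> fourier f \<omega> * iexp (\<omega> * t)"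
    proof (rule AE_I2)
      fix \<omega>
      have "(\<lambda>n. exp (- (\<epsilon> n * \<omega>)\<^sup>2 / 2) *\<^sub>R (fourier f \<omega> * iexp (\<omega> * t)))
          \<longlonglongrightarrow> exp (- (0 * \<omega>)\<^sup>2 / 2) *\<^sub>R (fourier f \<omega> * iexp (\<omega> * t))"
        by (intro tendsto_intros \<epsilon>0) simp
      then show "(\<lambda>n. exp (- (\<epsilon> n * \<omega>)\<^sup>2 / 2) *\<^sub>R (fourier f \<omega> * iexp (\<omega> * t))) \<longlonglongrightarrow> fourier f \<omega> * iexp (\<omega> * t)"
        by simp
    qed
  qed (use Ft in \<open>auto simp: mult_left_le_one_le\<close>)
  moreover have "(\<lambda>n. \<integral>x. std_normal_density x *\<^sub>R f (t + \<epsilon> n * x) \<partial>lborel) \<longlonglongrightarrow> (\<integral>x. std_normal_density x *\<^sub>R f t \<partial>lborel)"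
  proof (rule integral_dominated_convergence[where w="\<lambda>x. std_normal_density x * B"])
    show "AE x in lborel. (\<lambda>n. std_normal_density x *\<^sub>R f (t + \<epsilon> n * x)) \<longlonglongrightarrow> std_normal_density x *\<^sub>R f t"
    proof (rule AE_I2)
      fix x
      have "(\<lambda>n. t + \<epsilon> n * x) \<longlonglongrightarrow> t + 0 * x" by (intro tendsto_intros \<epsilon>0)
      then have "(\<lambda>n. f (t + \<epsilon> n * x)) \<longlonglongrightarrow> f t" using isCont_tendsto_compose[OF cont] by simp
      then show "(\<lambda>n. std_normal_density x *\<^sub>R f (t + \<epsilon> n * x)) \<longlonglongrightarrow> std_normal_density x *\<^sub>R f t"
        by (rule tendsto_scaleR[OF tendsto_const])
    qed
    show "AE x in lborel. norm (std_normal_density x *\<^sub>R f (t + \<epsilon> n * x)) \<le> std_normal_density x * B" for n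
      using bounded by (auto intro!: mult_left_mono)
  qed auto
  then have "(\<lambda>n. 2 * pi * (\<integral>x. std_normal_density x *\<^sub>R f (t + \<epsilon> n * x) \<partial>lborel)) \<longlonglongrightarrow> 2 * pi * f t"
    by (intro tendsto_mult_left) simp
  ultimately show ?thesis
    unfolding fourier_gaussian_mean[OF f \<epsilon>] using LIMSEQ_unique by blast
qed

text \<open>Inversion is applied to the correlation C of U and V: integrating over the shift smooths
  out the jump of U at 0, so C is continuous, and its transform is the product assumed
  integrable.\<close>

lemma fourier_correlation:
  fixes U V :: "real \<Rightarrow> complex"
  assumes U: "integrable lborel U" "\<And>x. norm (U x) \<le> B" "\<And>x. x \<noteq> 0 \<Longrightarrow> isCont U x"
    and V: "integrable lborel V"
    and UV: "integrable lborel (\<lambda>\<omega>. fourier U \<omega> * cnj (fourier V \<omega>))"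
  shows "(\<integral>\<omega>. fourier U \<omega> * cnj (fourier V \<omega>) * iexp (\<omega> * t) \<partial>lborel) = 2 * pi * (\<integral>s. U (t + s) * cnj (V s) \<partial>lborel)"
proof -
  have [measurable]: "U \<in> borel_measurable borel" "V \<in> borel_measurable borel" using U V by auto
  define C where "C x = (\<integral>s. U (x + s) * cnj (V s) \<partial>lborel)" for x
  have shift: "integrable lborel (\<lambda>x. U (x + s))" for s
    using lborel_integrable_real_affine[OF U(1), of 1 s] by (simp add: add.commute)
  have UVs: "norm (U x * cnj (V s)) \<le> B * norm (V s)" for x s
    unfolding norm_mult using U(2) by (simp add: mult_right_mono)
  \<comment> \<open>Stated for every \<omega>: the case \<omega> = 0 gives the integrability of C,
    the general case the transform of C.\<close>
  have two: "integrable (lborel \<Otimes>\<^sub>M lborel) (\<lambda>(s, x). U (x + s) * cnj (V s) * iexp (- (\<omega> * x)))" for \<omega>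
  proof (rule lborel_pair.Fubini_integrable)
    have "(\<integral>x. norm (U (x + s)) \<partial>lborel) = (\<integral>x. norm (U x) \<partial>lborel)" for s
      using lborel_integral_real_affine[of 1 "\<lambda>x. norm (U x)" s] by (simp add: add.commute)
    then show "integrable lborel (\<lambda>x. \<integral>y. norm (case (x, y) of (s, x) \<Rightarrow> U (x + s) * cnj (V s) * iexp (- (\<omega> * x))) \<partial>lborel)"
      using V by (simp add: norm_mult)
    show "AE x in lborel. integrable lborel (\<lambda>y. case (x, y) of (s, x) \<Rightarrow> U (x + s) * cnj (V s) * iexp (- (\<omega> * x)))"
      unfolding split_conv using shift
      by (intro AE_I2 integrable_times_iexp integrable_mult_left) auto
  qed measurable
  have C_int: "integrable lborel C"
    using lborel_pair.integrable_snd[OF two[of 0]] by (simp add: C_def[abs_def])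
  have "fourier C \<omega> = fourier U \<omega> * cnj (fourier V \<omega>)" for \<omega>
  proof -
    have "fourier C \<omega> = (\<integral>x. \<integral>s. U (x + s) * cnj (V s) * iexp (- (\<omega> * x)) \<partial>lborel \<partial>lborel)"
      unfolding fourier_def C_def by simp
    also have "\<dots> = (\<integral>s. \<integral>x. U (x + s) * cnj (V s) * iexp (- (\<omega> * x)) \<partial>lborel \<partial>lborel)"
      by (rule lborel_pair.Fubini_integral[OF two])
    also have "\<dots> = (\<integral>s. fourier U \<omega> * cnj (V s * iexp (- (\<omega> * s))) \<partial>lborel)"
    proof (rule Bochner_Integration.integral_cong[OF refl])
      fix s
      have "fourier U \<omega> = (\<integral>x. U (s + 1 * x) * iexp (- (\<omega> * (s + 1 * x))) \<partial>lborel)"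
        unfolding fourier_def by (subst lborel_integral_real_affine[of 1 _ s]) auto
      then have "fourier U \<omega> * cnj (V s * iexp (- (\<omega> * s))) =
          (\<integral>x. U (s + 1 * x) * iexp (- (\<omega> * (s + 1 * x))) * cnj (V s * iexp (- (\<omega> * s))) \<partial>lborel)"
        by simp
      also have "\<dots> = (\<integral>x. U (x + s) * cnj (V s) * iexp (- (\<omega> * x)) \<partial>lborel)"
      proof (rule Bochner_Integration.integral_cong[OF refl])
        fix x
        have "iexp (- (\<omega> * (s + 1 * x))) * cnj (iexp (- (\<omega> * s))) = iexp (- (\<omega> * x))"
          by (simp add: exp_cnj algebra_simps flip: exp_add)
        then show "U (s + 1 * x) * iexp (- (\<omega> * (s + 1 * x))) * cnj (V s * iexp (- (\<omega> * s))) = U (x + s) * cnj (V s) * iexp (- (\<omega> * x))"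
          by (simp add: add.commute mult.assoc mult.left_commute[of "iexp _"])
      qed
      finally show "(\<integral>x. U (x + s) * cnj (V s) * iexp (- (\<omega> * x)) \<partial>lborel) = fourier U \<omega> * cnj (V s * iexp (- (\<omega> * s)))" ..
    qed
    also have "\<dots> = fourier U \<omega> * cnj (fourier V \<omega>)"
      unfolding integral_mult_right_zero fourier_def[of V]
      by (rule arg_cong[where f="\<lambda>z. fourier U \<omega> * z", OF Bochner_Integration.integral_cnj])
    finally show ?thesis .
  qed
  then have FC: "fourier C = (\<lambda>\<omega>. fourier U \<omega> * cnj (fourier V \<omega>))" by auto
  have C_bound: "norm (C x) \<le> B * (\<integral>s. norm (V s) \<partial>lborel)" for x
  proof -
    have "norm (C x) \<le> (\<integral>s. norm (U (x + s) * cnj (V s)) \<partial>lborel)"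
      unfolding C_def by (rule integral_norm_bound)
    also have "\<dots> \<le> (\<integral>s. B * norm (V s) \<partial>lborel)"
    proof (rule integral_mono)
      show "integrable lborel (\<lambda>s. norm (U (x + s) * cnj (V s)))"
        by (rule Bochner_Integration.integrable_bound[of _ "\<lambda>s. B * norm (V s)"])
          (use V UVs in \<open>auto intro: order_trans[OF _ abs_ge_self]\<close>)
    qed (use V UVs in auto)
    finally show ?thesis by simp
  qed
  have "isCont C t"
    unfolding continuous_at_sequentially o_def
  proof (intro allI impI)
    fix X :: "nat \<Rightarrow> real" assume X: "X \<longlonglongrightarrow> t"
    show "(\<lambda>n. C (X n)) \<longlonglongrightarrow> C t"
      unfolding C_def
    proof (rule integral_dominated_convergence[where w="\<lambda>s. B * norm (V s)"])
      \<comment> \<open>The possible discontinuity of U at 0 is met only for s = -t, a null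
        set.\<close>
      show "AE s in lborel. (\<lambda>n. U (X n + s) * cnj (V s)) \<longlonglongrightarrow> U (t + s) * cnj (V s)"
        using AE_lborel_singleton[of "- t"]
      proof eventually_elim
        case (elim s)
        then have "isCont U (t + s)" by (intro U(3)) auto
        then have "(\<lambda>n. U (X n + s)) \<longlonglongrightarrow> U (t + s)"
          by (rule isCont_tendsto_compose) (intro tendsto_intros X)
        then show ?case by (rule tendsto_mult_right)
      qed
    qed (use V UVs in auto)
  qed
  from fourier_inversion[OF C_int C_bound this] UV show ?thesis
    by (simp add: FC C_def)
qed

text \<open>Closed at 0, in agreement with the weak inequality between the coordinates of s and t in
  the kernel.\<close>

definition causal :: "(real \<Rightarrow> real) \<Rightarrow> real \<Rightarrow> real" where
  "causal f x = (if 0 \<le> x then f x else 0)"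

lemma causal_measurable [measurable]:
  assumes [measurable]: "f \<in> borel_measurable borel"
  shows "causal f \<in> borel_measurable borel"
  unfolding causal_def[abs_def] by measurable

lemma exp_decay_causal:
  assumes f: "exp_decay f" and m[measurable]: "f \<in> borel_measurable borel"
  shows "integrable lborel (causal f)" "\<exists>B. \<forall>x. \<bar>causal f x\<bar> \<le> B"
    "((\<lambda>x. f x) \<longlongrightarrow> 0) at_top"
proof -
  obtain C \<delta> where \<delta>: "\<delta> > 0" and C: "C \<ge> 0" and b: "\<And>x. x \<ge> 0 \<Longrightarrow> norm (f x) \<le> C * exp (- (\<delta> * x))"
    by (rule exp_decay_bounds[OF f]) (rule that; assumption)
  interpret E: prob_space "density lborel (exponential_density \<delta>)"
    by (rule prob_space_exponential_density[OF \<delta>])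
  have "integrable (density lborel (exponential_density \<delta>)) (\<lambda>x. 1 :: real)" by simp
  then have "integrable lborel (exponential_density \<delta>)"
    using exponential_density_nonneg[OF \<delta>] by (subst (asm) integrable_density) auto
  then have "integrable lborel (\<lambda>x. C / \<delta> * exponential_density \<delta> x)" by simp
  then show "integrable lborel (causal f)"
  proof (rule Bochner_Integration.integrable_bound)
    show "AE x in lborel. norm (causal f x) \<le> norm (C / \<delta> * exponential_density \<delta> x)"
    proof (rule AE_I2)
      fix x :: real
      show "norm (causal f x) \<le> norm (C / \<delta> * exponential_density \<delta> x)"
        using b[of x] \<delta> C by (auto simp: causal_def exponential_density_def abs_mult mult.commute)
    qed
  qed measurable
  have "\<bar>causal f x\<bar> \<le> C" for x
  proof (cases "x \<ge> 0")
    case True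
    then have "exp (- (\<delta> * x)) \<le> 1" using \<delta> by simp
    then have "C * exp (- (\<delta> * x)) \<le> C * 1" using C by (intro mult_left_mono)
    then show ?thesis using b[OF True] True by (simp add: causal_def)
  qed (simp add: causal_def C)
  then show "\<exists>B. \<forall>x. \<bar>causal f x\<bar> \<le> B" by blast
  have "filterlim (\<lambda>x. - (\<delta> * x)) at_bot at_top"
    using \<delta> by (simp add: filterlim_uminus_at_bot filterlim_tendsto_pos_mult_at_top[OF tendsto_const _ filterlim_ident])
  then have "((\<lambda>x. C * exp (- (\<delta> * x))) \<longlongrightarrow> C * 0) at_top"
    by (intro tendsto_mult_left filterlim_compose[OF exp_at_bot])
  then show "((\<lambda>x. f x) \<longlongrightarrow> 0) at_top"
    by (intro Lim_null_comparison[of f "\<lambda>x. C * exp (- (\<delta> * x))"])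
      (use b in \<open>auto intro!: eventually_mono[OF eventually_ge_at_top[of 0]]\<close>)
qed

lemma integrable_inverse_1_plus_square': "integrable lborel (\<lambda>x::real. inverse (1 + x\<^sup>2))"
  using integrable_inverse_1_plus_square by (simp add: set_integrable_def einterval_def)

context linear_recurrence
begin

definition W_hat :: "nat \<Rightarrow> real \<Rightarrow> complex" where
  "W_hat k = fourier (\<lambda>x. of_real (causal (W k) x))"

lemma integrable_causal_W: "integrable lborel (causal (W k))"
  by (rule exp_decay_causal[OF W_exp_decay]) measurable

lemma integrable_causal_W_of_real: "integrable lborel (\<lambda>x. complex_of_real (causal (W k) x))"
  using integrable_causal_W by simp

lemma causal_W_isCont: "x \<noteq> 0 \<Longrightarrow> isCont (\<lambda>x. complex_of_real (causal (W k) x)) x"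
proof -
  assume x: "x \<noteq> 0"
  have W: "isCont (W k) x" by (rule DERIV_isCont[OF W_deriv])
  have "isCont (causal (W k)) x"
  proof (cases "x > 0")
    case True
    then have "\<forall>\<^sub>F y in nhds x. causal (W k) y = W k y"
      by (intro eventually_mono[OF eventually_nhds_in_open[of "{0<..}"]]) (auto simp: causal_def)
    then show ?thesis using W isCont_cong by blast
  next
    case False
    then have "\<forall>\<^sub>F y in nhds x. causal (W k) y = 0"
      using x by (intro eventually_mono[OF eventually_nhds_in_open[of "{..<0}"]]) (auto simp: causal_def)
    then show ?thesis using isCont_cong[of "causal (W k)" "\<lambda>_. 0" x] by simp
  qed
  then show ?thesis by simp
qed

text \<open>Integration by parts on the half-line: the boundary term at infinity vanishes by
  exponential decay, the one at 0 is the jump \<open>W k 0 = s k\<close>.\<close>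

lemma W_hat_Suc: "W_hat (Suc k) \<omega> = \<i> * \<omega> * W_hat k \<omega> - s k"
proof -
  define g where "g k x = complex_of_real (W k x) * iexp (- (\<omega> * x))" for k x
  define G where "G x = g (Suc k) x - \<i> * \<omega> * g k x" for x
  have int: "integrable lborel (\<lambda>x. of_real (causal (W k) x) * iexp (- (\<omega> * x)))" for k
    by (intro integrable_times_iexp integrable_causal_W_of_real) simp
  \<comment> \<open>Interval integrals run over the open half-line, whereas \<open>causal\<close>
    includes 0; the two agree up to a null set.\<close>
  have ae: "AE x in lborel. indicator {0<..} x *\<^sub>R g k x = of_real (causal (W k) x) * iexp (- (\<omega> * x))" for k
    using AE_lborel_singleton[of 0] by eventually_elim (auto simp: g_def causal_def indicator_def)
  have gm[measurable]: "g k \<in> borel_measurable borel" for k unfolding g_def[abs_def] by measurable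
  have gi: "integrable lborel (\<lambda>x. indicator {0<..} x *\<^sub>R g k x)" for k
  proof (rule integrable_cong_AE_imp[OF int[of k]])
    show "AE x in lborel. of_real (causal (W k) x) * iexp (- (\<omega> * x)) = indicator {0<..} x *\<^sub>R g k x"
      using ae[of k] by eventually_elim (rule sym)
  qed measurable
  have gW: "(\<integral>x. indicator {0<..} x *\<^sub>R g k x \<partial>lborel) = W_hat k \<omega>" for k
    unfolding W_hat_def fourier_def using int[of k] by (intro integral_cong_AE ae) auto
  have dg: "(g k has_vector_derivative G x) (at x)" for x
  proof -
    have "((\<lambda>x. complex_of_real (W k x)) has_vector_derivative of_real (W (Suc k) x)) (at x)"
      by (rule has_vector_derivative_of_real[OF W_deriv])
    moreover have "((\<lambda>x. iexp (- (\<omega> * x))) has_vector_derivative (- \<i> * \<omega>) * iexp (- (\<omega> * x))) (at x)"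
      by (rule has_vector_derivative_real_field[where f="\<lambda>z. exp (\<i> * (- (of_real \<omega> * z)))", simplified of_real_mult[symmetric] of_real_minus[symmetric]])
        (auto intro!: derivative_eq_intros)
    ultimately show ?thesis unfolding g_def[abs_def] G_def
      by (rule has_vector_derivative_mult[THEN has_vector_derivative_eq_rhs]) (simp add: g_def algebra_simps)
  qed
  have "(LBINT x=0..\<infinity>. G x) = 0 - of_real (s k)"
  proof (rule interval_integral_FTC_integrable[where F="g k"])
    show "(g k has_vector_derivative G x) (at x)" for x by (rule dg)
    have "isCont (W k) x" for k x by (rule DERIV_isCont[OF W_deriv])
    then show "isCont G x" for x
      unfolding G_def[abs_def] g_def by (intro continuous_intros) auto
    show "set_integrable lborel (einterval 0 \<infinity>) G"
    proof -
      have "indicator (einterval 0 \<infinity>) x *\<^sub>R G x = indicator {0<..} x *\<^sub>R g (Suc k) x - \<i> * \<omega> * (indicator {0<..} x *\<^sub>R g k x)" for x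
        by (simp add: G_def scaleR_diff_right einterval_def greaterThan_def)
      then show ?thesis
        unfolding set_integrable_def
        using Bochner_Integration.integrable_diff[OF gi[of "Suc k"] integrable_mult_right[OF gi[of k], of "\<i> * \<omega>"]] by simp
    qed
    show "((g k \<circ> real_of_ereal) \<longlongrightarrow> of_real (s k)) (at_right 0)"
    proof -
      have "isCont (g k) 0" by (rule has_vector_derivative_continuous[OF dg])
      then have "(g k \<longlongrightarrow> g k 0) (at_right 0)"
        unfolding isCont_def by (rule tendsto_within_subset) simp
      then show ?thesis by (simp add: zero_ereal_def ereal_tendsto_simps g_def W_0)
    qed
    show "((g k \<circ> real_of_ereal) \<longlongrightarrow> 0) (at_left \<infinity>)"
      unfolding ereal_tendsto_simps
    proof (rule tendsto_norm_zero_cancel)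
      have "(W k \<longlongrightarrow> 0) at_top" by (rule exp_decay_causal(3)[OF W_exp_decay]) measurable
      then show "((\<lambda>x. norm (g k x)) \<longlongrightarrow> 0) at_top"
        by (simp add: g_def norm_mult tendsto_rabs_zero)
    qed
  qed simp
  moreover have "(LBINT x=0..\<infinity>. G x) = W_hat (Suc k) \<omega> - \<i> * \<omega> * W_hat k \<omega>"
  proof -
    have "(LBINT x=0..\<infinity>. G x) = (\<integral>x. indicator {0<..} x *\<^sub>R G x \<partial>lborel)"
      by (simp add: interval_lebesgue_integral_def set_lebesgue_integral_def einterval_def greaterThan_def)
    also have "\<dots> = (\<integral>x. indicator {0<..} x *\<^sub>R g (Suc k) x - \<i> * \<omega> * (indicator {0<..} x *\<^sub>R g k x) \<partial>lborel)"
      by (simp add: G_def scaleR_diff_right)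
    also have "\<dots> = W_hat (Suc k) \<omega> - \<i> * \<omega> * W_hat k \<omega>"
      using gi[of k] gi[of "Suc k"] by (subst Bochner_Integration.integral_diff) (simp_all only: integrable_mult_right integral_mult_right_zero gW)
    finally show ?thesis .
  qed
  ultimately show ?thesis by (simp add: algebra_simps)
qed

lemma W_hat_measurable [measurable]: "W_hat k \<in> borel_measurable borel"
  unfolding W_hat_def by measurable

text \<open>By \<open>W_hat_Suc\<close>, \<omega> times the transform is again a bounded function.
  Hence the decay 1/|\<omega>|, which a jump at 0 does not allow to improve and which makes products
  of two transforms integrable.\<close>

lemma W_hat_bound: "\<exists>C. \<forall>\<omega>. (cmod (W_hat k \<omega>))\<^sup>2 \<le> C * inverse (1 + \<omega>\<^sup>2)"
proof -
  define B where "B k = (\<integral>x. \<bar>causal (W k) x\<bar> \<partial>lborel)" for k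
  have B: "cmod (W_hat k \<omega>) \<le> B k" for k \<omega>
  proof -
    have "cmod (W_hat k \<omega>) \<le> (\<integral>x. cmod (of_real (causal (W k) x) * iexp (- (\<omega> * x))) \<partial>lborel)"
      unfolding W_hat_def fourier_def by (rule integral_norm_bound)
    then show ?thesis by (simp add: norm_mult B_def)
  qed
  have "(cmod (W_hat k \<omega>))\<^sup>2 \<le> ((B k)\<^sup>2 + (B (Suc k) + \<bar>s k\<bar>)\<^sup>2) * inverse (1 + \<omega>\<^sup>2)" for \<omega>
  proof -
    have "\<i> * \<omega> * W_hat k \<omega> = W_hat (Suc k) \<omega> + s k" by (simp add: W_hat_Suc)
    then have "\<bar>\<omega>\<bar> * cmod (W_hat k \<omega>) = cmod (W_hat (Suc k) \<omega> + s k)" by (metis norm_mult norm_ii norm_of_real mult_1)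
    also have "\<dots> \<le> cmod (W_hat (Suc k) \<omega>) + cmod (of_real (s k))" by (rule norm_triangle_ineq)
    also have "\<dots> \<le> B (Suc k) + \<bar>s k\<bar>" using B[of "Suc k" \<omega>] by simp
    finally have "(\<bar>\<omega>\<bar> * cmod (W_hat k \<omega>))\<^sup>2 \<le> (B (Suc k) + \<bar>s k\<bar>)\<^sup>2" by (rule power_mono) simp
    moreover have "(cmod (W_hat k \<omega>))\<^sup>2 \<le> (B k)\<^sup>2" by (rule power_mono[OF B]) simp
    ultimately have "(1 + \<omega>\<^sup>2) * (cmod (W_hat k \<omega>))\<^sup>2 \<le> (B k)\<^sup>2 + (B (Suc k) + \<bar>s k\<bar>)\<^sup>2"
      by (simp add: power_mult_distrib distrib_right)
    moreover have "1 + \<omega>\<^sup>2 > 0" by (simp add: add_pos_nonneg)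
    ultimately show ?thesis by (simp add: field_simps)
  qed
  then show ?thesis by blast
qed

end

section \<open>Integrals of products over the coordinates\<close>

text \<open>Lebesgue measure is the image of a product measure indexed by the basis vectors, while
  the product runs over the index type; the bijection from i to \<open>axis i 1\<close> mediates
  between them.\<close>

lemma integral_prod_coords:
  fixes f :: "'d::finite \<Rightarrow> real \<Rightarrow> complex"
  assumes f: "\<And>i. integrable lborel (f i)"
  shows "integrable lborel (\<lambda>x::real^'d. \<Prod>i\<in>UNIV. f i (vec_nth x i))"
    "integral\<^sup>L lborel (\<lambda>x::real^'d. \<Prod>i\<in>UNIV. f i (vec_nth x i)) = (\<Prod>i\<in>UNIV. integral\<^sup>L lborel (f i))"
proof -
  let ?b = "\<lambda>i. axis i (1::real) :: real^'d"
  have B: "bij_betw ?b UNIV Basis"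
    by (auto simp: bij_betw_def inj_on_def axis_eq_axis Basis_vec_def)
  define ix where "ix = the_inv_into UNIV ?b"
  have ix: "ix (?b i) = i" for i
    unfolding ix_def using B by (intro the_inv_into_f_f) (auto simp: bij_betw_def)
  have [measurable]: "f i \<in> borel_measurable borel" for i using f by auto
  have coord: "vec_nth (\<Sum>b\<in>Basis. \<omega> b *\<^sub>R b) i = \<omega> (?b i)" for \<omega> and i :: 'd
  proof -
    have "vec_nth (\<Sum>b\<in>Basis. \<omega> b *\<^sub>R b) i = inner (\<Sum>b\<in>Basis. \<omega> b *\<^sub>R b) (?b i)"
      by (simp add: cart_eq_inner_axis)
    also have "\<dots> = \<omega> (?b i)" by (rule inner_sum_left_Basis) (auto simp: Basis_vec_def)
    finally show ?thesis .
  qed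
  have prod: "(\<Prod>i\<in>UNIV. f i (vec_nth (\<Sum>b\<in>Basis. \<omega> b *\<^sub>R b) i)) = (\<Prod>b\<in>Basis. f (ix b) (\<omega> b))" for \<omega>
    unfolding coord using prod.reindex_bij_betw[OF B, of "\<lambda>b. f (ix b) (\<omega> b)"] by (simp add: ix)
  interpret P: product_sigma_finite "\<lambda>_::real^'d. lborel :: real measure" ..
  have m: "(\<lambda>x::real^'d. \<Prod>i\<in>UNIV. f i (vec_nth x i)) \<in> borel_measurable borel" by measurable
  have m': "(\<lambda>\<omega>. \<Sum>b\<in>Basis. \<omega> b *\<^sub>R b) \<in> measurable (PiM (Basis :: (real^'d) set) (\<lambda>_. lborel)) borel" by measurable
  show "integrable lborel (\<lambda>x::real^'d. \<Prod>i\<in>UNIV. f i (vec_nth x i))"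
    unfolding lborel_eq[where 'a="real^'d"] integrable_distr_eq[OF m' m] prod
    by (rule P.product_integrable_prod) (auto intro: f)
  have "integral\<^sup>L lborel (\<lambda>x::real^'d. \<Prod>i\<in>UNIV. f i (vec_nth x i)) = (\<Prod>b\<in>Basis. integral\<^sup>L lborel (f (ix b)))"
    unfolding lborel_eq[where 'a="real^'d"] integral_distr[OF m' m] prod
    by (rule P.product_integral_prod) (auto intro: f)
  also have "\<dots> = (\<Prod>i\<in>UNIV. integral\<^sup>L lborel (f i))"
    using prod.reindex_bij_betw[OF B, of "\<lambda>b. integral\<^sup>L lborel (f (ix b))"] by (simp add: ix)
  finally show "integral\<^sup>L lborel (\<lambda>x::real^'d. \<Prod>i\<in>UNIV. f i (vec_nth x i)) = (\<Prod>i\<in>UNIV. integral\<^sup>L lborel (f i))" .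
qed

section \<open>Companion matrices\<close>

lemma pow_mat_Suc_left:
  assumes A: "A \<in> carrier_mat n n"
  shows "A ^\<^sub>m Suc k = A * A ^\<^sub>m k"
proof (induction k)
  case 0
  then show ?case using A by simp
next
  case (Suc k)
  have "A ^\<^sub>m Suc (Suc k) = (A * A ^\<^sub>m k) * A" using Suc by simp
  also have "\<dots> = A * (A ^\<^sub>m k * A)"
    by (rule assoc_mult_mat[OF A pow_carrier_mat[OF A] A])
  finally show ?case by simp
qed

lemma smult_mult_mat:
  assumes "A \<in> carrier_mat n m" "B \<in> carrier_mat m l"
  shows "(c \<cdot>\<^sub>m A) * (d \<cdot>\<^sub>m B) = (c * d :: 'a::comm_semiring_1) \<cdot>\<^sub>m (A * B)"
  using assms by (intro eq_matI) (auto simp: scalar_prod_def sum_distrib_left ac_simps)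

lemma pow_mat_smult:
  fixes A :: "'a::comm_semiring_1 mat"
  assumes A: "A \<in> carrier_mat n n"
  shows "(c \<cdot>\<^sub>m A) ^\<^sub>m k = c ^ k \<cdot>\<^sub>m (A ^\<^sub>m k)"
proof (induction k)
  case 0
  show ?case using A by (intro eq_matI) auto
next
  case (Suc k)
  have "(c \<cdot>\<^sub>m A) ^\<^sub>m Suc k = (c ^ k \<cdot>\<^sub>m (A ^\<^sub>m k)) * (c \<cdot>\<^sub>m A)" using Suc by simp
  also have "\<dots> = (c ^ k * c) \<cdot>\<^sub>m (A ^\<^sub>m k * A)"
    by (rule smult_mult_mat[OF pow_carrier_mat[OF A] A])
  finally show ?case by (simp add: mult.commute)
qed

lemma companion_carrier: "companion a \<in> carrier_mat (degree a) (degree a)"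
  by (simp add: companion_def Let_def)

lemma companion_index:
  "k < degree a \<Longrightarrow> l < degree a \<Longrightarrow>
    companion a $$ (k, l) = (if k = degree a - 1 then - coeff a l else if l = k + 1 then 1 else 0)"
  by (simp add: companion_def Let_def)

lemma index_mult_mat_sum:
  assumes "A \<in> carrier_mat n m" "B \<in> carrier_mat m r" "k < n" "l < r"
  shows "(A * B) $$ (k, l) = (\<Sum>i<m. A $$ (k, i) * B $$ (i, l))"
  using assms by (simp add: scalar_prod_def atLeast0LessThan)

locale stable_poly =
  fixes a :: "real poly"
  assumes monic: "lead_coeff a = 1" and degree_pos: "0 < degree a"
    and stable: "\<And>z::complex. poly (map_poly of_real a) z = 0 \<Longrightarrow> Re z < 0"
begin

abbreviation "p \<equiv> degree a"

abbreviation "A \<equiv> companion a"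

text \<open>Multiplication by \<open>A\<close> from the left shifts the rows up by one, so that the first rows of the powers
  determine all entries.\<close>

definition top_row :: "nat \<Rightarrow> nat \<Rightarrow> real" where
  "top_row l n = (A ^\<^sub>m n) $$ (0, l)"

lemma companion_pow_Suc:
  assumes "k < p" "l < p"
  shows "(A ^\<^sub>m Suc n) $$ (k, l) =
    (if k = p - 1 then - (\<Sum>m<p. coeff a m * (A ^\<^sub>m n) $$ (m, l)) else (A ^\<^sub>m n) $$ (Suc k, l))"
proof -
  have "(A ^\<^sub>m Suc n) $$ (k, l) = (\<Sum>m<p. A $$ (k, m) * (A ^\<^sub>m n) $$ (m, l))"
    unfolding pow_mat_Suc_left[OF companion_carrier]
    by (rule index_mult_mat_sum[OF companion_carrier pow_carrier_mat[OF companion_carrier] assms])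
  also have "\<dots> = (if k = p - 1 then - (\<Sum>m<p. coeff a m * (A ^\<^sub>m n) $$ (m, l)) else (A ^\<^sub>m n) $$ (Suc k, l))"
  proof (cases "k = p - 1")
    case True
    then show ?thesis using assms by (simp add: companion_index sum_negf)
  next
    case False
    have "(\<Sum>m<p. A $$ (k, m) * (A ^\<^sub>m n) $$ (m, l)) = (\<Sum>m<p. if m = Suc k then (A ^\<^sub>m n) $$ (m, l) else 0)"
      using assms False by (intro sum.cong refl) (simp add: companion_index)
    then show ?thesis using assms False by simp
  qed
  finally show ?thesis .
qed

lemma companion_pow_index:
  assumes "k < p" "l < p"
  shows "(A ^\<^sub>m n) $$ (k, l) = top_row l (n + k)"
  using assms(1)
proof (induction k arbitrary: n)
  case (Suc k)
  then have "(A ^\<^sub>m n) $$ (Suc k, l) = (A ^\<^sub>m Suc n) $$ (k, l)"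
    using companion_pow_Suc[of k l n] assms(2) by auto
  also have "\<dots> = top_row l (Suc n + k)" using Suc by (intro Suc.IH) simp
  finally show ?case by simp
qed (simp add: top_row_def)

lemma top_row_delta: "k < p \<Longrightarrow> l < p \<Longrightarrow> top_row l k = (if k = l then 1 else 0)"
  using companion_pow_index[of k l 0] companion_carrier[of a] by simp

text \<open>The last row of A holds the negated coefficients of a, so with the row shift this is
  Cayley-Hamilton for the companion matrix, read along the first row.\<close>

lemma linear_recurrence_top_row: "l < p \<Longrightarrow> linear_recurrence a (top_row l)"
proof
  assume l: "l < p"
  fix n
  have "top_row l (n + p) = (A ^\<^sub>m Suc n) $$ (p - 1, l)"
    using companion_pow_index[of "p - 1" l "Suc n"] l degree_pos by simp
  also have "\<dots> = - (\<Sum>m<p. coeff a m * (A ^\<^sub>m n) $$ (m, l))"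
    using companion_pow_Suc[of "p - 1" l n] l degree_pos by simp
  also have "\<dots> = - (\<Sum>m<p. coeff a m * top_row l (n + m))"
    using l by (simp add: companion_pow_index)
  finally have "top_row l (n + p) = - (\<Sum>m<p. coeff a m * top_row l (n + m))" .
  moreover have "{..p} = insert p {..<p}" by auto
  ultimately show "(\<Sum>k\<le>p. coeff a k * top_row l (n + k)) = 0"
    using monic by simp
qed (use monic stable in auto)

text \<open>Moving down a row shifts the sequence, so each column of the exponential consists of one
  scalar solution and its successive derivatives.\<close>

lemma mat_exp_companion:
  assumes "k < p" "l < p"
  shows "mat_exp (x \<cdot>\<^sub>m A) $$ (k, l) = linear_recurrence.W (top_row l) k x"
proof -
  interpret linear_recurrence a "top_row l" by (rule linear_recurrence_top_row[OF assms(2)])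
  have "mat_exp (x \<cdot>\<^sub>m A) $$ (k, l) = (\<Sum>n. ((x \<cdot>\<^sub>m A) ^\<^sub>m n) $$ (k, l) / fact n)"
    using assms companion_carrier[of a] by (simp add: mat_exp_def)
  also have "\<dots> = (\<Sum>n. top_row l (n + k) / fact n * x ^ n)"
  proof (rule suminf_cong)
    fix n
    have "(x ^ n \<cdot>\<^sub>m (A ^\<^sub>m n)) $$ (k, l) = x ^ n * (A ^\<^sub>m n) $$ (k, l)"
      using assms pow_carrier_mat[OF companion_carrier[of a], of n] by (subst index_smult_mat) auto
    then show "((x \<cdot>\<^sub>m A) ^\<^sub>m n) $$ (k, l) / fact n = top_row l (n + k) / fact n * x ^ n"
      unfolding pow_mat_smult[OF companion_carrier] using assms by (simp add: companion_pow_index)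
  qed
  finally show ?thesis by (simp add: W_def)
qed

text \<open>The adjugate of z - A in closed form: entry (k, l) is the remainder modulo a of z^k
  times the quotient of a by z^(l+1). The subtraction in the exponents never truncates, since i > l
  in the first case and k > l in the second.\<close>

definition resolvent_numerator :: "real poly mat" where
  "resolvent_numerator = Matrix.mat p p (\<lambda>(k, l).
     if k \<le> l then (\<Sum>i\<in>{l<..p}. monom (coeff a i) (i + k - l - 1))
     else - (\<Sum>i\<le>l. monom (coeff a i) (i + k - l - 1)))"

lemma resolvent_numerator_carrier: "resolvent_numerator \<in> carrier_mat p p"
  by (simp add: resolvent_numerator_def)

lemma resolvent_numerator_index:
  "k < p \<Longrightarrow> l < p \<Longrightarrow> resolvent_numerator $$ (k, l) =
    (if k \<le> l then (\<Sum>i\<in>{l<..p}. monom (coeff a i) (i + k - l - 1))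
     else - (\<Sum>i\<le>l. monom (coeff a i) (i + k - l - 1)))"
  by (simp add: resolvent_numerator_def)

lemma split_at: "l < p \<Longrightarrow> {..p} = {..l} \<union> {l<..p}"
  by auto

lemma resolvent_numerator_times_X:
  assumes "k < p" "l < p"
  shows "monom 1 1 * resolvent_numerator $$ (k, l) =
    (if k \<le> l then (\<Sum>i\<in>{l<..p}. monom (coeff a i) (i + k - l))
     else - (\<Sum>i\<le>l. monom (coeff a i) (i + k - l)))"
  unfolding resolvent_numerator_index[OF assms]
  by (auto simp: sum_distrib_left mult_monom Suc_diff_Suc intro!: sum.cong)

text \<open>Entry (k, l) of Q (z - A) = a I: column l of z - A has z on the diagonal, -1 above it
  and a coefficient of a in the last row, which is multiplied by the last column entry z^k of
  Q.\<close>

lemma resolvent_numerator_identity: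
  assumes k: "k < p" and l: "l < p"
  shows "monom 1 1 * resolvent_numerator $$ (k, l) - (if l = 0 then 0 else resolvent_numerator $$ (k, l - 1))
    + monom (coeff a l) k = (if k = l then a else 0)"
proof -
  \<comment> \<open>The entries (k, l) and (k, l - 1) lie in different branches of the definition
    only for k = l > 0; there the lower and the upper sum join to all of a. For l = 0 there is no
    left neighbour.\<close>
  consider "l = 0" "k = l" | "l = 0" "k > l" | m where "l = Suc m" "k \<le> m" | m where "l = Suc m" "k = l"
    | m where "l = Suc m" "k > l"
    by (cases l) (auto, linarith)
  then show ?thesis
  proof cases
    case 1
    have "a = (\<Sum>i\<le>p. monom (coeff a i) i)" by (simp add: poly_as_sum_of_monoms)
    also have "\<dots> = monom (coeff a 0) 0 + (\<Sum>i\<in>{0<..p}. monom (coeff a i) i)"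
      using degree_pos by (subst split_at[of 0]) (auto simp: sum.union_disjoint)
    finally show ?thesis using 1 resolvent_numerator_times_X[OF k l] by simp
  next
    case 2
    then show ?thesis using resolvent_numerator_times_X[OF k l] by simp
  next
    case (3 m)
    have "{m<..p} = insert l {l<..p}" using 3 l by auto
    moreover have "(\<Sum>i\<in>{m<..p}. monom (coeff a i) (i + k - m - 1)) = (\<Sum>i\<in>{m<..p}. monom (coeff a i) (i + k - l))"
      using 3 by (intro sum.cong refl) simp
    ultimately show ?thesis
      using 3 resolvent_numerator_times_X[OF k l] resolvent_numerator_index[of k m] k l by simp
  next
    case (4 m)
    have "a = (\<Sum>i\<le>p. monom (coeff a i) i)" by (simp add: poly_as_sum_of_monoms)
    also have "\<dots> = (\<Sum>i\<le>l. monom (coeff a i) i) + (\<Sum>i\<in>{l<..p}. monom (coeff a i) i)"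
      unfolding split_at[OF l] by (rule sum.union_disjoint) auto
    finally have "a = (\<Sum>i\<le>m. monom (coeff a i) i) + monom (coeff a l) l + (\<Sum>i\<in>{l<..p}. monom (coeff a i) i)"
      using 4 by simp
    moreover have "(\<Sum>i\<le>m. monom (coeff a i) (i + k - m - 1)) = (\<Sum>i\<le>m. monom (coeff a i) i)"
      using 4 by (intro sum.cong refl) simp
    ultimately show ?thesis
      using 4 resolvent_numerator_times_X[OF k l] resolvent_numerator_index[of k m] k l by simp
  next
    case (5 m)
    have "(\<Sum>i\<le>m. monom (coeff a i) (i + k - m - 1)) = (\<Sum>i\<le>m. monom (coeff a i) (i + k - l))"
      using 5 by (intro sum.cong refl) simp
    then show ?thesis
      using 5 resolvent_numerator_times_X[OF k l] resolvent_numerator_index[of k m] k l by simp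
  qed
qed

lemma resolvent_numerator_last: "k < p \<Longrightarrow> resolvent_numerator $$ (k, p - 1) = monom 1 k"
proof -
  assume k: "k < p"
  have "{p - 1<..p} = {p}" using degree_pos by auto
  then show ?thesis using k monic by (simp add: resolvent_numerator_index)
qed

lemma resolvent_numerator_mult:
  "resolvent_numerator * char_poly_matrix A = a \<cdot>\<^sub>m 1\<^sub>m p"
proof (rule eq_matI)
  let ?Q = resolvent_numerator
  fix k l assume "k < dim_row (a \<cdot>\<^sub>m 1\<^sub>m p)" "l < dim_col (a \<cdot>\<^sub>m 1\<^sub>m p)"
  then have k: "k < p" and l: "l < p" by auto
  \<comment> \<open>A sum of contributions instead of a case distinction, because the diagonal and
    the last row meet at m = l = p - 1.\<close>
  have cpm: "char_poly_matrix A $$ (m, l) =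
      (if m = l then monom 1 1 else 0) - (if 0 < l \<and> m = l - 1 then 1 else 0) + (if m = p - 1 then [:coeff a l:] else 0)"
    if "m < p" for m
    using that l companion_carrier[of a]
    by (auto simp: char_poly_matrix_def companion_index monom_Suc monom_0 one_pCons)
  have "(?Q * char_poly_matrix A) $$ (k, l) = (\<Sum>m<p. ?Q $$ (k, m) * char_poly_matrix A $$ (m, l))"
    by (rule index_mult_mat_sum[OF resolvent_numerator_carrier _ k l])
      (simp add: companion_carrier)
  also have "\<dots> = (\<Sum>m<p. (if m = l then ?Q $$ (k, m) * monom 1 1 else 0)
      - (if m = l - 1 then (if 0 < l then ?Q $$ (k, m) else 0) else 0) + (if m = p - 1 then ?Q $$ (k, m) * [:coeff a l:] else 0))"
    by (intro sum.cong refl) (simp add: cpm algebra_simps)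
  also have "\<dots> = ?Q $$ (k, l) * monom 1 1 - (if 0 < l then ?Q $$ (k, l - 1) else 0) + ?Q $$ (k, p - 1) * [:coeff a l:]"
    using l degree_pos by (simp add: sum.distrib sum_subtractf)
  also have "\<dots> = monom 1 1 * ?Q $$ (k, l) - (if l = 0 then 0 else ?Q $$ (k, l - 1)) + monom (coeff a l) k"
    using k by (simp add: resolvent_numerator_last[unfolded One_nat_def] smult_monom mult.commute)
  also have "\<dots> = (if k = l then a else 0)" by (rule resolvent_numerator_identity[OF k l])
  finally show "(?Q * char_poly_matrix A) $$ (k, l) = (a \<cdot>\<^sub>m 1\<^sub>m p) $$ (k, l)" using k l by simp
qed (use resolvent_numerator_carrier char_poly_matrix_closed[OF companion_carrier[of a]] in auto)

lemma is_scaled_resolvent_numerator: "is_scaled_resolvent a resolvent_numerator"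
proof -
  interpret h: semiring_hom "to_fract :: real poly \<Rightarrow> real poly fract" by unfold_locales auto
  let ?Z = "map_mat to_fract (char_poly_matrix A)" and ?Q = "map_mat to_fract resolvent_numerator"
  define R where "R = inverse (to_fract a) \<cdot>\<^sub>m ?Q"
  have Z: "?Z \<in> carrier_mat p p" using companion_carrier[of a] by simp
  have Q: "?Q \<in> carrier_mat p p" using resolvent_numerator_carrier by simp
  have R: "R \<in> carrier_mat p p" using Q by (simp add: R_def)
  have a0: "to_fract a \<noteq> 0" using monic by auto
  have "?Q * ?Z = map_mat to_fract (a \<cdot>\<^sub>m 1\<^sub>m p)"
    using h.mat_hom_mult[OF resolvent_numerator_carrier, of "char_poly_matrix A" p] companion_carrier[of a]
    by (simp add: resolvent_numerator_mult)
  also have "\<dots> = to_fract a \<cdot>\<^sub>m 1\<^sub>m p" by (intro eq_matI) auto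
  finally have QZ: "?Q * ?Z = to_fract a \<cdot>\<^sub>m 1\<^sub>m p" .
  have "R * ?Z = inverse (to_fract a) \<cdot>\<^sub>m (?Q * ?Z)"
    unfolding R_def by (rule mult_smult_assoc_mat[OF Q Z])
  also have "\<dots> = 1\<^sub>m p" unfolding QZ using a0 by (intro eq_matI) auto
  finally have RZ: "R * ?Z = 1\<^sub>m p" .
  \<comment> \<open>Over the field of rational functions a left inverse of a square matrix is also a
    right inverse, so the product computed in \<open>resolvent_numerator_mult\<close> is
    enough.\<close>
  have ZR: "?Z * R = 1\<^sub>m p" by (rule mat_mult_left_right_inverse[OF R Z RZ])
  have "?Q = to_fract a \<cdot>\<^sub>m R" unfolding R_def using a0 by (intro eq_matI) (auto simp: mult.assoc[symmetric])
  then show ?thesis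
    unfolding is_scaled_resolvent_def Let_def inverts_mat_def
    using R RZ ZR Z resolvent_numerator_carrier by (intro conjI bexI[OF _ R]) auto
qed

text \<open>\<open>acoeff\<close> counts from the leading coefficient, whence the substitution j = p
  - i; for k \<le> l the term j = 0 is split off as the leading monomial. In the given ranges all
  exponents are true differences.\<close>

lemma resolvent_numerator_formula:
  assumes k: "k \<in> {1..p}" and l: "l \<in> {1..p}"
  shows "resolvent_numerator $$ (k - 1, l - 1) =
    (if k \<le> l
     then monom 1 (p + k - 1 - l) + (\<Sum>j=1..p-l. monom (acoeff a j) (p + k - 1 - j - l))
     else - (\<Sum>j=p-l+1..p. monom (acoeff a j) (p + k - 1 - j - l)))"
proof (cases "k \<le> l")
  case True
  have "resolvent_numerator $$ (k - 1, l - 1) = (\<Sum>i\<in>{l - 1<..p}. monom (coeff a i) (i + (k - 1) - (l - 1) - 1))"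
    using k l True by (subst resolvent_numerator_index) auto
  also have "\<dots> = (\<Sum>j\<le>p - l. monom (acoeff a j) (p + k - 1 - j - l))"
    by (rule sum.reindex_bij_witness[of _ "\<lambda>j. p - j" "\<lambda>i. p - i"])
      (use k l in \<open>auto simp: acoeff_def intro!: arg_cong2[where f=monom]\<close>)
  also have "{..p - l} = insert 0 {1..p - l}" by auto
  also have "(\<Sum>j\<in>\<dots>. monom (acoeff a j) (p + k - 1 - j - l)) =
      monom 1 (p + k - 1 - l) + (\<Sum>j=1..p-l. monom (acoeff a j) (p + k - 1 - j - l))"
    using monic by (simp add: acoeff_def)
  finally show ?thesis using True by simp
next
  case False
  have "resolvent_numerator $$ (k - 1, l - 1) = - (\<Sum>i\<le>l - 1. monom (coeff a i) (i + (k - 1) - (l - 1) - 1))"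
    using k l False by (subst resolvent_numerator_index) auto
  also have "(\<Sum>i\<le>l - 1. monom (coeff a i) (i + (k - 1) - (l - 1) - 1)) = (\<Sum>j=p-l+1..p. monom (acoeff a j) (p + k - 1 - j - l))"
    by (rule sum.reindex_bij_witness[of _ "\<lambda>j. p - j" "\<lambda>i. p - i"])
      (use k l False in \<open>auto simp: acoeff_def intro!: arg_cong2[where f=monom]\<close>)
  finally show ?thesis using False by simp
qed

end

section \<open>Transforms of the entries of the matrix exponential\<close>

context linear_recurrence
begin

lemma sum_W_hat: "(\<Sum>k\<le>degree a. of_real (coeff a k) * W_hat k \<omega>) = 0"
proof -
  have int: "integrable lborel (\<lambda>x. of_real (causal (W k) x) * iexp (- (\<omega> * x)))" for k
    by (intro integrable_times_iexp integrable_causal_W_of_real) simp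
  have "(\<Sum>k\<le>degree a. of_real (coeff a k) * W_hat k \<omega>) =
      (\<Sum>k\<le>degree a. \<integral>x. of_real (coeff a k) * (of_real (causal (W k) x) * iexp (- (\<omega> * x))) \<partial>lborel)"
    by (simp add: W_hat_def fourier_def)
  also have "\<dots> = (\<integral>x. (\<Sum>k\<le>degree a. of_real (coeff a k) * (of_real (causal (W k) x) * iexp (- (\<omega> * x)))) \<partial>lborel)"
    by (rule Bochner_Integration.integral_sum[symmetric]) (rule integrable_mult_right[OF int])
  also have "\<dots> = (\<integral>x. 0 \<partial>(lborel :: real measure))"
  proof (rule Bochner_Integration.integral_cong[OF refl])
    fix x
    have "(\<Sum>k\<le>degree a. coeff a k * causal (W k) x) = 0"
      using W_recurrence[of 0 x] by (cases "0 \<le> x") (simp_all add: causal_def)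
    then have "of_real (\<Sum>k\<le>degree a. coeff a k * causal (W k) x) * iexp (- (\<omega> * x)) = 0"
      by (simp only: of_real_0 mult_zero_left)
    then show "(\<Sum>k\<le>degree a. of_real (coeff a k) * (of_real (causal (W k) x) * iexp (- (\<omega> * x)))) = 0"
      by (simp add: sum_distrib_right mult.assoc)
  qed
  finally show ?thesis by simp
qed

end

lemma poly_of_real_add:
  "poly (map_poly complex_of_real (q + r)) z = poly (map_poly of_real q) z + poly (map_poly of_real r) z"
proof -
  have "map_poly complex_of_real (q + r) = map_poly of_real q + map_poly of_real r"
    by (rule poly_eqI) (simp add: coeff_map_poly)
  then show ?thesis by simp
qed

lemma poly_of_real_uminus: "poly (map_poly complex_of_real (- q)) z = - poly (map_poly of_real q) z"
proof -
  have "map_poly complex_of_real (- q) = - map_poly of_real q"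
    by (rule poly_eqI) (simp add: coeff_map_poly)
  then show ?thesis by simp
qed

lemma poly_of_real_sum:
  "poly (map_poly complex_of_real (sum f S)) z = (\<Sum>i\<in>S. poly (map_poly of_real (f i)) z)"
  by (induction S rule: infinite_finite_induct) (simp_all add: poly_of_real_add)

context stable_poly
begin

definition entry_hat :: "nat \<times> nat \<Rightarrow> real \<Rightarrow> complex" where
  "entry_hat kl = linear_recurrence.W_hat (top_row (snd kl)) (fst kl)"

text \<open>Each derivative brings a factor i \<omega> and subtracts an initial value, which is 1 at
  step l and 0 at the other steps below p. So a single correction arises and is then carried along
  as a power. The index k = p is no matrix entry, but occurs in the transformed recurrence.\<close>

lemma entry_hat_recursion:
  assumes "l < p" "k \<le> p"
  shows "entry_hat (k, l) \<omega> = (\<i> * \<omega>) ^ k * entry_hat (0, l) \<omega> - (if l < k then (\<i> * \<omega>) ^ (k - 1 - l) else 0)"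
proof -
  interpret r: linear_recurrence a "top_row l" by (rule linear_recurrence_top_row[OF assms(1)])
  show ?thesis using assms(2)
  proof (induction k)
    case (Suc k)
    have "entry_hat (Suc k, l) \<omega> = \<i> * \<omega> * entry_hat (k, l) \<omega> - top_row l k"
      by (simp add: entry_hat_def r.W_hat_Suc)
    also have "\<dots> = \<i> * \<omega> * ((\<i> * \<omega>) ^ k * entry_hat (0, l) \<omega> - (if l < k then (\<i> * \<omega>) ^ (k - 1 - l) else 0)) - (if k = l then 1 else 0)"
      using Suc assms(1) by (simp add: top_row_delta)
    also have "\<dots> = (\<i> * \<omega>) ^ Suc k * entry_hat (0, l) \<omega> - (if l < Suc k then (\<i> * \<omega>) ^ (Suc k - 1 - l) else 0)"
    proof (cases "l < k")
      case True
      then have "Suc (k - 1 - l) = Suc k - 1 - l" by simp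
      then have "\<i> * \<omega> * (\<i> * \<omega>) ^ (k - 1 - l) = (\<i> * \<omega>) ^ (Suc k - 1 - l)" by (metis power_Suc)
      then show ?thesis using True by (simp add: right_diff_distrib)
    qed auto
    finally show ?case .
  qed simp
qed

text \<open>The transform of the causal exponential is (i \<omega> - A)^(-1), derived entry by
  entry: the transformed recurrence is an equation for row 0 alone, and
  \<open>entry_hat_recursion\<close> yields the other rows from it.\<close>

lemma resolvent_numerator_entry_hat:
  assumes k: "k < p" and l: "l < p"
  shows "poly (map_poly of_real (resolvent_numerator $$ (k, l))) (\<i> * \<omega>) =
    poly (map_poly of_real a) (\<i> * \<omega>) * entry_hat (k, l) \<omega>"
proof -
  interpret r: linear_recurrence a "top_row l" by (rule linear_recurrence_top_row[OF l])
  define z where "z = \<i> * complex_of_real \<omega>"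
  define P where "P = poly (map_poly of_real a) z"
  have P: "P = (\<Sum>i\<le>p. of_real (coeff a i) * z ^ i)"
    by (simp add: P_def poly_altdef coeff_map_poly)
  have rec: "entry_hat (i, l) \<omega> = z ^ i * entry_hat (0, l) \<omega> - (if l < i then z ^ (i - 1 - l) else 0)" if "i \<le> p" for i
    using entry_hat_recursion[OF l that] by (simp add: z_def)
  have "0 = (\<Sum>i\<le>p. of_real (coeff a i) * entry_hat (i, l) \<omega>)"
    using r.sum_W_hat[of \<omega>] by (simp add: entry_hat_def)
  also have "\<dots> = (\<Sum>i\<le>p. of_real (coeff a i) * z ^ i * entry_hat (0, l) \<omega> - (if l < i then of_real (coeff a i) * z ^ (i - 1 - l) else 0))"
  proof (rule sum.cong[OF refl])
    fix i assume "i \<in> {..p}"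
    then have "i \<le> p" by simp
    show "of_real (coeff a i) * entry_hat (i, l) \<omega> = of_real (coeff a i) * z ^ i * entry_hat (0, l) \<omega>
        - (if l < i then of_real (coeff a i) * z ^ (i - 1 - l) else 0)"
      unfolding rec[OF \<open>i \<le> p\<close>] by (simp add: right_diff_distrib mult.assoc)
  qed
  also have "\<dots> = P * entry_hat (0, l) \<omega> - (\<Sum>i\<le>p. if l < i then of_real (coeff a i) * z ^ (i - 1 - l) else 0)"
    by (simp add: P sum_subtractf sum_distrib_right)
  also have "(\<Sum>i\<le>p. if l < i then of_real (coeff a i) * z ^ (i - 1 - l) else 0) =
      (\<Sum>i\<in>{l<..p}. of_real (coeff a i) * z ^ (i - 1 - l))"
    by (intro sum.mono_neutral_cong_right) auto
  finally have F0: "P * entry_hat (0, l) \<omega> = (\<Sum>i\<in>{l<..p}. of_real (coeff a i) * z ^ (i - 1 - l))" by simp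
  have "P * entry_hat (k, l) \<omega> = z ^ k * (P * entry_hat (0, l) \<omega>) - (if l < k then P * z ^ (k - 1 - l) else 0)"
    unfolding rec[OF less_imp_le[OF k]] by (simp add: right_diff_distrib mult.left_commute)
  also have "z ^ k * (P * entry_hat (0, l) \<omega>) = (\<Sum>i\<in>{l<..p}. of_real (coeff a i) * z ^ (i + k - l - 1))"
    unfolding F0 sum_distrib_left
  proof (rule sum.cong[OF refl])
    fix i assume "i \<in> {l<..p}"
    then have "i + k - l - 1 = k + (i - 1 - l)" by auto
    then show "z ^ k * (of_real (coeff a i) * z ^ (i - 1 - l)) = of_real (coeff a i) * z ^ (i + k - l - 1)"
      by (simp only: power_add) (simp add: mult.left_commute)
  qed
  finally have PF: "P * entry_hat (k, l) \<omega> = (\<Sum>i\<in>{l<..p}. of_real (coeff a i) * z ^ (i + k - l - 1))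
      - (if l < k then P * z ^ (k - 1 - l) else 0)" .
  show ?thesis
  proof (cases "k \<le> l")
    case True
    then have "poly (map_poly of_real (resolvent_numerator $$ (k, l))) z = P * entry_hat (k, l) \<omega>"
      by (simp add: PF resolvent_numerator_index[OF k l] poly_of_real_sum poly_monom map_poly_monom)
    then show ?thesis by (simp add: P_def z_def)
  next
    case False
    \<comment> \<open>For k > l, subtracting this term removes the coefficients with i > l and
      leaves the negative of those with i \<le> l, as in the second case of
      \<open>resolvent_numerator\<close>.\<close>
    have "P * z ^ (k - 1 - l) = (\<Sum>i\<le>p. of_real (coeff a i) * z ^ (i + k - l - 1))"
      unfolding P sum_distrib_right
    proof (rule sum.cong[OF refl])
      fix i
      have "i + k - l - 1 = i + (k - 1 - l)" using False by simp
      then show "of_real (coeff a i) * z ^ i * z ^ (k - 1 - l) = of_real (coeff a i) * z ^ (i + k - l - 1)"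
        by (simp only: power_add mult.assoc)
    qed
    also have "\<dots> = (\<Sum>i\<le>l. of_real (coeff a i) * z ^ (i + k - l - 1)) + (\<Sum>i\<in>{l<..p}. of_real (coeff a i) * z ^ (i + k - l - 1))"
      unfolding split_at[OF l] by (rule sum.union_disjoint) auto
    finally have "P * entry_hat (k, l) \<omega> = - (\<Sum>i\<le>l. of_real (coeff a i) * z ^ (i + k - l - 1))"
      using False by (simp add: PF)
    then have "poly (map_poly of_real (resolvent_numerator $$ (k, l))) z = P * entry_hat (k, l) \<omega>"
      using False by (simp add: resolvent_numerator_index[OF k l] poly_of_real_sum poly_monom map_poly_monom poly_of_real_uminus)
    then show ?thesis by (simp add: P_def z_def)
  qed
qed

end

section \<open>Expansion of matrix products into entries\<close>

lemma foldr_mat_carrier: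
  assumes "\<And>i. N i \<in> carrier_mat p p"
  shows "foldr (\<lambda>i R. N i * R) xs (1\<^sub>m p) \<in> carrier_mat p p"
  by (induction xs) (use assms in \<open>auto intro: mult_carrier_mat\<close>)

lemma coord_mat_prod_carrier:
  "(\<And>i. N i \<in> carrier_mat p p) \<Longrightarrow> coord_mat_prod p N \<in> carrier_mat p p"
  unfolding coord_mat_prod_def by (rule foldr_mat_carrier)

text \<open>Expanding a matrix product over all paths of indices gives a sum whose terms contain one entry of
  every factor. It decouples the coordinates.\<close>

inductive entry_sum :: "nat \<Rightarrow> 'd set \<Rightarrow> (('d \<Rightarrow> complex mat) \<Rightarrow> complex) \<Rightarrow> bool" for p S where
  entry_sum_zero: "entry_sum p S (\<lambda>_. 0)"
| entry_sum_step: "entry_sum p S f \<Longrightarrow> (\<And>i. fst (\<kappa> i) < p \<and> snd (\<kappa> i) < p) \<Longrightarrow>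
    entry_sum p S (\<lambda>N. f N + c * (\<Prod>i\<in>S. N i $$ \<kappa> i))"

lemma entry_sum_add:
  assumes f: "entry_sum p S f" and g: "entry_sum p S g"
  shows "entry_sum p S (\<lambda>N. f N + g N)"
  using g
proof induction
  case entry_sum_zero
  then show ?case using f by simp
next
  case (entry_sum_step g \<kappa> c)
  then show ?case
    using entry_sum.entry_sum_step[of p S "\<lambda>N. f N + g N" \<kappa> c] by (simp add: add.assoc)
qed

lemma entry_sum_cmult: "entry_sum p S f \<Longrightarrow> entry_sum p S (\<lambda>N. d * f N)"
proof (induction rule: entry_sum.induct)
  case entry_sum_zero
  then show ?case by (simp add: entry_sum.entry_sum_zero)
next
  case (entry_sum_step f \<kappa> c)
  then show ?case
    using entry_sum.entry_sum_step[of p S "\<lambda>N. d * f N" \<kappa> "d * c"] by (simp add: distrib_left mult.assoc)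
qed

lemma entry_sum_sum: "(\<And>j. j \<in> J \<Longrightarrow> entry_sum p S (f j)) \<Longrightarrow> entry_sum p S (\<lambda>N. \<Sum>j\<in>J. f j N)"
proof (induction J rule: infinite_finite_induct)
  case (insert j J)
  then show ?case using entry_sum_add[of p S "f j"] by simp
qed (simp_all add: entry_sum_zero)

lemma entry_sum_insert:
  assumes "entry_sum p S f" "finite S" "x \<notin> S" "k < p" "m < p"
  shows "entry_sum p (insert x S) (\<lambda>N. N x $$ (k, m) * f N)"
  using assms(1)
proof induction
  case entry_sum_zero
  then show ?case by (simp add: entry_sum.entry_sum_zero)
next
  case (entry_sum_step f \<kappa> c)
  have "(\<Prod>i\<in>S. N i $$ (if i = x then (k, m) else \<kappa> i)) = (\<Prod>i\<in>S. N i $$ \<kappa> i)" for N :: "'a \<Rightarrow> complex mat"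
    using assms(3) by (intro prod.cong refl) auto
  then have "N x $$ (k, m) * (f N + c * (\<Prod>i\<in>S. N i $$ \<kappa> i)) =
      N x $$ (k, m) * f N + c * (\<Prod>i\<in>insert x S. N i $$ (if i = x then (k, m) else \<kappa> i))" for N :: "'a \<Rightarrow> complex mat"
    using assms(2,3) by (simp add: distrib_left mult.left_commute)
  moreover have "entry_sum p (insert x S)
      (\<lambda>N. N x $$ (k, m) * f N + c * (\<Prod>i\<in>insert x S. N i $$ (if i = x then (k, m) else \<kappa> i)))"
    using entry_sum_step assms(4,5) by (intro entry_sum.entry_sum_step) auto
  ultimately show ?case by (simp only:)
qed

lemma entry_sum_foldr:
  fixes xs :: "'d list"
  assumes "distinct xs" "k < p" "l < p"
  shows "\<exists>f. entry_sum p (set xs) f \<and>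
    (\<forall>N. (\<forall>i. N i \<in> carrier_mat p p) \<longrightarrow> foldr (\<lambda>i R. N i * R) xs (1\<^sub>m p) $$ (k, l) = f N)"
  using assms(1,2)
proof (induction xs arbitrary: k)
  case Nil
  \<comment> \<open>The empty product is 1, so the entry of the identity matrix is a legitimate
    single term; the index (0, 0) is a dummy.\<close>
  have "entry_sum p {} (\<lambda>N :: 'd \<Rightarrow> complex mat. 0 + (if k = l then 1 else 0) * (\<Prod>i\<in>{}. N i $$ (0, 0)))"
    by (rule entry_sum_step[OF entry_sum_zero, where \<kappa>="\<lambda>_. (0, 0)"]) (use assms(3) in auto)
  then show ?case using Nil assms(3) by (intro exI conjI) auto
next
  case (Cons x xs)
  have xs: "distinct xs" and x: "x \<notin> set xs" using Cons.prems by auto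
  \<comment> \<open>Chosen for each m before any family N is given, so that the expression built
    from the \<open>f m\<close> is again independent of N.\<close>
  define f where "f m = (SOME f. entry_sum p (set xs) f \<and>
    (\<forall>N. (\<forall>i. N i \<in> carrier_mat p p) \<longrightarrow> foldr (\<lambda>i R. N i * R) xs (1\<^sub>m p) $$ (m, l) = f N))" for m
  have f: "entry_sum p (set xs) (f m)"
    "\<And>N. (\<And>i. N i \<in> carrier_mat p p) \<Longrightarrow> foldr (\<lambda>i R. N i * R) xs (1\<^sub>m p) $$ (m, l) = f m N" if "m < p" for m
    using someI_ex[OF Cons.IH[OF xs that]] unfolding f_def[symmetric] by blast+
  have "entry_sum p (set (x # xs)) (\<lambda>N. \<Sum>m<p. N x $$ (k, m) * f m N)"
    using f(1) x Cons.prems(2) by (auto intro!: entry_sum_sum entry_sum_insert)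
  moreover have "foldr (\<lambda>i R. N i * R) (x # xs) (1\<^sub>m p) $$ (k, l) = (\<Sum>m<p. N x $$ (k, m) * f m N)"
    if N: "\<And>i. N i \<in> carrier_mat p p" for N
  proof -
    have "foldr (\<lambda>i R. N i * R) (x # xs) (1\<^sub>m p) $$ (k, l) =
        (\<Sum>m<p. N x $$ (k, m) * foldr (\<lambda>i R. N i * R) xs (1\<^sub>m p) $$ (m, l))"
      using index_mult_mat_sum[OF N foldr_mat_carrier[OF N] Cons.prems(2) assms(3)] by simp
    then show ?thesis using f(2)[OF _ N] by simp
  qed
  ultimately show ?case by blast
qed

lemma entry_sum_expand:
  assumes f: "entry_sum p S f" and p: "0 < p"
  shows "\<exists>m c \<kappa>. (\<forall>j i. fst (\<kappa> j i) < p \<and> snd (\<kappa> j i) < p) \<and>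
    (\<forall>N. f N = (\<Sum>j<(m::nat). c j * (\<Prod>i\<in>S. N i $$ \<kappa> j i)))"
  using f
proof induction
  case entry_sum_zero
  show ?case by (rule exI[of _ 0], rule exI, rule exI[of _ "\<lambda>_ _. (0, 0)"]) (use p in simp)
next
  case (entry_sum_step f \<kappa>' c')
  then obtain m c \<kappa> where *: "\<And>j i. fst (\<kappa> j i) < p \<and> snd (\<kappa> j i) < p"
    "\<And>N. f N = (\<Sum>j<(m::nat). c j * (\<Prod>i\<in>S. N i $$ \<kappa> j i))" by blast
  show ?case
    by (rule exI[of _ "Suc m"], rule exI[of _ "c(m := c')"], rule exI[of _ "\<kappa>(m := \<kappa>')"])
      (use * entry_sum_step in auto)
qed

text \<open>The quantifier over N comes last: coefficients and index paths depend on v and p alone,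
  so the kernel and \<open>carma_Q\<close> can share them.\<close>

lemma coord_mat_prod_expansion:
  fixes v :: "complex Matrix.vec"
  assumes v: "v \<in> carrier_vec p" and p: "0 < p"
  shows "\<exists>m c (\<kappa> :: nat \<Rightarrow> 'd::{finite,linorder} \<Rightarrow> nat \<times> nat).
    (\<forall>j i. fst (\<kappa> j i) < p \<and> snd (\<kappa> j i) < p) \<and>
    (\<forall>N :: 'd \<Rightarrow> complex mat. (\<forall>i. N i \<in> carrier_mat p p) \<longrightarrow>
      scalar_prod v (coord_mat_prod p N *\<^sub>v unit_vec p (p - 1)) = (\<Sum>j<m. c j * (\<Prod>i\<in>UNIV. N i $$ \<kappa> j i)))"
proof -
  let ?xs = "sorted_list_of_set (UNIV :: 'd set)"
  define f where "f k = (SOME f. entry_sum p (set ?xs) f \<and>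
    (\<forall>N. (\<forall>i. N i \<in> carrier_mat p p) \<longrightarrow> foldr (\<lambda>i R. N i * R) ?xs (1\<^sub>m p) $$ (k, p - 1) = f N))" for k
  have ex: "\<exists>f. entry_sum p (set ?xs) f \<and>
    (\<forall>N. (\<forall>i. N i \<in> carrier_mat p p) \<longrightarrow> foldr (\<lambda>i R. N i * R) ?xs (1\<^sub>m p) $$ (k, p - 1) = f N)" if "k < p" for k
    by (rule entry_sum_foldr) (use that p in auto)
  have f: "entry_sum p (set ?xs) (f k)"
    "\<And>N. (\<And>i. N i \<in> carrier_mat p p) \<Longrightarrow> foldr (\<lambda>i R. N i * R) ?xs (1\<^sub>m p) $$ (k, p - 1) = f k N" if "k < p" for k
    using someI_ex[OF ex[OF that]] unfolding f_def[symmetric] by blast+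
  have "entry_sum p (set ?xs) (\<lambda>N. \<Sum>k<p. v $ k * f k N)"
    by (rule entry_sum_sum) (rule entry_sum_cmult, rule f, simp)
  then have "entry_sum p UNIV (\<lambda>N :: 'd \<Rightarrow> complex mat. \<Sum>k<p. v $ k * f k N)" by simp
  from entry_sum_expand[OF this p] obtain m c \<kappa> where \<kappa>: "\<forall>j i. fst (\<kappa> j i) < p \<and> snd (\<kappa> j i) < p"
    and sum: "\<And>N :: 'd \<Rightarrow> complex mat. (\<Sum>k<p. v $ k * f k N) = (\<Sum>j<(m::nat). c j * (\<Prod>i\<in>UNIV. N i $$ \<kappa> j i))"
    by blast
  have "scalar_prod v (coord_mat_prod p N *\<^sub>v unit_vec p (p - 1)) = (\<Sum>j<m. c j * (\<Prod>i\<in>UNIV. N i $$ \<kappa> j i))"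
    if N: "\<forall>i. N i \<in> carrier_mat p p" for N :: "'d \<Rightarrow> complex mat"
  proof -
    have C: "coord_mat_prod p N \<in> carrier_mat p p" by (rule coord_mat_prod_carrier) (use N in blast)
    have "(coord_mat_prod p N *\<^sub>v unit_vec p (p - 1)) $ k = coord_mat_prod p N $$ (k, p - 1)" if "k < p" for k
      using C p that by (simp add: scalar_prod_right_unit)
    then have "scalar_prod v (coord_mat_prod p N *\<^sub>v unit_vec p (p - 1)) = (\<Sum>k<p. v $ k * coord_mat_prod p N $$ (k, p - 1))"
      using C v unfolding scalar_prod_def by (simp add: atLeast0LessThan)
    also have "\<dots> = (\<Sum>k<p. v $ k * f k N)"
      unfolding coord_mat_prod_def using f(2)[of _ N] N by (intro sum.cong refl) simp
    finally show ?thesis by (simp only: sum)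
  qed
  with \<kappa> show ?thesis by blast
qed

section \<open>Parseval's identity for sums of products over the coordinates\<close>

text \<open>Both sides expand over pairs (j, j') into terms that factor over the coordinates, where
  \<open>fourier_correlation\<close> applies and gives 2 pi per coordinate. The first claim with t'
  = t will give the square integrability of the kernel.\<close>

lemma product_plancherel:
  fixes U :: "nat \<Rightarrow> 'd::finite \<Rightarrow> real \<Rightarrow> complex" and c :: "nat \<Rightarrow> complex" and m :: nat
  defines "g \<equiv> \<lambda>t s :: real^'d. \<Sum>j<m. c j * (\<Prod>i\<in>UNIV. U j i (vec_nth t i - vec_nth s i))"
    and "H \<equiv> \<lambda>\<omega> :: real^'d. \<Sum>j<m. c j * (\<Prod>i\<in>UNIV. fourier (U j i) (vec_nth \<omega> i))"
  assumes U: "\<And>j i. j < m \<Longrightarrow> integrable lborel (U j i)" "\<And>j i. j < m \<Longrightarrow> \<exists>B. \<forall>x. cmod (U j i x) \<le> B"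
      "\<And>j i. j < m \<Longrightarrow> \<forall>x. x \<noteq> 0 \<longrightarrow> isCont (U j i) x"
    and FF: "\<And>j j' i. j < m \<Longrightarrow> j' < m \<Longrightarrow> integrable lborel (\<lambda>\<omega>. fourier (U j i) \<omega> * cnj (fourier (U j' i) \<omega>))"
  shows "integrable lborel (\<lambda>s. g t s * cnj (g t' s))"
    and "integrable lborel (\<lambda>\<omega>. (cmod (H \<omega>))\<^sup>2)"
    and "(\<integral>\<omega>. exp (\<i> * of_real (inner \<omega> t)) * of_real ((cmod (H \<omega>))\<^sup>2) \<partial>lborel) =
      (2 * pi) ^ CARD('d) * (\<integral>s. g t s * cnj (g 0 s) \<partial>lborel)"
proof -
  define u where "u t t' j j' i s = U j i (vec_nth t i - s) * cnj (U j' i (vec_nth t' i - s))"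
    for t t' :: "real^'d" and j j' i s
  have u_int: "integrable lborel (u t t' j j' i)" if j: "j < m" "j' < m" for t t' j j' i
  proof -
    obtain B where B: "\<And>x. cmod (U j i x) \<le> B" using U(2)[OF j(1)] by blast
    have shift: "integrable lborel (\<lambda>s. U j i (vec_nth t i - s))" if "j < m" for t :: "real^'d" and j
      using lborel_integrable_real_affine[OF U(1)[OF that, of i], of "- 1" "vec_nth t i"] by simp
    show ?thesis unfolding u_def
    proof (rule Bochner_Integration.integrable_bound)
      show "integrable lborel (\<lambda>s. B * cmod (U j' i (vec_nth t' i - s)))" using shift[OF j(2)] by simp
      show "(\<lambda>s. U j i (vec_nth t i - s) * cnj (U j' i (vec_nth t' i - s))) \<in> borel_measurable lborel"
        using borel_measurable_integrable[OF shift[OF j(1)]] borel_measurable_integrable[OF shift[OF j(2)]]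
        by simp
      show "AE s in lborel. norm (U j i (vec_nth t i - s) * cnj (U j' i (vec_nth t' i - s))) \<le> norm (B * cmod (U j' i (vec_nth t' i - s)))"
        using B by (intro AE_I2) (auto simp: norm_mult intro!: order_trans[OF mult_right_mono[OF B] abs_ge_self])
    qed
  qed
  have gg: "g t s * cnj (g t' s) = (\<Sum>j<m. \<Sum>j'<m. c j * cnj (c j') * (\<Prod>i\<in>UNIV. u t t' j j' i (vec_nth s i)))" for t t' s
    unfolding g_def u_def by (simp add: sum_product prod.distrib ac_simps)
  have ggi: "integrable lborel (\<lambda>s. c j * cnj (c j') * (\<Prod>i\<in>UNIV. u t t' j j' i (vec_nth s i)))" if "j < m" "j' < m" for t t' j j'
    using that by (intro integrable_mult_right integral_prod_coords(1) u_int)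
  show "integrable lborel (\<lambda>s. g t s * cnj (g t' s))"
    unfolding gg by (intro Bochner_Integration.integrable_sum ggi) auto
  define v where "v t j j' i \<omega> = fourier (U j i) \<omega> * cnj (fourier (U j' i) \<omega>) * iexp (\<omega> * vec_nth t i)"
    for t :: "real^'d" and j j' i \<omega>
  have v_int: "integrable lborel (v t j j' i)" if "j < m" "j' < m" for t j j' i
    unfolding v_def by (intro integrable_times_iexp FF that) simp
  have HH: "exp (\<i> * of_real (inner \<omega> t)) * of_real ((cmod (H \<omega>))\<^sup>2) =
      (\<Sum>j<m. \<Sum>j'<m. c j * cnj (c j') * (\<Prod>i\<in>UNIV. v t j j' i (vec_nth \<omega> i)))" for t \<omega>
  proof -
    have "exp (\<i> * of_real (inner \<omega> t)) = (\<Prod>i\<in>UNIV. iexp (vec_nth \<omega> i * vec_nth t i))"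
      by (simp add: inner_vec_def sum_distrib_left exp_sum)
    moreover have "complex_of_real ((cmod (H \<omega>))\<^sup>2) = (\<Sum>j<m. \<Sum>j'<m. c j * cnj (c j') *
        (\<Prod>i\<in>UNIV. fourier (U j i) (vec_nth \<omega> i) * cnj (fourier (U j' i) (vec_nth \<omega> i))))"
      unfolding complex_norm_square H_def by (simp add: sum_product prod.distrib ac_simps)
    ultimately show ?thesis
      unfolding v_def by (simp add: sum_distrib_left prod.distrib ac_simps)
  qed
  have HHi: "integrable lborel (\<lambda>\<omega>. c j * cnj (c j') * (\<Prod>i\<in>UNIV. v t j j' i (vec_nth \<omega> i)))" if "j < m" "j' < m" for t j j'
    using that by (intro integrable_mult_right integral_prod_coords(1) v_int)
  \<comment> \<open>At t = 0 the exponential is 1, so the expansion \<open>HH\<close> covers the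
    integrability of the squared modulus as well.\<close>
  have "integrable lborel (\<lambda>\<omega>. exp (\<i> * of_real (inner \<omega> 0)) * complex_of_real ((cmod (H \<omega>))\<^sup>2))"
    unfolding HH by (intro Bochner_Integration.integrable_sum HHi) auto
  then have "integrable lborel (\<lambda>\<omega>. complex_of_real ((cmod (H \<omega>))\<^sup>2))" by simp
  from integrable_Re[OF this] show "integrable lborel (\<lambda>\<omega>. (cmod (H \<omega>))\<^sup>2)" by simp
  have uv: "integral\<^sup>L lborel (v t j j' i) = 2 * pi * integral\<^sup>L lborel (u t 0 j j' i)" if j: "j < m" "j' < m" for j j' i
  proof -
    obtain B where B: "\<And>x. cmod (U j i x) \<le> B" using U(2)[OF j(1)] by blast
    have "integral\<^sup>L lborel (v t j j' i) = 2 * pi * (\<integral>s. U j i (vec_nth t i + s) * cnj (U j' i s) \<partial>lborel)"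
      unfolding v_def by (rule fourier_correlation[OF U(1)[OF j(1)] B U(3)[OF j(1), rule_format] U(1)[OF j(2)] FF[OF j]])
    \<comment> \<open>Reflection s to -s passes from the correlation to the convolution form U(t -
      s) of the kernel.\<close>
    also have "(\<integral>s. U j i (vec_nth t i + s) * cnj (U j' i s) \<partial>lborel) = integral\<^sup>L lborel (u t 0 j j' i)"
      by (subst lborel_integral_real_affine[of "- 1" _ 0]) (simp_all add: u_def)
    finally show ?thesis .
  qed
  have "(\<integral>\<omega>. exp (\<i> * of_real (inner \<omega> t)) * of_real ((cmod (H \<omega>))\<^sup>2) \<partial>lborel) =
      (\<Sum>j<m. \<Sum>j'<m. \<integral>\<omega>. c j * cnj (c j') * (\<Prod>i\<in>UNIV. v t j j' i (vec_nth \<omega> i)) \<partial>lborel)"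
    unfolding HH by (subst Bochner_Integration.integral_sum; (intro sum.cong refl Bochner_Integration.integral_sum Bochner_Integration.integrable_sum HHi)?; simp)
  also have "\<dots> = (\<Sum>j<m. \<Sum>j'<m. c j * cnj (c j') * (\<Prod>i\<in>UNIV. 2 * pi * integral\<^sup>L lborel (u t 0 j j' i)))"
    by (intro sum.cong refl) (simp add: integral_prod_coords(2) v_int uv)
  also have "\<dots> = (2 * pi) ^ CARD('d) * (\<Sum>j<m. \<Sum>j'<m. c j * cnj (c j') * (\<Prod>i\<in>UNIV. integral\<^sup>L lborel (u t 0 j j' i)))"
    by (simp add: prod.distrib sum_distrib_left ac_simps)
  also have "(\<Sum>j<m. \<Sum>j'<m. c j * cnj (c j') * (\<Prod>i\<in>UNIV. integral\<^sup>L lborel (u t 0 j j' i))) =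
      (\<Sum>j<m. \<Sum>j'<m. \<integral>s. c j * cnj (c j') * (\<Prod>i\<in>UNIV. u t 0 j j' i (vec_nth s i)) \<partial>lborel)"
    by (intro sum.cong refl) (simp add: integral_prod_coords(2) u_int)
  also have "\<dots> = (\<integral>s. g t s * cnj (g 0 s) \<partial>lborel)"
    unfolding gg by (subst Bochner_Integration.integral_sum; (intro sum.cong refl Bochner_Integration.integral_sum[symmetric] Bochner_Integration.integrable_sum ggi)?; simp)
  finally show "(\<integral>\<omega>. exp (\<i> * of_real (inner \<omega> t)) * of_real ((cmod (H \<omega>))\<^sup>2) \<partial>lborel) =
      (2 * pi) ^ CARD('d) * (\<integral>s. g t s * cnj (g 0 s) \<partial>lborel)" .
qed

section \<open>Causal entries of the matrix exponential\<close>

context stable_poly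
begin

definition entry :: "nat \<times> nat \<Rightarrow> real \<Rightarrow> complex" where
  "entry kl x = of_real (causal (linear_recurrence.W (top_row (snd kl)) (fst kl)) x)"

lemma entry_hat_eq_fourier:
  assumes "snd kl < p"
  shows "entry_hat kl = fourier (entry kl)"
proof -
  interpret linear_recurrence a "top_row (snd kl)" by (rule linear_recurrence_top_row[OF assms])
  show ?thesis unfolding entry_hat_def W_hat_def entry_def[abs_def] ..
qed

lemma entry_props:
  assumes "snd kl < p"
  shows "integrable lborel (entry kl)" "\<exists>B. \<forall>x. cmod (entry kl x) \<le> B" "\<forall>x. x \<noteq> 0 \<longrightarrow> isCont (entry kl) x"
proof -
  interpret linear_recurrence a "top_row (snd kl)" by (rule linear_recurrence_top_row[OF assms])
  show "integrable lborel (entry kl)"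
    unfolding entry_def[abs_def] by (rule integrable_causal_W_of_real)
  show "\<forall>x. x \<noteq> 0 \<longrightarrow> isCont (entry kl) x"
    unfolding entry_def[abs_def] using causal_W_isCont by blast
  show "\<exists>B. \<forall>x. cmod (entry kl x) \<le> B"
    using exp_decay_causal(2)[OF W_exp_decay W_measurable] by (simp add: entry_def)
qed

lemma mat_exp_entry:
  assumes "fst kl < p" "snd kl < p"
  shows "entry kl x = (if 0 \<le> x then of_real (mat_exp (x \<cdot>\<^sub>m A) $$ kl) else 0)"
  using mat_exp_companion[OF assms, of x] by (simp add: entry_def causal_def)

lemma integrable_entry_hat_product:
  assumes "snd kl < p" "snd kl' < p"
  shows "integrable lborel (\<lambda>\<omega>. entry_hat kl \<omega> * cnj (entry_hat kl' \<omega>))"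
proof -
  have *: "entry_hat kl \<in> borel_measurable borel" "\<exists>C. \<forall>\<omega>. (cmod (entry_hat kl \<omega>))\<^sup>2 \<le> C * inverse (1 + \<omega>\<^sup>2)"
    if kl: "snd kl < p" for kl
  proof -
    interpret linear_recurrence a "top_row (snd kl)" by (rule linear_recurrence_top_row[OF kl])
    have "entry_hat kl = W_hat (fst kl)" by (rule entry_hat_def)
    then show "entry_hat kl \<in> borel_measurable borel"
      "\<exists>C. \<forall>\<omega>. (cmod (entry_hat kl \<omega>))\<^sup>2 \<le> C * inverse (1 + \<omega>\<^sup>2)"
      using W_hat_bound[of "fst kl"] by simp_all
  qed
  note [measurable] = *(1)[OF assms(1)] *(1)[OF assms(2)]
  obtain C C' where C: "\<And>\<omega>. (cmod (entry_hat kl \<omega>))\<^sup>2 \<le> C * inverse (1 + \<omega>\<^sup>2)"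
    and C': "\<And>\<omega>. (cmod (entry_hat kl' \<omega>))\<^sup>2 \<le> C' * inverse (1 + \<omega>\<^sup>2)"
    using *(2)[OF assms(1)] *(2)[OF assms(2)] by blast
  show ?thesis
  proof (rule Bochner_Integration.integrable_bound)
    show "integrable lborel (\<lambda>\<omega>::real. (C + C') * inverse (1 + \<omega>\<^sup>2))"
      by (intro integrable_mult_right integrable_inverse_1_plus_square')
    show "AE \<omega> in lborel. norm (entry_hat kl \<omega> * cnj (entry_hat kl' \<omega>)) \<le> norm ((C + C') * inverse (1 + \<omega>\<^sup>2))"
    proof (rule AE_I2)
      fix \<omega> :: real
      have "norm (entry_hat kl \<omega> * cnj (entry_hat kl' \<omega>)) = cmod (entry_hat kl \<omega>) * cmod (entry_hat kl' \<omega>)" by (simp add: norm_mult)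
      also have "\<dots> \<le> (cmod (entry_hat kl \<omega>))\<^sup>2 + (cmod (entry_hat kl' \<omega>))\<^sup>2"
      proof -
        have "0 \<le> cmod (entry_hat kl \<omega>) * cmod (entry_hat kl' \<omega>)" by simp
        then show ?thesis using sum_squares_bound[of "cmod (entry_hat kl \<omega>)" "cmod (entry_hat kl' \<omega>)"] by linarith
      qed
      also have "\<dots> \<le> (C + C') * inverse (1 + \<omega>\<^sup>2)"
        using C[of \<omega>] C'[of \<omega>] by (simp add: distrib_right)
      finally show "norm (entry_hat kl \<omega> * cnj (entry_hat kl' \<omega>)) \<le> norm ((C + C') * inverse (1 + \<omega>\<^sup>2))"
        unfolding real_norm_def by (rule order_trans[OF _ abs_ge_self])
    qed
  qed measurable
qed

lemma poly_imaginary_nonzero: "poly (map_poly of_real a) (\<i> * of_real \<omega>) \<noteq> 0"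
  using stable[of "\<i> * of_real \<omega>"] by auto

end

text \<open>Carries the real kernel over to the complex numbers, where the expansion into entries is
  stated.\<close>

lemma (in semiring_hom) coord_mat_prod_hom:
  assumes N: "\<And>i. N i \<in> carrier_mat p p"
  shows "map_mat hom (coord_mat_prod p N) = coord_mat_prod p (\<lambda>i. map_mat hom (N i))"
proof -
  have "map_mat hom (foldr (\<lambda>i R. N i * R) xs (1\<^sub>m p)) = foldr (\<lambda>i R. map_mat hom (N i) * R) xs (1\<^sub>m p)" for xs
  proof (induction xs)
    case (Cons x xs)
    then show ?case using mat_hom_mult[OF N[of x] foldr_mat_carrier[of N p xs, OF N]] by simp
  qed (simp add: mat_hom_one)
  then show ?thesis by (simp add: coord_mat_prod_def)
qed

lemma (in semiring_hom) scalar_prod_mat_vec_hom: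
  assumes "v \<in> carrier_vec n" "C \<in> carrier_mat n n" "k < n"
  shows "hom (scalar_prod v (C *\<^sub>v unit_vec n k)) = scalar_prod (map_vec hom v) (map_mat hom C *\<^sub>v unit_vec n k)"
proof -
  have 1: "scalar_prod v (C *\<^sub>v unit_vec n k) = (\<Sum>i<n. v $ i * C $$ (i, k))"
    using assms by (simp add: scalar_prod_def[of v] scalar_prod_right_unit atLeast0LessThan)
  have 2: "scalar_prod (map_vec hom v) (map_mat hom C *\<^sub>v unit_vec n k) = (\<Sum>i<n. hom (v $ i) * hom (C $$ (i, k)))"
    using assms by (simp add: scalar_prod_def[of "map_vec hom v"] scalar_prod_right_unit atLeast0LessThan)
  show ?thesis unfolding 1 2 by (simp add: hom_sum hom_mult)
qed

section \<open>The spectral density\<close>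

text \<open>The existential quantifier determines \<open>Qs\<close>: the inverse over the rational
  functions is unique and \<open>to_fract\<close> is injective, so only one matrix satisfies
  \<open>is_scaled_resolvent\<close> for each i.\<close>

theorem proposition2p5:
  fixes M :: "'w measure"
    and \<Lambda> :: "(real^'d::{finite,linorder}) set \<Rightarrow> 'w \<Rightarrow> real"
    and \<beta> \<sigma> :: real and \<nu> :: "real measure"
    and p q :: nat and b :: "real Matrix.vec" and a :: "'d \<Rightarrow> real poly"
    and Y :: "real^'d::{finite,linorder} \<Rightarrow> 'w \<Rightarrow> real"
  assumes "prob_space M"
    and "causal_carma_field M \<Lambda> \<beta> \<sigma> \<nu> p q b a Y"
    and "levy_finite_second_moment \<nu>"
  shows "\<exists>Qs :: 'd \<Rightarrow> real poly mat.
    (\<forall>i. is_scaled_resolvent (a i) (Qs i)) \<and>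
    (\<forall>i. \<forall>k\<in>{1..p}. \<forall>l\<in>{1..p}. Qs i $$ (k - 1, l - 1) =
       (if k \<le> l
        then monom 1 (p + k - 1 - l) + (\<Sum>j=1..p-l. monom (acoeff (a i) j) (p + k - 1 - j - l))
        else - (\<Sum>j=p-l+1..p. monom (acoeff (a i) j) (p + k - 1 - j - l)))) \<and>
    is_spectral_density M Y (\<lambda>w. levy_variance \<sigma> \<nu> / (2 * pi) ^ CARD('d) *
       (cmod (carma_Q p b Qs (imag_vec w) / carma_P a (imag_vec w)))\<^sup>2)"
proof -
  interpret prob_space M by fact
  interpret square_integrable_levy_basis M \<Lambda> \<beta> \<sigma> \<nu>
    using assms by unfold_locales (auto simp: causal_carma_field_def)
  have hom: "semiring_hom complex_of_real" by unfold_locales auto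
  have p: "0 < p" and b: "b \<in> carrier_vec p" and deg: "\<And>i. degree (a i) = p"
    and sp: "\<And>i. stable_poly (a i)"
    using assms(2) by (auto simp: causal_carma_field_def carma_parameters_def stable_poly_def)
  define f where "f t s = (if \<forall>i. vec_nth s i \<le> vec_nth t i then carma_kernel p b a (t - s) else 0)" for t s :: "real^'d::{finite,linorder}"
  have Y: "has_levy_integral M \<Lambda> (f t) (Y t)" for t
    using assms(2) by (auto simp: causal_carma_field_def f_def[abs_def])
  define Qs where "Qs i = stable_poly.resolvent_numerator (a i)" for i
  have Qs_carrier: "Qs i \<in> carrier_mat p p" for i
    using stable_poly.resolvent_numerator_carrier[OF sp, of i] by (simp add: Qs_def deg)
  have b': "map_vec complex_of_real b \<in> carrier_vec p" using b by simp
  \<comment> \<open>Instantiated twice: with the matrix exponentials in \<open>f_eq\<close> and with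
    the values of the matrix polynomials in \<open>H\<close>. Hence both have the same c and
    \<kappa>.\<close>
  obtain m c and \<kappa> :: "nat \<Rightarrow> 'd \<Rightarrow> nat \<times> nat" where \<kappa>: "\<And>j i. fst (\<kappa> j i) < p" "\<And>j i. snd (\<kappa> j i) < p"
    and expand: "\<And>N :: 'd \<Rightarrow> complex mat. (\<And>i. N i \<in> carrier_mat p p) \<Longrightarrow>
      scalar_prod (map_vec complex_of_real b) (coord_mat_prod p N *\<^sub>v unit_vec p (p - 1)) =
        (\<Sum>j<m. c j * (\<Prod>i\<in>UNIV. N i $$ \<kappa> j i))"
    using coord_mat_prod_expansion[OF b' p, where 'd='d] by blast
  define U where "U j i = stable_poly.entry (a i) (\<kappa> j i)" for j i
  define F where "F j i = stable_poly.entry_hat (a i) (\<kappa> j i)" for j i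
  have FU: "F j i = fourier (U j i)" for j i
    unfolding F_def U_def by (rule stable_poly.entry_hat_eq_fourier[OF sp]) (simp add: deg \<kappa>)
  have f_eq: "complex_of_real (f t s) = (\<Sum>j<m. c j * (\<Prod>i\<in>UNIV. U j i (vec_nth t i - vec_nth s i)))" for t s
  proof (cases "\<forall>i. vec_nth s i \<le> vec_nth t i")
    case True
    define N where "N i = mat_exp (vec_nth (t - s) i \<cdot>\<^sub>m companion (a i))" for i
    have N: "N i \<in> carrier_mat p p" for i
      using companion_carrier[of "a i"] by (simp add: N_def mat_exp_def deg)
    have "complex_of_real (f t s) = of_real (scalar_prod b (coord_mat_prod p N *\<^sub>v unit_vec p (p - 1)))"
      using True by (simp add: f_def carma_kernel_def N_def[abs_def])
    also have "\<dots> = scalar_prod (map_vec of_real b)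
        (coord_mat_prod p (\<lambda>i. map_mat of_real (N i)) *\<^sub>v unit_vec p (p - 1))"
      using semiring_hom.scalar_prod_mat_vec_hom[OF hom b coord_mat_prod_carrier[OF N], of "p - 1"] p
      by (simp add: semiring_hom.coord_mat_prod_hom[OF hom N])
    also have "\<dots> = (\<Sum>j<m. c j * (\<Prod>i\<in>UNIV. map_mat of_real (N i) $$ \<kappa> j i))"
      by (rule expand) (simp add: N)
    also have "\<dots> = (\<Sum>j<m. c j * (\<Prod>i\<in>UNIV. U j i (vec_nth t i - vec_nth s i)))"
    proof (intro sum.cong prod.cong refl arg_cong2[where f="(*)"])
      fix j i
      have "map_mat complex_of_real (N i) $$ \<kappa> j i = of_real (N i $$ \<kappa> j i)"
        using N[of i] \<kappa>[of j i] by (cases "\<kappa> j i") auto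
      also have "\<dots> = U j i (vec_nth t i - vec_nth s i)"
        unfolding U_def using True
        by (subst stable_poly.mat_exp_entry[OF sp]) (simp_all add: N_def deg \<kappa>)
      finally show "map_mat complex_of_real (N i) $$ \<kappa> j i = U j i (vec_nth t i - vec_nth s i)" .
    qed
    finally show ?thesis .
  next
    case False
    \<comment> \<open>One negative coordinate annihilates a factor of every term, so the products of
      causal entries reproduce the cut-off of the kernel outside the orthant.\<close>
    then obtain i where i: "vec_nth t i - vec_nth s i < 0" by (auto simp: not_le)
    have "U j i (vec_nth t i - vec_nth s i) = 0" for j
      unfolding U_def using i by (subst stable_poly.mat_exp_entry[OF sp]) (simp_all add: deg \<kappa>)
    then have "(\<Prod>i\<in>UNIV. U j i (vec_nth t i - vec_nth s i)) = 0" for j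
      by (intro prod_zero) auto
    then show ?thesis using False by (auto simp: f_def simp del: prod_zero_iff)
  qed
  define H where "H \<omega> = (\<Sum>j<m. c j * (\<Prod>i\<in>UNIV. fourier (U j i) (vec_nth \<omega> i)))" for \<omega> :: "real^'d::{finite,linorder}"
  have H: "carma_Q p b Qs (imag_vec w) / carma_P a (imag_vec w) = H w" for w
  proof -
    have P0: "carma_P a (imag_vec w) \<noteq> 0"
      using stable_poly.poly_imaginary_nonzero[OF sp] by (simp add: carma_P_def imag_vec_def)
    have "carma_Q p b Qs (imag_vec w) =
        (\<Sum>j<m. c j * (\<Prod>i\<in>UNIV. map_mat (\<lambda>r. poly (map_poly of_real r) (vec_nth (imag_vec w) i)) (Qs i) $$ \<kappa> j i))"
      unfolding carma_Q_def by (rule expand) (simp add: Qs_carrier)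
    also have "\<dots> = (\<Sum>j<m. c j * (\<Prod>i\<in>UNIV. poly (map_poly of_real (a i)) (vec_nth (imag_vec w) i) * F j i (vec_nth w i)))"
    proof (intro sum.cong prod.cong refl arg_cong2[where f="(*)"])
      fix j i
      have "map_mat (\<lambda>r. poly (map_poly of_real r) (vec_nth (imag_vec w) i)) (Qs i) $$ \<kappa> j i =
          poly (map_poly of_real (Qs i $$ \<kappa> j i)) (\<i> * vec_nth w i)"
        using Qs_carrier[of i] \<kappa>[of j i] by (cases "\<kappa> j i") (auto simp: imag_vec_def)
      also have "\<dots> = poly (map_poly of_real (a i)) (\<i> * vec_nth w i) * F j i (vec_nth w i)"
        using stable_poly.resolvent_numerator_entry_hat[OF sp, of "fst (\<kappa> j i)" i "snd (\<kappa> j i)" "vec_nth w i"] \<kappa>[of j i]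
        by (simp add: deg Qs_def F_def)
      finally show "map_mat (\<lambda>r. poly (map_poly of_real r) (vec_nth (imag_vec w) i)) (Qs i) $$ \<kappa> j i =
          poly (map_poly of_real (a i)) (vec_nth (imag_vec w) i) * F j i (vec_nth w i)"
        by (simp add: imag_vec_def)
    qed
    \<comment> \<open>Every term contains exactly one entry for each coordinate, so the same product
      of denominators comes out of all of them.\<close>
    also have "\<dots> = carma_P a (imag_vec w) * H w"
      by (simp add: carma_P_def H_def FU prod.distrib sum_distrib_left mult.left_commute)
    finally show ?thesis using P0 by simp
  qed
  have U_props: "integrable lborel (U j i)" "\<exists>B. \<forall>x. cmod (U j i x) \<le> B" "\<forall>x. x \<noteq> 0 \<longrightarrow> isCont (U j i) x" for j i
    using stable_poly.entry_props[OF sp, of "\<kappa> j i" i] by (auto simp: U_def deg \<kappa>)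
  have FF: "integrable lborel (\<lambda>\<omega>. fourier (U j i) \<omega> * cnj (fourier (U j' i) \<omega>))" for j j' i
    using stable_poly.integrable_entry_hat_product[OF sp, of "\<kappa> j i" i "\<kappa> j' i"]
    by (simp add: FU[symmetric] F_def deg \<kappa>)
  note planch = product_plancherel[where U=U and c=c and m=m, OF U_props FF, folded f_eq H_def]
  have f2: "integrable lborel (\<lambda>s. (f t s)\<^sup>2)" for t
    using integrable_Re[OF planch(1)[of t t]] by (simp add: power2_eq_square)
  have dens: "is_spectral_density M Y (\<lambda>w. levy_variance \<sigma> \<nu> / (2 * pi) ^ CARD('d) *
      (cmod (carma_Q p b Qs (imag_vec w) / carma_P a (imag_vec w)))\<^sup>2)"
    unfolding is_spectral_density_def H
  proof (intro conjI allI)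
    show "Y t \<in> borel_measurable M" "integrable M (\<lambda>\<omega>. (Y t \<omega>)\<^sup>2)" for t
      using variance_levy_integral[OF Y f2] by auto
    show "integrable lborel (\<lambda>w. levy_variance \<sigma> \<nu> / (2 * pi) ^ CARD('d) * (cmod (H w))\<^sup>2)"
      by (intro integrable_mult_right planch(2))
    fix t
    have "(\<integral>w. exp (\<i> * of_real (inner w t)) * of_real (levy_variance \<sigma> \<nu> / (2 * pi) ^ CARD('d) * (cmod (H w))\<^sup>2) \<partial>lborel) =
        (\<integral>w. of_real (levy_variance \<sigma> \<nu> / (2 * pi) ^ CARD('d)) * (exp (\<i> * of_real (inner w t)) * of_real ((cmod (H w))\<^sup>2)) \<partial>lborel)"
      by (intro Bochner_Integration.integral_cong refl) (simp only: of_real_mult mult.left_commute)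
    also have "\<dots> = of_real (levy_variance \<sigma> \<nu> / (2 * pi) ^ CARD('d)) *
        ((2 * pi) ^ CARD('d) * (\<integral>s. of_real (f t s) * cnj (of_real (f 0 s)) \<partial>lborel))"
      unfolding integral_mult_right_zero planch(3) ..
    also have "(\<integral>s. complex_of_real (f t s) * cnj (of_real (f 0 s)) \<partial>lborel) = of_real (\<integral>s. f t s * f 0 s \<partial>lborel)"
      by (simp flip: of_real_mult)
    \<comment> \<open>The normalisation of the density cancels the (2 pi)^d of Parseval's
      identity.\<close>
    also have "complex_of_real (levy_variance \<sigma> \<nu> / (2 * pi) ^ CARD('d)) * (complex_of_real ((2 * pi) ^ CARD('d)) * complex_of_real (\<integral>s. f t s * f 0 s \<partial>lborel)) =
        complex_of_real (levy_variance \<sigma> \<nu> * (\<integral>s. f t s * f 0 s \<partial>lborel))"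
      by simp
    also have "\<dots> = of_real (covariance M (Y t) (Y 0))"
      by (simp only: covariance_levy_integral[OF Y f2 Y f2])
    finally show "complex_of_real (covariance M (Y t) (Y 0)) =
        (\<integral>w. exp (\<i> * of_real (inner w t)) * of_real (levy_variance \<sigma> \<nu> / (2 * pi) ^ CARD('d) * (cmod (H w))\<^sup>2) \<partial>lborel)" ..
  qed
  show ?thesis
  proof (intro exI[of _ Qs] conjI allI ballI dens)
    show "is_scaled_resolvent (a i) (Qs i)" for i
      unfolding Qs_def by (rule stable_poly.is_scaled_resolvent_numerator[OF sp])
    fix i k l assume "k \<in> {1..p}" "l \<in> {1..p}"
    then show "Qs i $$ (k - 1, l - 1) =
       (if k \<le> l
        then monom 1 (p + k - 1 - l) + (\<Sum>j=1..p-l. monom (acoeff (a i) j) (p + k - 1 - j - l))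
        else - (\<Sum>j=p-l+1..p. monom (acoeff (a i) j) (p + k - 1 - j - l)))"
      using stable_poly.resolvent_numerator_formula[OF sp, of k i l] unfolding Qs_def deg by blast
  qed
qed

end
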